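(* Let $d\ge1$. (a) Fix $1 \leq p < \infty$. A nontrivial function $\varphi$ in $H^p(\mathbb{T}^d)$ is a Hilbert point in $H^p(\mathbb{T}^d)$ if and only if there is some constant $\lambda>0$ such that $$P\left(|\varphi|^{p-2} \varphi\right) = \lambda \varphi.$$ (b) Fix $1 \leq p \leq \infty$. A nontrivial function $\varphi$ in $H^p(\mathbb{T}^d)\cap H^2(\mathbb{T}^d)$ is a Hilbert point in $H^p(\mathbb{T}^d)$ if and only if $$\|\varphi\|_{H^p(\mathbb{T}^d)} \|\varphi\|_{(H^p(\mathbb{T}^d))^\ast} = \|\varphi\|_{H^2(\mathbb{T}^d)}^2.$$
   Context: $\mathbb{T}^d$ is the $d$-dimensional torus with normalized Haar measure $m_d$; $\widehat f(\alpha)=\int_{\mathbb{T}^d} f(z)\overline{z^\alpha}\,dm_d(z)$ for $\alpha\in\mathbb{Z}^d$. The Hardy space $H^p(\mathbb{T}^d)$ is the closed subspace of $L^p(\mathbb{T}^d)$ of functions $f$ with $\widehat f(\alpha)=0$ for all $\alpha\in\mathbb{Z}^d\setminus\mathbb{N}_0^d$, $\mathbb{N}_0=\{0,1,2,\ldots\}$, with the $L^p$ norm $\|\cdot\|_{H^p(\mathbb{T}^d)}$. Write $\langle f,g\rangle=\int_{\mathbb{T}^d} f\overline g\,dm_d$. $P$ is the Riesz projection, i.e. the orthogonal projection from $L^2(\mathbb{T}^d)$ onto $H^2(\mathbb{T}^d)$, extended to a bounded operator on $L^q(\mathbb{T}^d)$ for $1<q<\infty$; thus $Pf$ has Fourier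 series $\sum_{\alpha\in\mathbb{N}_0^d}\widehat f(\alpha)z^\alpha$. The function $|\varphi|^{p-2}\varphi$ is understood to be $0$ where $\varphi=0$. A nontrivial (i.e. not a.e. zero) function $\varphi$ in $H^p(\mathbb{T}^d)$, $1\le p\le\infty$, is a Hilbert point in $H^p(\mathbb{T}^d)$ if $\|\varphi\|_{H^p(\mathbb{T}^d)}\le\|\varphi+f\|_{H^p(\mathbb{T}^d)}$ for every $f\in H^p(\mathbb{T}^d)$ such that $\langle f,\varphi\rangle=0$. When $1\le p<2$, the condition $\langle f,\varphi\rangle=0$ is declared to mean that $f$ lies in the closure in $H^p(\mathbb{T}^d)$ of the set of analytic polynomials $g$ with $\langle g,\varphi\rangle=0$. A function $\varphi$ is said to be in $(H^p(\mathbb{T}^d))^\ast$ if $f\mapsto\langle f,\varphi\rangle$ defines a bounded linear functional on $H^p(\mathbb{T}^d)$ (for $1\le p<2$, defined first on polynomials and extended by continuity), and $$\|\varphi\|_{(H^p(\mathbb{T}^d))^\ast}=\sup_{g\in H^p(\mathbb{T}^d),\ g\not\equiv0}\frac{|\langle g,\varphi\rangle|}{\|g\|_{H^p(\mathbb{T}^d)}},$$ which is $+\infty$ if the functional is not bounded. *)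

theory Defs
  imports "HOL-Probability.Probability"
begin

section \<open>The torus, Fourier coefficients and Lebesgue spaces\<close>

text \<open>The dimension \<open>d \<ge> 1\<close> is \<open>CARD('d)\<close>, so points of the torus are functions
  \<open>'d \<Rightarrow> complex\<close> with unimodular values, and multi-indices are functions \<open>'d \<Rightarrow> int\<close>.
  The normalized Haar measure is the product of normalized arc length measures; its space is
  the torus itself, so values of functions off the torus play no role.\<close>

definition circle_haar :: "complex measure" where
  "circle_haar =
     distr (uniform_measure lborel {0..1}) (restrict_space borel (sphere 0 1))
       (\<lambda>t::real. cis (2 * pi * t))"

definition torus_haar :: "('d::finite \<Rightarrow> complex) measure" where
  "torus_haar = (\<Pi>\<^sub>M i\<in>UNIV. circle_haar)"

lemma prob_space_circle_haar: "prob_space circle_haar"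
proof -
  interpret prob_space "uniform_measure lborel {0..1::real}"
    by (rule prob_space_uniform_measure) auto
  have "(\<lambda>t::real. cis (2 * pi * t)) \<in> borel_measurable borel"
    by (intro borel_measurable_continuous_onI continuous_intros)
  then have "(\<lambda>t::real. cis (2 * pi * t)) \<in>
      measurable (uniform_measure lborel {0..1}) (restrict_space borel (sphere 0 1))"
    by (intro measurable_restrict_space2) (auto simp: measurable_def)
  then show ?thesis
    unfolding circle_haar_def by (rule prob_space_distr)
qed

lemma prob_space_torus_haar: "prob_space (torus_haar :: ('d::finite \<Rightarrow> complex) measure)"
  unfolding torus_haar_def by (intro prob_space_PiM prob_space_circle_haar)

lemma space_torus_haar:
  "space (torus_haar :: ('d::finite \<Rightarrow> complex) measure) = {z. \<forall>i. cmod (z i) = 1}"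
  by (auto simp: torus_haar_def circle_haar_def space_PiM space_restrict_space PiE_def Pi_def)

definition character :: "('d::finite \<Rightarrow> int) \<Rightarrow> ('d \<Rightarrow> complex) \<Rightarrow> complex" where
  "character \<alpha> z = (\<Prod>i\<in>UNIV. z i powi \<alpha> i)"

definition nonneg_indices :: "('d::finite \<Rightarrow> int) set" where
  "nonneg_indices = {\<alpha>. \<forall>i. 0 \<le> \<alpha> i}"

definition pairing ::
    "(('d::finite \<Rightarrow> complex) \<Rightarrow> complex) \<Rightarrow> (('d \<Rightarrow> complex) \<Rightarrow> complex) \<Rightarrow> complex" where
  "pairing f g = (LINT z|torus_haar. f z * cnj (g z))"

definition fourier :: "(('d::finite \<Rightarrow> complex) \<Rightarrow> complex) \<Rightarrow> ('d \<Rightarrow> int) \<Rightarrow> complex" where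
  "fourier f \<alpha> = (LINT z|torus_haar. f z * cnj (character \<alpha> z))"

text \<open>Elements of Lebesgue spaces are represented by functions rather than by classes modulo
  a.e. equality. \<open>lp_norm p f\<close> is only meaningful for \<open>f \<in> lp_space p\<close> and \<open>1 \<le> p\<close>.\<close>

definition lp_space :: "ereal \<Rightarrow> (('d::finite \<Rightarrow> complex) \<Rightarrow> complex) set" where
  "lp_space p =
     {f \<in> borel_measurable torus_haar.
        if p = \<infinity> then \<exists>C::real. AE z in torus_haar. cmod (f z) \<le> C
        else integrable torus_haar (\<lambda>z. cmod (f z) powr real_of_ereal p)}"

definition lp_norm :: "ereal \<Rightarrow> (('d::finite \<Rightarrow> complex) \<Rightarrow> complex) \<Rightarrow> real" where
  "lp_norm p f =
     (if p = \<infinity> then real_of_ereal (esssup torus_haar (\<lambda>z. ereal (cmod (f z))))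
      else (LINT z|torus_haar. cmod (f z) powr real_of_ereal p) powr (1 / real_of_ereal p))"

definition lp_tendsto ::
    "ereal \<Rightarrow> (nat \<Rightarrow> ('d::finite \<Rightarrow> complex) \<Rightarrow> complex) \<Rightarrow> (('d \<Rightarrow> complex) \<Rightarrow> complex) \<Rightarrow> bool"
  where
  "lp_tendsto p F f \<longleftrightarrow>
     (\<forall>n. F n \<in> lp_space p) \<and> f \<in> lp_space p \<and>
     (\<lambda>n. lp_norm p (\<lambda>z. F n z - f z)) \<longlonglongrightarrow> 0"

definition nontrivial :: "(('d::finite \<Rightarrow> complex) \<Rightarrow> complex) \<Rightarrow> bool" where
  "nontrivial f \<longleftrightarrow> \<not> (AE z in torus_haar. f z = 0)"

section \<open>Hardy spaces and the Riesz projection\<close>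

definition hardy :: "ereal \<Rightarrow> (('d::finite \<Rightarrow> complex) \<Rightarrow> complex) set" where
  "hardy p = {f \<in> lp_space p. \<forall>\<alpha>. \<alpha> \<notin> nonneg_indices \<longrightarrow> fourier f \<alpha> = 0}"

definition analytic_polys :: "(('d::finite \<Rightarrow> complex) \<Rightarrow> complex) set" where
  "analytic_polys =
     {(\<lambda>z. \<Sum>\<alpha>\<in>A. c \<alpha> * character \<alpha> z) | A c. finite A \<and> A \<subseteq> nonneg_indices}"

text \<open>\<open>h\<close> is (a representative of) the orthogonal projection of \<open>f\<close> in \<open>L\<^sup>2\<close> onto \<open>H\<^sup>2\<close>.\<close>

definition is_orth_proj ::
    "(('d::finite \<Rightarrow> complex) \<Rightarrow> complex) \<Rightarrow> (('d \<Rightarrow> complex) \<Rightarrow> complex) \<Rightarrow> bool" where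
  "is_orth_proj f h \<longleftrightarrow>
     f \<in> lp_space 2 \<and> h \<in> hardy 2 \<and> (\<forall>g\<in>hardy 2. pairing (\<lambda>z. f z - h z) g = 0)"

text \<open>The Riesz projection \<open>P\<close>, as the relation \<open>P f = h\<close> (a.e.): \<open>f\<close> lies in some \<open>L\<^sup>q\<close>,
  \<open>1 < q < \<infinity>\<close>, and \<open>h\<close> is the value at \<open>f\<close> of the extension by continuity to \<open>L\<^sup>q\<close> of the
  orthogonal projection. For different \<open>q\<close> these extensions agree a.e. on common arguments, since
  \<open>L\<^sup>q\<close> convergence determines the Fourier coefficients of \<open>h\<close>; for \<open>f\<close> in \<open>L\<^sup>2\<close> (in particular
  in \<open>L\<^sup>q\<close> with \<open>q \<ge> 2\<close>) one recovers the orthogonal projection.\<close>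

definition is_riesz_proj ::
    "(('d::finite \<Rightarrow> complex) \<Rightarrow> complex) \<Rightarrow> (('d \<Rightarrow> complex) \<Rightarrow> complex) \<Rightarrow> bool" where
  "is_riesz_proj f h \<longleftrightarrow>
     (\<exists>q::real. 1 < q \<and>
       (\<exists>F G. (\<forall>n. is_orth_proj (F n) (G n)) \<and>
          lp_tendsto (ereal q) F f \<and> lp_tendsto (ereal q) G h))"

section \<open>Hilbert points and the dual norm\<close>

text \<open>The meaning of \<open>\<langle>f, \<phi>\<rangle> = 0\<close> for \<open>f\<close> in \<open>H\<^sup>p\<close>; for \<open>p < 2\<close> the product of \<open>f\<close> and
  \<open>\<phi>\<close> need not be integrable.\<close>

definition hardy_orthogonal ::
    "ereal \<Rightarrow> (('d::finite \<Rightarrow> complex) \<Rightarrow> complex) \<Rightarrow> (('d \<Rightarrow> complex) \<Rightarrow> complex) \<Rightarrow> bool" where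
  "hardy_orthogonal p f \<phi> \<longleftrightarrow>
     (if p < 2
      then \<exists>G. (\<forall>n. G n \<in> analytic_polys \<and> pairing (G n) \<phi> = 0) \<and> lp_tendsto p G f
      else pairing f \<phi> = 0)"

definition hilbert_point :: "ereal \<Rightarrow> (('d::finite \<Rightarrow> complex) \<Rightarrow> complex) \<Rightarrow> bool" where
  "hilbert_point p \<phi> \<longleftrightarrow>
     \<phi> \<in> hardy p \<and> nontrivial \<phi> \<and>
     (\<forall>f\<in>hardy p. hardy_orthogonal p f \<phi> \<longrightarrow> lp_norm p \<phi> \<le> lp_norm p (\<lambda>z. \<phi> z + f z))"

definition in_hardy_dual :: "ereal \<Rightarrow> (('d::finite \<Rightarrow> complex) \<Rightarrow> complex) \<Rightarrow> bool" where
  "in_hardy_dual p \<phi> \<longleftrightarrow>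
     (if p < 2
      then \<exists>C. \<forall>g\<in>analytic_polys. integrable torus_haar (\<lambda>z. g z * cnj (\<phi> z)) \<and>
                 cmod (pairing g \<phi>) \<le> C * lp_norm p g
      else \<exists>C. \<forall>g\<in>hardy p. integrable torus_haar (\<lambda>z. g z * cnj (\<phi> z)) \<and>
                 cmod (pairing g \<phi>) \<le> C * lp_norm p g)"

text \<open>The functional induced by \<open>\<phi>\<close>, extended by continuity from polynomials when \<open>p < 2\<close>;
  meaningful for \<open>in_hardy_dual p \<phi>\<close> and \<open>g \<in> hardy p\<close>.\<close>

definition dual_pairing ::
    "ereal \<Rightarrow> (('d::finite \<Rightarrow> complex) \<Rightarrow> complex) \<Rightarrow> (('d \<Rightarrow> complex) \<Rightarrow> complex) \<Rightarrow> complex" where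
  "dual_pairing p g \<phi> =
     (if p < 2
      then THE c. \<forall>G. (\<forall>n. G n \<in> analytic_polys) \<and> lp_tendsto p G g
                       \<longrightarrow> (\<lambda>n. pairing (G n) \<phi>) \<longlonglongrightarrow> c
      else pairing g \<phi>)"

definition hardy_dual_norm :: "ereal \<Rightarrow> (('d::finite \<Rightarrow> complex) \<Rightarrow> complex) \<Rightarrow> ereal" where
  "hardy_dual_norm p \<phi> =
     (if in_hardy_dual p \<phi>
      then (SUP g\<in>{g \<in> hardy p. nontrivial g}. ereal (cmod (dual_pairing p g \<phi>) / lp_norm p g))
      else \<infinity>)"

end

theory Submission
  imports Defs "HOL-Complex_Analysis.Conformal_Mappings"
begin

text \<open>Let \<open>\<psi>\<close> be \<open>duality_map p \<phi>\<close>, the function whose Riesz projection is taken in part (a). Both parts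
  rest on the fact that \<open>\<phi>\<close> is a Hilbert point iff the Fourier coefficients of \<open>\<psi>\<close> and \<open>c \<phi>\<close> agree on
  nonnegative indices for some \<open>c > 0\<close>. One direction is Holder's inequality with its equality case
  \<open>pairing \<phi> \<psi> = Ip p \<phi>\<close>; the other differentiates \<open>t \<mapsto> Ip p (\<phi> + t g)\<close> at \<open>0\<close> for analytic polynomials
  \<open>g\<close> orthogonal to \<open>\<phi>\<close>. For \<open>p = 1\<close> the derivative exists because nontrivial functions in the Hardy
  space are nonzero a.e., which follows from a Jensen inequality for analytic polynomials. Fejer means
  replace the boundedness of the Riesz projection: they give the density of polynomials and, once the
  Fourier coefficients match, the sequences required in \<open>is_riesz_proj\<close> (for \<open>p = 1\<close>, matching
  coefficients force \<open>\<phi>\<close> to be square integrable).\<close>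

text \<open>For \<open>p < 2\<close> the product of \<open>\<phi>\<close> with an element of H^p
  need not be integrable, whereas pairing with \<open>\<psi>\<close> is bounded on L^p by Holder's
  inequality. Statements about \<open>\<phi>\<close> are therefore tested on analytic polynomials,
  where both pairings are finite sums of Fourier coefficients, and carried to H^p by continuity of
  the pairing with \<open>\<psi>\<close>. Fejer means suit this transfer: as averages against a
  positive kernel they contract L^p for all finite \<open>p \<ge> 1\<close>, including p = 1, where
  the Riesz projection is unbounded; as Fourier multipliers they create no new frequencies and
  commute with that projection. Zeros of \<open>\<phi>\<close> are an obstacle only for p = 1,
  because the modulus is not differentiable at the origin while its p-th power is for p > 1. The
  duality map has no counterpart at p = infinity, so part (b) is split at 2: for
  \<open>p \<ge> 2\<close> a scaling argument with the dual norm covers infinity as well, and for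
  \<open>p < 2\<close> the dual norm of a Hilbert point is found by identifying the extended
  functional with pairing against a multiple of \<open>\<psi>\<close>.\<close>

global_interpretation torus: prob_space "torus_haar :: ('d::finite \<Rightarrow> complex) measure"
  by (rule prob_space_torus_haar)

lemma borel_measurable_cnj [measurable]:
  "f \<in> borel_measurable M \<Longrightarrow> (\<lambda>x. cnj (f x)) \<in> borel_measurable M"
  by (rule borel_measurable_continuous_on[OF continuous_on_cnj[OF continuous_on_id]])

section \<open>Characters\<close>

lemma norm_character [simp]:
  assumes "z \<in> space torus_haar"
  shows "cmod (character \<alpha> z) = 1"
  using assms
  by (simp add: character_def space_torus_haar norm_power_int flip: prod_norm)

lemma character_add:
  assumes "z \<in> space torus_haar"
  shows "character (\<lambda>i. \<alpha> i + \<beta> i) z = character \<alpha> z * character \<beta> z"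
proof -
  have "z i \<noteq> 0" for i using assms by (auto simp: space_torus_haar)
      (metis norm_zero zero_neq_one)
  then show ?thesis
    by (simp add: character_def power_int_add prod.distrib)
qed

lemma cnj_character:
  assumes "z \<in> space torus_haar"
  shows "cnj (character \<alpha> z) = character (\<lambda>i. - \<alpha> i) z"
proof -
  have "cnj (z i) = inverse (z i)" for i
    using assms complex_norm_square[of "z i"]
    by (intro inverse_unique[symmetric]) (auto simp: space_torus_haar)
  then show ?thesis
    by (simp add: character_def cnj_prod power_int_minus power_int_inverse)
qed

lemma character_diff:
  assumes "z \<in> space torus_haar"
  shows "character (\<lambda>i. \<alpha> i - \<beta> i) z = character \<alpha> z * cnj (character \<beta> z)"
  using character_add[OF assms, of \<alpha> "\<lambda>i. - \<beta> i"] by (simp add: cnj_character[OF assms])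

lemma character_zero [simp]: "character (\<lambda>_. 0) z = 1"
  by (simp add: character_def)

section \<open>Haar integrals of characters\<close>

lemma circle_haar_measurable:
  "(\<lambda>t::real. cis (2 * pi * t)) \<in>
      measurable (uniform_measure lborel {0..1}) (restrict_space borel (sphere 0 1))"
proof -
  have "(\<lambda>t::real. cis (2 * pi * t)) \<in> borel_measurable borel"
    by (intro borel_measurable_continuous_onI continuous_intros)
  then show ?thesis
    by (intro measurable_restrict_space2) (auto simp: measurable_def)
qed

lemma powi_measurable_circle: "(\<lambda>z::complex. z powi n) \<in> borel_measurable (restrict_space borel (sphere 0 1))"
proof -
  have "(\<lambda>z::complex. z powi n) \<in> borel_measurable borel"
    by (cases "n \<ge> 0") (simp_all add: power_int_def)
  then show ?thesis by (rule measurable_restrict_space1)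
qed

lemma integral_powi_circle:
  "(LINT z|circle_haar. z powi n) = (if n = 0 then 1 else 0)"
proof -
  have "(LINT z|circle_haar. z powi n) =
      (LINT t|uniform_measure lborel {0..1}. cis (2 * pi * t) powi n)"
    unfolding circle_haar_def
    by (rule integral_distr[OF circle_haar_measurable powi_measurable_circle])
  also have "\<dots> = (LINT t|uniform_measure lborel {0..1}. cis (2 * pi * n * t))"
    by (simp add: cis_power_int mult_ac)
  also have "\<dots> = (LINT t|lborel. indicator {0..1} t *\<^sub>R cis (2 * pi * n * t))"
  proof -
    have "(\<lambda>t::real. cis (2 * pi * n * t)) \<in> borel_measurable borel"
      by (intro borel_measurable_continuous_onI continuous_intros)
    moreover have "uniform_measure lborel {0..1::real} = density lborel (\<lambda>x. ennreal (indicator {0..1} x))"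
      unfolding uniform_measure_def by (intro density_cong) (auto simp: indicator_def)
    ultimately show ?thesis by (simp add: integral_density)
  qed
  also have "\<dots> = (if n = 0 then 1 else 0)"
  proof (cases "n = 0")
    case True
    then show ?thesis by simp
  next
    case False
    define c where "c = \<i> * complex_of_real (2 * pi * n)"
    have c: "c \<noteq> 0" using False by (simp add: c_def)
    have cis: "cis (2 * pi * n * t) = exp (c * of_real t)" for t
      by (simp add: cis_conv_exp c_def mult_ac)
    have "(LINT t|lborel. indicator {0..1} t *\<^sub>R exp (c * of_real t)) =
        exp (c * of_real 1) / c - exp (c * of_real 0) / c"
    proof (rule integral_FTC_atLeastAtMost)
      show "((\<lambda>t. exp (c * of_real t) / c) has_vector_derivative exp (c * of_real t)) (at t within {0..1})" for t
        using c by (auto intro!: derivative_eq_intros has_vector_derivative_real_field)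
    qed (auto intro!: continuous_intros)
    moreover have "exp (c * of_real 1) = 1"
      using cis[of 1] by (metis c_def cis_multiple_2pi Ints_of_int mult.right_neutral)
    ultimately show ?thesis using False by (simp add: cis)
  qed
  finally show ?thesis .
qed

lemma integrable_powi_circle: "integrable circle_haar (\<lambda>z. z powi n)"
proof -
  interpret prob_space circle_haar by (rule prob_space_circle_haar)
  show ?thesis
  proof (rule integrable_const_bound[of _ 1])
    show "(\<lambda>z. z powi n) \<in> borel_measurable circle_haar"
      using powi_measurable_circle by (simp add: circle_haar_def)
    show "AE z in circle_haar. norm (z powi n) \<le> 1"
      by (intro AE_I2) (auto simp: circle_haar_def space_restrict_space norm_power_int)
  qed
qed

lemma product_sigma_finite_circle: "product_sigma_finite (\<lambda>_. circle_haar)"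
  by (intro product_sigma_finite.intro prob_space_imp_sigma_finite prob_space_circle_haar)

lemma component_measurable_torus [measurable]:
  "(\<lambda>z. z i) \<in> borel_measurable (torus_haar :: ('d::finite \<Rightarrow> complex) measure)"
proof -
  have "(\<lambda>z. z i) \<in> measurable (torus_haar :: ('d \<Rightarrow> complex) measure) circle_haar"
    unfolding torus_haar_def by simp
  moreover have "(\<lambda>z. z) \<in> measurable circle_haar borel"
    unfolding circle_haar_def by (simp add: measurable_restrict_space1)
  ultimately show ?thesis by (rule measurable_compose)
qed

lemma character_measurable [measurable]: "character \<alpha> \<in> borel_measurable torus_haar"
proof -
  have "(\<lambda>z. z i powi \<alpha> i) \<in> borel_measurable torus_haar" for i
    by (cases "\<alpha> i \<ge> 0") (simp_all add: power_int_def)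
  then show ?thesis
    unfolding character_def[abs_def] by measurable
qed

lemma integral_character: "(LINT z|torus_haar. character \<alpha> z) = (if \<alpha> = (\<lambda>_. 0) then 1 else 0)"
proof -
  interpret product_sigma_finite "\<lambda>_. circle_haar" by (rule product_sigma_finite_circle)
  have "(LINT z|torus_haar. character \<alpha> z) = (\<Prod>i\<in>UNIV. LINT z|circle_haar. z powi \<alpha> i)"
    unfolding character_def torus_haar_def
    by (rule product_integral_prod) (auto simp: integrable_powi_circle)
  also have "\<dots> = (if \<alpha> = (\<lambda>_. 0) then 1 else 0)"
    by (auto simp: integral_powi_circle fun_eq_iff intro!: prod_zero)
  finally show ?thesis .
qed

lemma integrable_torus_bounded:
  fixes f :: "('d::finite \<Rightarrow> complex) \<Rightarrow> 'b::{banach, second_countable_topology}"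
  assumes "f \<in> borel_measurable torus_haar" "\<And>z. z \<in> space torus_haar \<Longrightarrow> norm (f z) \<le> B"
  shows "integrable torus_haar f"
  using assms by (intro torus.integrable_const_bound[of _ B]) auto

lemma integrable_character [simp]: "integrable torus_haar (character \<alpha>)"
  by (rule integrable_torus_bounded[of _ 1]) auto

lemma integrable_mult_bounded:
  fixes f g :: "('d::finite \<Rightarrow> complex) \<Rightarrow> complex"
  assumes "integrable torus_haar f" "g \<in> borel_measurable torus_haar"
    "\<And>z. z \<in> space torus_haar \<Longrightarrow> cmod (g z) \<le> B"
  shows "integrable torus_haar (\<lambda>z. f z * g z)"
proof (rule Bochner_Integration.integrable_bound[where f="\<lambda>z. B * cmod (f z)"])
  show "AE z in torus_haar. norm (f z * g z) \<le> norm (B * cmod (f z))"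
  proof (rule AE_I2)
    fix z :: "'d \<Rightarrow> complex" assume "z \<in> space torus_haar"
    then have "cmod (f z) * cmod (g z) \<le> cmod (f z) * \<bar>B\<bar>"
      using assms(3) by (intro mult_left_mono) force+
    then show "norm (f z * g z) \<le> norm (B * cmod (f z))"
      by (simp add: norm_mult abs_mult mult.commute)
  qed
  show "(\<lambda>z. f z * g z) \<in> borel_measurable torus_haar"
    using assms by measurable
qed (use assms in auto)

lemma integrable_mult_character:
  assumes "integrable torus_haar f"
  shows "integrable torus_haar (\<lambda>z. f z * character \<alpha> z)"
    "integrable torus_haar (\<lambda>z. f z * cnj (character \<alpha> z))"
  using integrable_mult_bounded[OF assms, of "character \<alpha>" 1]
    integrable_mult_bounded[OF assms, of "\<lambda>z. cnj (character \<alpha> z)" 1] by simp_all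

section \<open>Trigonometric polynomials\<close>

text \<open>The set \<open>S\<close> of admissible frequencies is a parameter because three choices
  occur: \<open>UNIV\<close> for density, \<open>nonneg_indices\<close> for analytic polynomials,
  and the spectrum of a given function in the Jensen argument.\<close>

definition trig_polys :: "('d::finite \<Rightarrow> int) set \<Rightarrow> (('d \<Rightarrow> complex) \<Rightarrow> complex) set" where
  "trig_polys S = {(\<lambda>z. \<Sum>\<alpha>\<in>A. c \<alpha> * character \<alpha> z) | A c. finite A \<and> A \<subseteq> S}"

lemma analytic_polys_eq: "analytic_polys = trig_polys nonneg_indices"
  by (simp add: analytic_polys_def trig_polys_def)

lemma trig_polys_zero: "(\<lambda>z. 0) \<in> trig_polys S"
  unfolding trig_polys_def by (auto intro!: exI[of _ "{}"])

lemma trig_polys_character: "\<alpha> \<in> S \<Longrightarrow> (\<lambda>z. c * character \<alpha> z) \<in> trig_polys S"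
  unfolding trig_polys_def by (auto intro!: exI[of _ "{\<alpha>}"] exI[of _ "\<lambda>_. c"])

lemma trig_polys_add:
  assumes "f \<in> trig_polys S" "g \<in> trig_polys S"
  shows "(\<lambda>z. f z + g z) \<in> trig_polys S"
proof -
  obtain A c where f: "f = (\<lambda>z. \<Sum>\<alpha>\<in>A. c \<alpha> * character \<alpha> z)" and A: "finite A" "A \<subseteq> S"
    using assms(1) by (auto simp: trig_polys_def)
  obtain B e where g: "g = (\<lambda>z. \<Sum>\<alpha>\<in>B. e \<alpha> * character \<alpha> z)" and B: "finite B" "B \<subseteq> S"
    using assms(2) by (auto simp: trig_polys_def)
  let ?c = "\<lambda>\<alpha>. (if \<alpha> \<in> A then c \<alpha> else 0) + (if \<alpha> \<in> B then e \<alpha> else 0)"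
  have "f z = (\<Sum>\<alpha>\<in>A \<union> B. (if \<alpha> \<in> A then c \<alpha> else 0) * character \<alpha> z)" for z
    unfolding f using A B by (intro sum.mono_neutral_cong_left) auto
  moreover have "g z = (\<Sum>\<alpha>\<in>A \<union> B. (if \<alpha> \<in> B then e \<alpha> else 0) * character \<alpha> z)" for z
    unfolding g using A B by (intro sum.mono_neutral_cong_left) auto
  ultimately have "(\<lambda>z. f z + g z) = (\<lambda>z. \<Sum>\<alpha>\<in>A \<union> B. ?c \<alpha> * character \<alpha> z)"
    by (simp add: distrib_right sum.distrib)
  then show ?thesis
    unfolding trig_polys_def using A B
    by (intro CollectI exI[of _ "A \<union> B"] exI[of _ ?c]) auto
qed

lemma trig_polys_scale:
  assumes "f \<in> trig_polys S"
  shows "(\<lambda>z. a * f z) \<in> trig_polys S"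
proof -
  obtain A c where f: "f = (\<lambda>z. \<Sum>\<alpha>\<in>A. c \<alpha> * character \<alpha> z)" and A: "finite A" "A \<subseteq> S"
    using assms(1) by (auto simp: trig_polys_def)
  have "(\<lambda>z. a * f z) = (\<lambda>z. \<Sum>\<alpha>\<in>A. (a * c \<alpha>) * character \<alpha> z)"
    by (simp add: f sum_distrib_left mult.assoc)
  then show ?thesis
    unfolding trig_polys_def using A by (intro CollectI exI[of _ A] exI[of _ "\<lambda>\<alpha>. a * c \<alpha>"]) auto
qed

lemma trig_polys_diff:
  assumes "f \<in> trig_polys S" "g \<in> trig_polys S"
  shows "(\<lambda>z. f z - g z) \<in> trig_polys S"
  using trig_polys_add[OF assms(1) trig_polys_scale[OF assms(2), of "-1"]] by simp

lemma trig_polys_sum: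
  assumes "\<And>i. i \<in> I \<Longrightarrow> f i \<in> trig_polys S"
  shows "(\<lambda>z. \<Sum>i\<in>I. f i z) \<in> trig_polys S"
proof (cases "finite I")
  case True
  then show ?thesis using assms
    by (induction I) (auto intro: trig_polys_zero trig_polys_add)
qed (simp add: trig_polys_zero)

text \<open>The product is a trigonometric polynomial only on the torus: where a coordinate is zero,
  integer powers with exponents of opposite sign do not multiply as in \<open>character_add\<close>.
  Hence \<open>h\<close> is asked to agree with the product on the torus alone.\<close>

lemma trig_polys_mult:
  assumes "f \<in> trig_polys UNIV" "g \<in> trig_polys UNIV"
  obtains h where "h \<in> trig_polys UNIV" "\<And>z. z \<in> space torus_haar \<Longrightarrow> h z = f z * g z"
proof -
  obtain A c where f: "f = (\<lambda>z. \<Sum>\<alpha>\<in>A. c \<alpha> * character \<alpha> z)" and A: "finite A"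
    using assms(1) by (auto simp: trig_polys_def)
  obtain B e where g: "g = (\<lambda>z. \<Sum>\<alpha>\<in>B. e \<alpha> * character \<alpha> z)" and B: "finite B"
    using assms(2) by (auto simp: trig_polys_def)
  define h where "h = (\<lambda>z. \<Sum>\<alpha>\<in>A. \<Sum>\<beta>\<in>B. (c \<alpha> * e \<beta>) * character (\<lambda>i. \<alpha> i + \<beta> i) z)"
  have "h \<in> trig_polys UNIV"
    unfolding h_def by (intro trig_polys_sum trig_polys_character) auto
  moreover have "h z = f z * g z" if "z \<in> space torus_haar" for z
    by (simp add: h_def f g sum_product character_add[OF that] mult_ac)
  ultimately show ?thesis by (rule that)
qed

lemma trig_polys_measurable:
  assumes "f \<in> trig_polys S" shows "f \<in> borel_measurable torus_haar"
  using assms by (auto simp: trig_polys_def)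

lemma trig_polys_bounded:
  assumes "f \<in> trig_polys S"
  obtains B where "B \<ge> 0" "\<And>z. z \<in> space torus_haar \<Longrightarrow> cmod (f z) \<le> B"
proof -
  obtain A c where f: "f = (\<lambda>z. \<Sum>\<alpha>\<in>A. c \<alpha> * character \<alpha> z)"
    using assms by (auto simp: trig_polys_def)
  show ?thesis
  proof
    show "cmod (f z) \<le> (\<Sum>\<alpha>\<in>A. cmod (c \<alpha>))" if "z \<in> space torus_haar" for z
      unfolding f using that by (intro sum_norm_le) (simp add: norm_mult)
  qed (simp add: sum_nonneg)
qed

section \<open>Fourier coefficients of integrable functions\<close>

lemma fourier_add:
  assumes "integrable torus_haar f" "integrable torus_haar g"
  shows "fourier (\<lambda>z. f z + g z) \<alpha> = fourier f \<alpha> + fourier g \<alpha>"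
  using assms by (simp add: fourier_def distrib_right integrable_mult_character)

lemma fourier_diff:
  assumes "integrable torus_haar f" "integrable torus_haar g"
  shows "fourier (\<lambda>z. f z - g z) \<alpha> = fourier f \<alpha> - fourier g \<alpha>"
  using assms by (simp add: fourier_def left_diff_distrib integrable_mult_character)

lemma fourier_scale: "fourier (\<lambda>z. a * f z) \<alpha> = a * fourier f \<alpha>"
  by (simp add: fourier_def mult.assoc)

lemma fourier_character: "fourier (character \<alpha>) \<beta> = (if \<alpha> = \<beta> then 1 else 0)"
proof -
  have "fourier (character \<alpha>) \<beta> = (LINT z|torus_haar. character (\<lambda>i. \<alpha> i - \<beta> i) z)"
    unfolding fourier_def by (intro Bochner_Integration.integral_cong) (auto simp: character_diff)
  then show ?thesis by (auto simp: integral_character fun_eq_iff)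
qed

lemma fourier_sum_characters:
  assumes "finite A"
  shows "fourier (\<lambda>z. \<Sum>\<alpha>\<in>A. c \<alpha> * character \<alpha> z) \<beta> = (if \<beta> \<in> A then c \<beta> else 0)"
proof -
  have "fourier (\<lambda>z. \<Sum>\<alpha>\<in>A. c \<alpha> * character \<alpha> z) \<beta> = (\<Sum>\<alpha>\<in>A. c \<alpha> * fourier (character \<alpha>) \<beta>)"
    by (simp add: fourier_def sum_distrib_right mult.assoc integrable_mult_character)
  also have "\<dots> = (if \<beta> \<in> A then c \<beta> else 0)"
    using assms by (simp add: fourier_character if_distrib cong: if_cong)
  finally show ?thesis .
qed

lemma trig_polys_integrable:
  assumes "f \<in> trig_polys S" shows "integrable torus_haar f"
  using trig_polys_bounded[OF assms] trig_polys_measurable[OF assms]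
  by (metis integrable_torus_bounded)

section \<open>Uniform approximation by trigonometric polynomials\<close>

lemma compact_torus: "compact (space (torus_haar :: ('d::finite \<Rightarrow> complex) measure))"
proof -
  have "space (torus_haar :: ('d \<Rightarrow> complex) measure) = PiE UNIV (\<lambda>_. sphere 0 1)"
    by (auto simp: space_torus_haar PiE_def Pi_def)
  moreover have "compactin (product_topology (\<lambda>_. euclidean) UNIV) (PiE (UNIV :: 'd set) (\<lambda>_. sphere (0::complex) 1))"
    by (subst compactin_PiE) auto
  ultimately show ?thesis by (simp add: euclidean_product_topology)
qed

lemma continuous_on_character: "continuous_on (space torus_haar) (character \<alpha>)"
  unfolding character_def[abs_def]
  by (intro continuous_intros continuous_on_power_int continuous_on_product_coordinates[THEN continuous_on_subset])
     (auto simp: space_torus_haar, metis norm_zero zero_neq_one)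

lemma continuous_on_trig_polys: "T \<in> trig_polys S \<Longrightarrow> continuous_on (space torus_haar) T"
  unfolding trig_polys_def
  by (auto intro!: continuous_on_sum continuous_on_mult continuous_on_const continuous_on_character simp del: continuous_on_const)

text \<open>Stone-Weierstrass for algebras of real functions. The algebra \<open>R\<close> consists
  of the real functions that coincide on the torus with some trigonometric polynomial, possibly one
  with complex coefficients.\<close>

theorem trig_polys_uniform_approx:
  fixes f :: "('d::finite \<Rightarrow> complex) \<Rightarrow> real"
  assumes "continuous_on (space torus_haar) f" "e > 0"
  obtains T where "T \<in> trig_polys UNIV"
    "\<And>z. z \<in> space torus_haar \<Longrightarrow> cmod (complex_of_real (f z) - T z) < e"
proof -
  define R :: "(('d \<Rightarrow> complex) \<Rightarrow> real) set" where
    "R = {f. \<exists>T\<in>trig_polys UNIV. \<forall>z\<in>space torus_haar. complex_of_real (f z) = T z}"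
  interpret function_ring_on R "space (torus_haar :: ('d \<Rightarrow> complex) measure)"
  proof
    show "compact (space (torus_haar :: ('d \<Rightarrow> complex) measure))" by (rule compact_torus)
  next
    fix f assume "f \<in> R"
    then obtain T where T: "T \<in> trig_polys UNIV" "\<And>z. z \<in> space torus_haar \<Longrightarrow> complex_of_real (f z) = T z"
      by (auto simp: R_def)
    have "continuous_on (space torus_haar) (\<lambda>z. Re (T z))"
      by (intro continuous_intros continuous_on_trig_polys[OF T(1)])
    moreover have "Re (T z) = f z" if "z \<in> space torus_haar" for z
      using T(2)[OF that] by (metis Re_complex_of_real)
    ultimately show "continuous_on (space torus_haar) f" by simp
  next
    fix f g assume "f \<in> R" "g \<in> R"
    then obtain T U where T: "T \<in> trig_polys UNIV" "\<And>z. z \<in> space torus_haar \<Longrightarrow> complex_of_real (f z) = T z"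
      and U: "U \<in> trig_polys UNIV" "\<And>z. z \<in> space torus_haar \<Longrightarrow> complex_of_real (g z) = U z"
      by (auto simp: R_def)
    show "(\<lambda>z. f z + g z) \<in> R"
      unfolding R_def using T U by (auto intro!: bexI[OF _ trig_polys_add[OF T(1) U(1)]])
    obtain h where "h \<in> trig_polys UNIV" "\<And>z. z \<in> space torus_haar \<Longrightarrow> h z = T z * U z"
      using trig_polys_mult[OF T(1) U(1)] by metis
    then show "(\<lambda>z. f z * g z) \<in> R"
      unfolding R_def using T U by (auto intro!: bexI[of _ h])
  next
    fix c show "(\<lambda>_. c) \<in> R"
      unfolding R_def
      using trig_polys_character[of "\<lambda>_. 0" UNIV "complex_of_real c"] by (auto intro!: bexI)
  next
    fix x y :: "'d \<Rightarrow> complex"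
    assume x: "x \<in> space torus_haar" and y: "y \<in> space torus_haar" and "x \<noteq> y"
    then obtain i where i: "x i \<noteq> y i" by auto
    \<comment> \<open>On the torus the conjugate of a coordinate is its inverse, so the real part of
      \<open>a * z i\<close> is a combination of two characters. The values 1 and
      \<open>\<i>\<close> of \<open>a\<close> yield the real part and the negative of the imaginary
      part, which together separate points.\<close>
    have sub: "(\<lambda>z. Re (a * z i)) \<in> R" for a
    proof -
      define \<alpha> where "\<alpha> = (\<lambda>j. if j = i then 1 else 0 :: int)"
      have *: "character \<alpha> z = z i" for z :: "'d \<Rightarrow> complex"
        by (simp add: character_def \<alpha>_def if_distrib prod.delta cong: if_cong)
      have "complex_of_real (Re (a * z i)) = a / 2 * character \<alpha> z + cnj a / 2 * character (\<lambda>j. - \<alpha> j) z"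
        if "z \<in> space torus_haar" for z
        unfolding cnj_character[OF that, symmetric] *
        using complex_add_cnj[of "a * z i"] by (simp add: field_simps)
      moreover have "(\<lambda>z. a / 2 * character \<alpha> z + cnj a / 2 * character (\<lambda>j. - \<alpha> j) z) \<in> trig_polys UNIV"
        by (intro trig_polys_add trig_polys_character) auto
      ultimately show ?thesis
        unfolding R_def mem_Collect_eq by (intro bexI ballI)
    qed
    have "Re (1 * x i) \<noteq> Re (1 * y i) \<or> Re (\<i> * x i) \<noteq> Re (\<i> * y i)"
      using i by (auto simp: complex_eq_iff)
    then show "\<exists>f\<in>R. f x \<noteq> f y"
      by (elim disjE) (erule bexI[OF _ sub])+
  qed
  obtain g where "g \<in> R" and g: "\<And>x. x \<in> space torus_haar \<Longrightarrow> \<bar>f x - g x\<bar> < e"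
    using Stone_Weierstrass_basic[OF assms] by blast
  then obtain T where T: "T \<in> trig_polys UNIV" "\<And>z. z \<in> space torus_haar \<Longrightarrow> complex_of_real (g z) = T z"
    by (auto simp: R_def)
  have "cmod (complex_of_real (f z) - T z) < e" if "z \<in> space torus_haar" for z
    using g[OF that] T(2)[OF that] by (metis norm_of_real of_real_diff)
  then show ?thesis using T(1) that by blast
qed

section \<open>Lebesgue spaces\<close>

text \<open>The p-th power of the norm. Estimates of limits are made for this quantity, with the
  factor \<open>2 powr p\<close> from \<open>lp_add\<close> in the role of the triangle
  inequality.\<close>

abbreviation Ip :: "real \<Rightarrow> (('d::finite \<Rightarrow> complex) \<Rightarrow> complex) \<Rightarrow> real" where
  "Ip p f \<equiv> (LINT z|torus_haar. cmod (f z) powr p)"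

lemma lp_space_ereal:
  "f \<in> lp_space (ereal p) \<longleftrightarrow>
     f \<in> borel_measurable torus_haar \<and> integrable torus_haar (\<lambda>z. cmod (f z) powr p)"
  by (simp add: lp_space_def)

lemma lp_norm_ereal: "lp_norm (ereal p) f = Ip p f powr (1 / p)"
  by (simp add: lp_norm_def)

lemma lp_measurable: "f \<in> lp_space p \<Longrightarrow> f \<in> borel_measurable torus_haar"
  by (simp add: lp_space_def)

lemma Ip_nonneg [simp]: "0 \<le> Ip p f"
  by (rule integral_nonneg_AE) auto

lemma powr_norm_add_le:
  assumes "0 < p"
  shows "cmod (a + b) powr p \<le> 2 powr p * (cmod a powr p + cmod b powr p)"
proof -
  have "cmod (a + b) powr p \<le> (2 * max (cmod a) (cmod b)) powr p"
    using assms norm_triangle_ineq[of a b] by (intro powr_mono2) auto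
  also have "\<dots> = 2 powr p * max (cmod a) (cmod b) powr p"
    by (simp add: powr_mult)
  also have "\<dots> \<le> 2 powr p * (cmod a powr p + cmod b powr p)"
    by (intro mult_left_mono) (auto simp: max_def)
  finally show ?thesis .
qed

lemma lp_add:
  assumes "0 < p" "f \<in> lp_space (ereal p)" "g \<in> lp_space (ereal p)"
  shows "(\<lambda>z. f z + g z) \<in> lp_space (ereal p)"
    and "Ip p (\<lambda>z. f z + g z) \<le> 2 powr p * (Ip p f + Ip p g)"
proof -
  have meas: "f \<in> borel_measurable torus_haar" "g \<in> borel_measurable torus_haar"
    using assms by (auto simp: lp_space_ereal)
  have int: "integrable torus_haar (\<lambda>z. 2 powr p * (cmod (f z) powr p + cmod (g z) powr p))"
    using assms by (auto simp: lp_space_ereal)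
  have int2: "integrable torus_haar (\<lambda>z. cmod (f z + g z) powr p)"
    using meas by (intro Bochner_Integration.integrable_bound[OF int])
      (auto intro!: AE_I2 powr_norm_add_le[OF \<open>0 < p\<close>])
  then show "(\<lambda>z. f z + g z) \<in> lp_space (ereal p)"
    using meas by (auto simp: lp_space_ereal)
  have "Ip p (\<lambda>z. f z + g z) \<le> (LINT z|torus_haar. 2 powr p * (cmod (f z) powr p + cmod (g z) powr p))"
    by (intro integral_mono int int2 powr_norm_add_le[OF \<open>0 < p\<close>])
  also have "\<dots> = 2 powr p * (Ip p f + Ip p g)"
    using assms by (simp add: lp_space_ereal)
  finally show "Ip p (\<lambda>z. f z + g z) \<le> 2 powr p * (Ip p f + Ip p g)" .
qed

lemma Ip_scale: "Ip p (\<lambda>z. c * f z) = cmod c powr p * Ip p f"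
  by (simp add: norm_mult powr_mult)

lemma lp_scale:
  assumes "f \<in> lp_space (ereal p)"
  shows "(\<lambda>z. c * f z) \<in> lp_space (ereal p)"
  using assms by (auto simp: lp_space_ereal norm_mult powr_mult)

lemma lp_diff:
  assumes "0 < p" "f \<in> lp_space (ereal p)" "g \<in> lp_space (ereal p)"
  shows "(\<lambda>z. f z - g z) \<in> lp_space (ereal p)"
    and "Ip p (\<lambda>z. f z - g z) \<le> 2 powr p * (Ip p f + Ip p g)"
  using lp_add[OF assms(1,2) lp_scale[OF assms(3), of "-1"]] by simp_all

lemma lp_bounded:
  assumes "0 \<le> p" "f \<in> borel_measurable torus_haar" "\<And>z. z \<in> space torus_haar \<Longrightarrow> cmod (f z) \<le> B"
  shows "f \<in> lp_space (ereal p)" and "Ip p f \<le> B powr p"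
proof -
  have le: "cmod (f z) powr p \<le> B powr p" if "z \<in> space torus_haar" for z
    using assms(1) assms(3)[OF that] by (intro powr_mono2) auto
  then have int: "integrable torus_haar (\<lambda>z. cmod (f z) powr p)"
    using assms(2) by (intro integrable_torus_bounded[where B="B powr p"]) auto
  then show "f \<in> lp_space (ereal p)" using assms by (simp add: lp_space_ereal)
  show "Ip p f \<le> B powr p"
    using le by (intro torus.integral_le_const int) auto
qed

lemma trig_polys_lp: "T \<in> trig_polys S \<Longrightarrow> 0 \<le> p \<Longrightarrow> T \<in> lp_space (ereal p)"
  by (metis trig_polys_bounded trig_polys_measurable lp_bounded(1))

text \<open>Convexity: the graph of the p-th power lies above its tangent at \<open>a\<close>. This
  one inequality gives Holder, Jensen for the Fejer kernel, and the bound on difference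
  quotients.\<close>

lemma Young_tangent:
  fixes x a p :: real
  assumes "1 \<le> p" "0 \<le> x" "0 \<le> a"
  shows "p * (x * a powr (p - 1)) \<le> x powr p + (p - 1) * a powr p"
proof (cases "p = 1")
  case True
  \<comment> \<open>By the convention \<open>0 powr 0 = 0\<close>, the factor
    \<open>a powr 0\<close> is 0 or 1, so only an inequality is available.\<close>
  have "x * a powr 0 \<le> x * 1" using assms by (intro mult_left_mono) auto
  then show ?thesis using True assms by simp
next
  case False
  then have p: "p > 1" using assms by simp
  have "x * a powr (p - 1) \<le> x powr p / p + (a powr (p - 1)) powr (p / (p - 1)) / (p / (p - 1))"
    using assms p by (intro Youngs_inequality) (auto simp: field_simps)
  also have "(a powr (p - 1)) powr (p / (p - 1)) = a powr p"
    using p by (simp add: powr_powr)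
  finally have "p * (x * a powr (p - 1)) \<le> p * (x powr p / p + a powr p / (p / (p - 1)))"
    using p by (intro mult_left_mono) auto
  also have "\<dots> = x powr p + (p - 1) * a powr p"
    using p by (simp add: field_simps)
  finally show ?thesis .
qed

lemma Ip_eq_0_iff:
  assumes "f \<in> lp_space (ereal p)"
  shows "Ip p f = 0 \<longleftrightarrow> (AE z in torus_haar. f z = 0)"
  using assms by (subst integral_nonneg_eq_0_iff_AE) (auto simp: lp_space_ereal)

text \<open>Writing the second factor as a power \<open>p - 1\<close> avoids the conjugate exponent,
  which is infinite for p = 1, and matches the modulus of the duality map. For p = 1 the convention
  \<open>0 powr 0 = 0\<close> turns this factor into the indicator of the set where \<open>g\<close>
  is nonzero.\<close>

lemma Holder:
  assumes "1 \<le> p" "f \<in> lp_space (ereal p)" "g \<in> lp_space (ereal p)"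
  shows "integrable torus_haar (\<lambda>z. cmod (f z) * cmod (g z) powr (p - 1))" (is ?int)
    and "(LINT z|torus_haar. cmod (f z) * cmod (g z) powr (p - 1)) \<le>
      lp_norm (ereal p) f * lp_norm (ereal p) g powr (p - 1)" (is ?le)
proof -
  have meas [measurable]: "f \<in> borel_measurable torus_haar" "g \<in> borel_measurable torus_haar"
    and int: "integrable torus_haar (\<lambda>z. cmod (f z) powr p)" "integrable torus_haar (\<lambda>z. cmod (g z) powr p)"
    using assms by (auto simp: lp_space_ereal)
  show "integrable torus_haar (\<lambda>z. cmod (f z) * cmod (g z) powr (p - 1))"
  proof (rule Bochner_Integration.integrable_bound)
    show "integrable torus_haar (\<lambda>z. cmod (f z) powr p + (p - 1) * cmod (g z) powr p)"
      using int by auto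
    show "AE z in torus_haar. norm (cmod (f z) * cmod (g z) powr (p - 1))
            \<le> norm (cmod (f z) powr p + (p - 1) * cmod (g z) powr p)"
    proof (rule AE_I2)
      fix z
      have "cmod (f z) * cmod (g z) powr (p - 1) \<le> p * (cmod (f z) * cmod (g z) powr (p - 1))"
        using mult_right_mono[OF assms(1), of "cmod (f z) * cmod (g z) powr (p - 1)"] by simp
      also have "\<dots> \<le> cmod (f z) powr p + (p - 1) * cmod (g z) powr p"
        by (rule Young_tangent) (use assms in auto)
      finally show "norm (cmod (f z) * cmod (g z) powr (p - 1))
            \<le> norm (cmod (f z) powr p + (p - 1) * cmod (g z) powr p)"
        by simp
    qed
  qed measurable
  note I = this
  define A where "A = lp_norm (ereal p) f"
  define B where "B = lp_norm (ereal p) g"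
  have nn: "A \<ge> 0" "B \<ge> 0" by (simp_all add: A_def B_def lp_norm_ereal)
  have Ap: "A powr p = Ip p f" "B powr p = Ip p g"
    using assms(1) by (simp_all add: A_def B_def lp_norm_ereal powr_powr)
  consider "A = 0 \<or> B = 0" | "A > 0" "B > 0" using nn by fastforce
  then show ?le
  proof cases
    case 1
    then have "(AE z in torus_haar. f z = 0) \<or> (AE z in torus_haar. g z = 0)"
      using Ap Ip_eq_0_iff[OF assms(2)] Ip_eq_0_iff[OF assms(3)] by auto
    then have "AE z in torus_haar. cmod (f z) * cmod (g z) powr (p - 1) = 0"
      by (auto elim!: eventually_mono)
    then have "(LINT z|torus_haar. cmod (f z) * cmod (g z) powr (p - 1)) = 0"
      using integral_cong_AE[of "\<lambda>z. cmod (f z) * cmod (g z) powr (p - 1)" torus_haar "\<lambda>_. 0"] by simp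
    then show ?le using nn by (simp add: A_def B_def)
  next
    case 2
    \<comment> \<open>Both functions are normalized to norm 1 and the tangent inequality is
      integrated; its right side then has integral \<open>1 + (p - 1)\<close>, which cancels the
      factor \<open>p\<close> on the left.\<close>
    have "(LINT z|torus_haar. p * (cmod (f z) * cmod (g z) powr (p - 1)) / (A * B powr (p - 1)))
        \<le> (LINT z|torus_haar. cmod (f z) powr p / A powr p + (p - 1) * (cmod (g z) powr p / B powr p))"
    proof (rule integral_mono)
      show "p * (cmod (f z) * cmod (g z) powr (p - 1)) / (A * B powr (p - 1))
        \<le> cmod (f z) powr p / A powr p + (p - 1) * (cmod (g z) powr p / B powr p)" for z
        using Young_tangent[of p "cmod (f z) / A" "cmod (g z) / B"] assms(1) 2
        by (simp add: powr_divide)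
    qed (use I int in auto)
    also have "\<dots> = 1 + (p - 1) * 1"
      using int 2 by (simp add: Ap flip: Ap)
    finally have "p * ((LINT z|torus_haar. cmod (f z) * cmod (g z) powr (p - 1)) / (A * B powr (p - 1))) \<le> p * 1"
      by simp
    then have "(LINT z|torus_haar. cmod (f z) * cmod (g z) powr (p - 1)) / (A * B powr (p - 1)) \<le> 1"
      using assms(1) by (subst (asm) mult_le_cancel_left_pos) auto
    then show ?le using 2 by (simp add: A_def B_def pos_divide_le_eq)
  qed
qed

text \<open>Holder with exponent \<open>p / r\<close> for \<open>cmod (f z) powr r\<close> and the
  constant 1, whose norm is 1 because the total mass is 1.\<close>

lemma lp_mono:
  fixes f :: "('d::finite \<Rightarrow> complex) \<Rightarrow> complex"
  assumes "0 < r" "r \<le> p" "f \<in> lp_space (ereal p)"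
  shows "f \<in> lp_space (ereal r)" and "Ip r f \<le> Ip p f powr (r / p)"
proof -
  have meas [measurable]: "f \<in> borel_measurable torus_haar"
    and int: "integrable torus_haar (\<lambda>z. cmod (f z) powr p)"
    using assms(3) by (simp_all add: lp_space_ereal)
  define q where "q = p / r"
  have q: "1 \<le> q" "r * q = p" "1 / q = r / p" using assms by (simp_all add: q_def)
  define h where "h = (\<lambda>z. complex_of_real (cmod (f z) powr r))"
  have norm_h: "cmod (h z) powr q = cmod (f z) powr p" "cmod (h z) = cmod (f z) powr r" for z
    by (simp_all add: h_def powr_powr q)
  have "h \<in> borel_measurable torus_haar" unfolding h_def by measurable
  then have h: "h \<in> lp_space (ereal q)"
    using int by (simp only: lp_space_ereal norm_h(1) simp_thms)
  have one: "(\<lambda>z :: 'd \<Rightarrow> complex. 1) \<in> lp_space (ereal q)" "Ip q (\<lambda>z :: 'd \<Rightarrow> complex. 1) = 1"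
    by (simp_all add: lp_space_ereal torus.prob_space)
  show "f \<in> lp_space (ereal r)"
    using Holder(1)[OF q(1) h one(1)] by (simp add: norm_h(2) lp_space_ereal)
  show "Ip r f \<le> Ip p f powr (r / p)"
    using Holder(2)[OF q(1) h one(1)]
    by (simp add: lp_norm_ereal norm_h(1) one(2) q(3)) (simp add: norm_h(2) torus.prob_space)
qed

lemma lp_integrable:
  assumes "1 \<le> p" "f \<in> lp_space (ereal p)"
  shows "integrable torus_haar f"
proof -
  have "f \<in> lp_space (ereal 1)" using lp_mono(1)[of 1 p f] assms by simp
  then have "f \<in> borel_measurable torus_haar" "integrable torus_haar (\<lambda>z. cmod (f z))"
    by (simp_all only: lp_space_ereal powr_one norm_ge_zero)
  then show ?thesis by (simp only: integrable_norm_iff)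
qed

lemma lp_tendsto_iff:
  assumes "0 < p"
  shows "lp_tendsto (ereal p) F f \<longleftrightarrow> (\<forall>n. F n \<in> lp_space (ereal p)) \<and> f \<in> lp_space (ereal p) \<and>
     (\<lambda>n. Ip p (\<lambda>z. F n z - f z)) \<longlonglongrightarrow> 0"
proof -
  have "(\<lambda>n. x n powr (1 / p)) \<longlonglongrightarrow> 0 \<longleftrightarrow> x \<longlonglongrightarrow> 0" if "\<And>n. 0 \<le> x n" for x :: "nat \<Rightarrow> real"
  proof
    assume "(\<lambda>n. x n powr (1 / p)) \<longlonglongrightarrow> 0"
    then have "(\<lambda>n. (x n powr (1 / p)) powr p) \<longlonglongrightarrow> 0 powr p"
      using assms by (intro tendsto_powr2 tendsto_const) auto
    then show "x \<longlonglongrightarrow> 0" using assms that by (simp add: powr_powr)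
  next
    assume "x \<longlonglongrightarrow> 0"
    then have "(\<lambda>n. x n powr (1 / p)) \<longlonglongrightarrow> 0 powr (1 / p)"
      using assms that by (intro tendsto_powr2 tendsto_const) auto
    then show "(\<lambda>n. x n powr (1 / p)) \<longlonglongrightarrow> 0" by simp
  qed
  then show ?thesis
    unfolding lp_tendsto_def lp_norm_ereal by simp
qed

lemma lp_tendsto_mono:
  assumes "0 < r" "r \<le> p" "lp_tendsto (ereal p) F f"
  shows "lp_tendsto (ereal r) F f"
proof -
  have p: "0 < p" using assms by simp
  note * = assms(3)[unfolded lp_tendsto_iff[OF p]]
  have "(\<lambda>n. Ip r (\<lambda>z. F n z - f z)) \<longlonglongrightarrow> 0"
  proof (rule tendsto_sandwich[OF _ _ tendsto_const])
    show "\<forall>\<^sub>F n in sequentially. 0 \<le> Ip r (\<lambda>z. F n z - f z)" by simp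
    show "\<forall>\<^sub>F n in sequentially. Ip r (\<lambda>z. F n z - f z) \<le> Ip p (\<lambda>z. F n z - f z) powr (r / p)"
      using * by (intro always_eventually allI lp_mono(2)[OF assms(1,2)] lp_diff(1)[OF p]) auto
    have "(\<lambda>n. Ip p (\<lambda>z. F n z - f z) powr (r / p)) \<longlonglongrightarrow> 0 powr (r / p)"
      using * assms p by (intro tendsto_powr2 tendsto_const) auto
    then show "(\<lambda>n. Ip p (\<lambda>z. F n z - f z) powr (r / p)) \<longlonglongrightarrow> 0" by simp
  qed
  then show ?thesis
    using * lp_mono(1)[OF assms(1,2)] unfolding lp_tendsto_iff[OF assms(1)] by blast
qed

lemma lp_tendsto_add:
  assumes "0 < p" "lp_tendsto (ereal p) F f" "lp_tendsto (ereal p) G g"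
  shows "lp_tendsto (ereal p) (\<lambda>n z. F n z + G n z) (\<lambda>z. f z + g z)"
proof -
  note F = assms(2)[unfolded lp_tendsto_iff[OF assms(1)]] and G = assms(3)[unfolded lp_tendsto_iff[OF assms(1)]]
  have "(\<lambda>n. Ip p (\<lambda>z. F n z + G n z - (f z + g z))) \<longlonglongrightarrow> 0"
  proof (rule tendsto_sandwich[OF _ _ tendsto_const])
    show "\<forall>\<^sub>F n in sequentially. 0 \<le> Ip p (\<lambda>z. F n z + G n z - (f z + g z))" by simp
    have "Ip p (\<lambda>z. F n z + G n z - (f z + g z)) \<le> 2 powr p * (Ip p (\<lambda>z. F n z - f z) + Ip p (\<lambda>z. G n z - g z))" for n
      using lp_add(2)[OF assms(1) lp_diff(1)[OF assms(1), of "F n" f] lp_diff(1)[OF assms(1), of "G n" g]] F G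
      by (simp add: algebra_simps)
    then show "\<forall>\<^sub>F n in sequentially. Ip p (\<lambda>z. F n z + G n z - (f z + g z)) \<le>
       2 powr p * (Ip p (\<lambda>z. F n z - f z) + Ip p (\<lambda>z. G n z - g z))"
      by (intro always_eventually allI)
    have "(\<lambda>n. 2 powr p * (Ip p (\<lambda>z. F n z - f z) + Ip p (\<lambda>z. G n z - g z))) \<longlonglongrightarrow> 2 powr p * (0 + 0)"
      using F G by (intro tendsto_intros) auto
    then show "(\<lambda>n. 2 powr p * (Ip p (\<lambda>z. F n z - f z) + Ip p (\<lambda>z. G n z - g z))) \<longlonglongrightarrow> 0" by simp
  qed
  then show ?thesis
    using F G lp_add(1)[OF assms(1)] unfolding lp_tendsto_iff[OF assms(1)] by blast
qed

lemma lp_tendsto_scale: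
  assumes "0 < p" "lp_tendsto (ereal p) F f"
  shows "lp_tendsto (ereal p) (\<lambda>n z. c * F n z) (\<lambda>z. c * f z)"
proof -
  note F = assms(2)[unfolded lp_tendsto_iff[OF assms(1)]]
  have "(\<lambda>n. cmod c powr p * Ip p (\<lambda>z. F n z - f z)) \<longlonglongrightarrow> cmod c powr p * 0"
    using F by (intro tendsto_intros) auto
  then show ?thesis
    using F lp_scale unfolding lp_tendsto_iff[OF assms(1)]
    by (simp add: Ip_scale flip: right_diff_distrib) blast
qed

section \<open>Density of trigonometric polynomials\<close>

text \<open>Membership in the closure of the trigonometric polynomials. It is a closed linear
  condition, so it can be carried from continuous functions to indicators of compact sets, then of
  measurable sets, then to simple functions and their limits.\<close>

definition lp_approximable :: "real \<Rightarrow> (('d::finite \<Rightarrow> complex) \<Rightarrow> complex) \<Rightarrow> bool" where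
  "lp_approximable p f \<longleftrightarrow> f \<in> lp_space (ereal p) \<and>
     (\<forall>e>0. \<exists>T\<in>trig_polys UNIV. Ip p (\<lambda>z. f z - T z) < e)"

lemma lp_approximable_zero:
  assumes "0 < p"
  shows "lp_approximable p (\<lambda>z. 0)"
  unfolding lp_approximable_def
proof (intro conjI allI impI)
  show "(\<lambda>z. 0) \<in> lp_space (ereal p)" by (simp add: lp_space_ereal)
  show "\<exists>T\<in>trig_polys UNIV. Ip p (\<lambda>z. 0 - T z) < e" if "e > 0" for e
    using that by (intro bexI[OF _ trig_polys_zero]) simp
qed

lemma lp_approximable_closed:
  assumes p: "0 < p" and f: "f \<in> lp_space (ereal p)"
    and g: "\<And>e. e > 0 \<Longrightarrow> \<exists>g. lp_approximable p g \<and> Ip p (\<lambda>z. f z - g z) < e"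
  shows "lp_approximable p f"
  unfolding lp_approximable_def
proof (intro conjI allI impI f)
  fix e :: real assume "e > 0"
  \<comment> \<open>Two errors below \<open>e'\<close> are added by \<open>lp_add\<close>, at the
    cost of a factor \<open>2 powr p\<close>.\<close>
  define e' where "e' = e / (2 * 2 powr p)"
  have e': "e' > 0" using \<open>e > 0\<close> by (simp add: e'_def)
  obtain g where g: "lp_approximable p g" "Ip p (\<lambda>z. f z - g z) < e'" using g[OF e'] by blast
  then obtain T where T: "T \<in> trig_polys UNIV" "Ip p (\<lambda>z. g z - T z) < e'" and "g \<in> lp_space (ereal p)"
    using e' by (auto simp: lp_approximable_def)
  have "Ip p (\<lambda>z. (f z - g z) + (g z - T z)) \<le> 2 powr p * (Ip p (\<lambda>z. f z - g z) + Ip p (\<lambda>z. g z - T z))"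
    using p T(1) \<open>g \<in> lp_space (ereal p)\<close> f by (intro lp_add(2) lp_diff(1)) (auto intro: trig_polys_lp)
  also have "\<dots> < 2 powr p * (e' + e')"
    using T(2) g(2) by (intro mult_strict_left_mono add_strict_mono) auto
  also have "\<dots> = e" by (simp add: e'_def)
  finally show "\<exists>T\<in>trig_polys UNIV. Ip p (\<lambda>z. f z - T z) < e" using T(1) by auto
qed

lemma lp_approximable_add:
  assumes p: "0 < p" and "lp_approximable p f" "lp_approximable p g"
  shows "lp_approximable p (\<lambda>z. f z + g z)"
  unfolding lp_approximable_def
proof (intro conjI allI impI)
  show "(\<lambda>z. f z + g z) \<in> lp_space (ereal p)"
    using assms by (intro lp_add(1)) (auto simp: lp_approximable_def)
  fix e :: real assume "e > 0"
  define e' where "e' = e / (2 * 2 powr p)"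
  have e': "e' > 0" using \<open>e > 0\<close> by (simp add: e'_def)
  obtain T U where T: "T \<in> trig_polys UNIV" "Ip p (\<lambda>z. f z - T z) < e'"
    and U: "U \<in> trig_polys UNIV" "Ip p (\<lambda>z. g z - U z) < e'"
    using assms e' unfolding lp_approximable_def by blast
  have "Ip p (\<lambda>z. (f z - T z) + (g z - U z)) \<le> 2 powr p * (Ip p (\<lambda>z. f z - T z) + Ip p (\<lambda>z. g z - U z))"
    using p T(1) U(1) assms(2,3) by (intro lp_add(2) lp_diff(1)) (auto intro: trig_polys_lp simp: lp_approximable_def)
  also have "\<dots> < 2 powr p * (e' + e')"
    using T(2) U(2) by (intro mult_strict_left_mono add_strict_mono) auto
  also have "\<dots> = e" by (simp add: e'_def)
  finally show "\<exists>T\<in>trig_polys UNIV. Ip p (\<lambda>z. f z + g z - T z) < e"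
    using trig_polys_add[OF T(1) U(1)] by (intro bexI[of _ "\<lambda>z. T z + U z"]) (simp_all add: algebra_simps)
qed

lemma lp_approximable_scale:
  assumes p: "0 < p" and "lp_approximable p f"
  shows "lp_approximable p (\<lambda>z. c * f z)"
proof (cases "c = 0")
  case True
  then show ?thesis using lp_approximable_zero[OF p] by simp
next
  case False
  show ?thesis unfolding lp_approximable_def
  proof (intro conjI allI impI)
    show "(\<lambda>z. c * f z) \<in> lp_space (ereal p)"
      using assms by (intro lp_scale) (auto simp: lp_approximable_def)
    fix e :: real assume "e > 0"
    have c: "cmod c powr p > 0" using False by simp
    then have "e / cmod c powr p > 0" using \<open>e > 0\<close> by simp
    then obtain T where T: "T \<in> trig_polys UNIV" "Ip p (\<lambda>z. f z - T z) < e / cmod c powr p"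
      using assms unfolding lp_approximable_def by blast
    then have "cmod c powr p * Ip p (\<lambda>z. f z - T z) < e"
      using c by (simp add: pos_less_divide_eq mult.commute)
    then have "Ip p (\<lambda>z. c * f z - c * T z) < e"
      unfolding Ip_scale[symmetric] by (simp add: right_diff_distrib)
    then show "\<exists>T\<in>trig_polys UNIV. Ip p (\<lambda>z. c * f z - T z) < e"
      using trig_polys_scale[OF T(1), of c] by (rule bexI)
  qed
qed

lemma lp_approximable_continuous:
  assumes p: "0 < p" and g: "continuous_on (space torus_haar) g" "g \<in> borel_measurable torus_haar"
    "\<And>z. \<bar>g z\<bar> \<le> (1::real)"
  shows "lp_approximable p (\<lambda>z. complex_of_real (g z))"
  unfolding lp_approximable_def
proof (intro conjI allI impI)
  show "(\<lambda>z. complex_of_real (g z)) \<in> lp_space (ereal p)"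
    using p g by (intro lp_bounded(1)[where B=1]) auto
  fix e :: real assume "e > 0"
  define e' where "e' = (e / 2) powr (1 / p)"
  have e': "e' > 0" "e' powr p = e / 2" using \<open>e > 0\<close> p by (simp_all add: e'_def powr_powr)
  obtain T where T: "T \<in> trig_polys UNIV" "\<And>z. z \<in> space torus_haar \<Longrightarrow> cmod (complex_of_real (g z) - T z) < e'"
    using trig_polys_uniform_approx[OF g(1) e'(1)] by metis
  have "Ip p (\<lambda>z. complex_of_real (g z) - T z) \<le> e' powr p"
    using p g(2) T trig_polys_measurable[OF T(1)] by (intro lp_bounded(2)) (auto intro: less_imp_le)
  also have "\<dots> < e" using e'(2) \<open>e > 0\<close> by simp
  finally show "\<exists>T\<in>trig_polys UNIV. Ip p (\<lambda>z. complex_of_real (g z) - T z) < e"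
    using T(1) by (rule bexI)
qed

text \<open>Inner regularity by compact sets concerns Borel measures on the whole function space,
  while \<open>torus_haar\<close> lives on a product sigma-algebra over the torus. This lemma and
  \<open>sets_torus_borel\<close> pass between the two.\<close>

lemma torus_to_borel: "(\<lambda>z. z) \<in> measurable (torus_haar :: ('d::finite \<Rightarrow> complex) measure) borel"
proof -
  have "(\<lambda>z. z) \<in> measurable (torus_haar :: ('d \<Rightarrow> complex) measure) (PiM UNIV (\<lambda>_. borel))"
  proof (rule measurable_PiM_single')
    show "(\<lambda>z. z) \<in> space (torus_haar :: ('d \<Rightarrow> complex) measure) \<rightarrow> UNIV \<rightarrow>\<^sub>E space borel"
      by (auto simp: PiE_def)
  qed (rule component_measurable_torus)
  then show ?thesis
    using measurable_cong_sets[OF refl sets_PiM_equal_borel] by blast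
qed

lemma sets_torus_borel:
  assumes "A \<in> sets (torus_haar :: ('d::finite \<Rightarrow> complex) measure)"
  shows "A \<in> sets borel"
proof -
  let ?S = "space (torus_haar :: ('d \<Rightarrow> complex) measure)"
  have S: "?S \<in> sets borel" using compact_torus by (intro borel_closed compact_imp_closed)
  have "(\<lambda>z. z) \<in> measurable (restrict_space borel ?S) (torus_haar :: ('d \<Rightarrow> complex) measure)"
    unfolding torus_haar_def
  proof (rule measurable_PiM_single')
    show "(\<lambda>z. z i) \<in> measurable (restrict_space borel (space (PiM UNIV (\<lambda>i::'d. circle_haar)))) circle_haar" for i
    proof -
      have "(\<lambda>z::'d \<Rightarrow> complex. z i) \<in> borel_measurable borel"
        by (intro borel_measurable_continuous_onI) simp
      then show ?thesis
        unfolding torus_haar_def[symmetric]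
        by (subst circle_haar_def, subst measurable_distr_eq2, intro measurable_restrict_space2 measurable_restrict_space1)
           (auto simp: space_restrict_space space_torus_haar)
    qed
  qed (auto simp: space_restrict_space space_PiM)
  then have "(\<lambda>z. z) -` A \<inter> space (restrict_space borel ?S) \<in> sets (restrict_space borel ?S)"
    using assms by (rule measurable_sets)
  moreover have "A \<subseteq> ?S" using sets.sets_into_space[OF assms] .
  ultimately have "A \<in> sets (restrict_space borel ?S)"
    by (simp add: space_restrict_space Int_absorb2)
  then show ?thesis
    using S by (simp add: sets_restrict_space_iff)
qed

lemma lp_approximable_compact:
  fixes K :: "('d::finite \<Rightarrow> complex) set"
  assumes p: "0 < p" and K: "compact K"
  shows "lp_approximable p (\<lambda>z. indicator K z)"
\<comment> \<open>The distance \<open>infdist\<close> to the empty set is 0 by convention, so the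
  functions used below would not approximate its indicator.\<close>
proof (cases "K = {}")
  case True
  then show ?thesis using lp_approximable_zero[OF p] by simp
next
  case False
  have borel_imp: "f \<in> borel_measurable torus_haar" if "f \<in> borel_measurable borel"
    for f :: "('d \<Rightarrow> complex) \<Rightarrow> 'z::topological_space"
    using measurable_compose[OF torus_to_borel that] .
  have Km: "(\<lambda>z. indicator K z :: complex) \<in> borel_measurable torus_haar"
    using K by (intro borel_imp borel_measurable_indicator borel_closed compact_imp_closed)
  have Kl: "(\<lambda>z. indicator K z) \<in> lp_space (ereal p)"
    using p Km by (intro lp_bounded(1)[where B=1]) (auto simp: indicator_def)
  \<comment> \<open>A sequence of continuous functions, equal to 1 on \<open>K\<close> and, as
    \<open>K\<close> is closed, eventually 0 at every point outside.\<close>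
  define g where "g n z = max 0 (1 - real n * infdist z K)" for n z
  have cont: "continuous_on UNIV (g n)" for n
    unfolding g_def by (intro continuous_intros)
  have meas: "g n \<in> borel_measurable torus_haar" for n
    by (intro borel_imp borel_measurable_continuous_onI cont)
  have bound: "\<bar>g n z\<bar> \<le> 1" for n z
    unfolding g_def by (auto simp: infdist_nonneg)
  have lim: "(\<lambda>n. g n z) \<longlonglongrightarrow> indicator K z" for z
  proof (cases "z \<in> K")
    case True
    then show ?thesis by (simp add: g_def)
  next
    case notin: False
    then have pos: "infdist z K > 0"
      using infdist_pos_not_in_closed[OF compact_imp_closed[OF K] False] by simp
    obtain N :: nat where N: "1 / infdist z K < real N" using reals_Archimedean2 by blast
    have "g n z = 0" if "n \<ge> N" for n
    proof -
      have "1 / infdist z K < real n" using N that by linarith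
      then have "1 < real n * infdist z K" using pos by (simp add: pos_divide_less_eq)
      then show ?thesis by (simp add: g_def)
    qed
    then have "(\<lambda>n. g n z) \<longlonglongrightarrow> 0" by (intro tendsto_eventually eventually_sequentiallyI[of N]) auto
    then show ?thesis using notin by simp
  qed
  have "(\<lambda>n. Ip p (\<lambda>z. indicator K z - complex_of_real (g n z))) \<longlonglongrightarrow> (LINT z|(torus_haar :: ('d \<Rightarrow> complex) measure). 0)"
  proof (rule integral_dominated_convergence[where w="\<lambda>z. 2 powr p"])
    show "(\<lambda>z. cmod (indicator K z - complex_of_real (g n z)) powr p) \<in> borel_measurable torus_haar" for n
      using Km meas by measurable
    show "AE z in torus_haar. (\<lambda>n. cmod (indicator K z - complex_of_real (g n z)) powr p) \<longlonglongrightarrow> 0"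
    proof (rule AE_I2)
      fix z
      have "(\<lambda>n. complex_of_real (g n z)) \<longlonglongrightarrow> complex_of_real (indicator K z)"
        by (intro tendsto_of_real lim)
      also have "complex_of_real (indicator K z) = indicator K z"
        by (simp add: indicator_def)
      finally have "(\<lambda>n. complex_of_real (g n z)) \<longlonglongrightarrow> indicator K z" .
      then have "(\<lambda>n. cmod (indicator K z - complex_of_real (g n z))) \<longlonglongrightarrow> cmod (indicator K z - indicator K z)"
        by (intro tendsto_intros)
      then have "(\<lambda>n. cmod (indicator K z - complex_of_real (g n z)) powr p) \<longlonglongrightarrow> 0 powr p"
        using p by (intro tendsto_powr2) auto
      then show "(\<lambda>n. cmod (indicator K z - complex_of_real (g n z)) powr p) \<longlonglongrightarrow> 0" by simp
    qed
    have "cmod (indicator K z - complex_of_real (g n z)) \<le> 2" for n z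
      using norm_triangle_ineq4[of "indicator K z" "complex_of_real (g n z)"] bound[of n z]
      by (auto simp: indicator_def split: if_splits)
    then show "AE z in torus_haar. norm (cmod (indicator K z - complex_of_real (g n z)) powr p) \<le> 2 powr p" for n
      using p by (intro AE_I2) (auto intro!: powr_mono2)
  qed auto
  then have L: "(\<lambda>n. Ip p (\<lambda>z. indicator K z - complex_of_real (g n z))) \<longlonglongrightarrow> 0" by simp
  show ?thesis
  proof (rule lp_approximable_closed[OF p Kl])
    fix e :: real assume "e > 0"
    then obtain n where "Ip p (\<lambda>z. indicator K z - complex_of_real (g n z)) < e"
      using order_tendstoD(2)[OF L] by (auto simp: eventually_sequentially)
    moreover have "lp_approximable p (\<lambda>z. complex_of_real (g n z))"
      using p cont meas bound by (intro lp_approximable_continuous) (auto intro: continuous_on_subset)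
    ultimately show "\<exists>g. lp_approximable p g \<and> Ip p (\<lambda>z. indicator K z - g z) < e" by blast
  qed
qed

text \<open>Inner regularity provides a compact \<open>K\<close> inside \<open>A\<close> such that
  \<open>A - K\<close> has small measure. Since a difference of nested indicators takes only the
  values 0 and 1, its \<open>Ip p\<close> is that measure for every \<open>p\<close>.\<close>

lemma lp_approximable_indicator:
  fixes A :: "('d::finite \<Rightarrow> complex) set"
  assumes p: "0 < p" and A: "A \<in> sets torus_haar"
  shows "lp_approximable p (\<lambda>z. indicator A z)"
proof -
  define N where "N = distr (torus_haar :: ('d \<Rightarrow> complex) measure) borel (\<lambda>z. z)"
  interpret N: prob_space N unfolding N_def by (rule torus.prob_space_distr[OF torus_to_borel])
  have N: "emeasure N B = emeasure torus_haar (B \<inter> space torus_haar)" if "B \<in> sets borel" for B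
    unfolding N_def using emeasure_distr[OF torus_to_borel that] by (simp add: Int_commute)
  have AS: "A \<subseteq> space torus_haar" using sets.sets_into_space[OF A] .
  have Al: "(\<lambda>z. indicator A z) \<in> lp_space (ereal p)"
    using p A by (intro lp_bounded(1)[where B=1]) (auto simp: indicator_def)
  show ?thesis
  proof (rule lp_approximable_closed[OF p Al])
    fix e :: real assume "e > 0"
    have "emeasure N A = (SUP K\<in>{K. K \<subseteq> A \<and> compact K}. emeasure N K)"
      by (rule inner_regular) (auto simp: N_def sets_torus_borel[OF A] N.emeasure_eq_measure[unfolded N_def])
    then have SUP: "emeasure N A \<le> ennreal c" if "\<And>K. K \<subseteq> A \<Longrightarrow> compact K \<Longrightarrow> emeasure N K \<le> ennreal c" for c
      using that by (auto intro: SUP_least)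
    have "\<exists>K. K \<subseteq> A \<and> compact K \<and> measure N A < measure N K + e"
    proof (rule ccontr)
      assume "\<not> ?thesis"
      then have no: "measure N K \<le> measure N A - e" if "K \<subseteq> A" "compact K" for K
        using that by (auto simp: not_less le_diff_eq)
      have "ennreal (measure N A) \<le> ennreal (measure N A - e)"
        using SUP[of "measure N A - e"] no unfolding N.emeasure_eq_measure by (meson ennreal_leI)
      moreover have "0 \<le> measure N A - e" using no[of "{}"] by simp
      ultimately show False using \<open>e > 0\<close> by simp
    qed
    then obtain K where K: "K \<subseteq> A" "compact K" "measure N A < measure N K + e" by blast
    have Kb: "K \<in> sets borel" using K(2) by (intro borel_closed compact_imp_closed)
    have KS: "K \<inter> space torus_haar = K" using K(1) AS by blast
    have Km: "K \<in> sets torus_haar"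
      using measurable_sets[OF torus_to_borel Kb] KS by simp
    have less: "measure torus_haar A < measure torus_haar K + e"
      using K(3) N[OF Kb] N[OF sets_torus_borel[OF A]] AS KS
      by (simp add: torus.emeasure_eq_measure N.emeasure_eq_measure Int_absorb2)
    have "Ip p (\<lambda>z. indicator A z - indicator K z) = (LINT z|torus_haar. indicator (A - K) z)"
      using K(1) by (intro Bochner_Integration.integral_cong) (auto simp: indicator_def)
    also have "\<dots> = measure torus_haar (A - K)"
      using A Km by simp
    also have "\<dots> < e" using less A Km K(1) by (simp add: torus.finite_measure_Diff)
    finally show "\<exists>g. lp_approximable p g \<and> Ip p (\<lambda>z. indicator A z - g z) < e"
      using lp_approximable_compact[OF p K(2)] by blast
  qed
qed

lemma lp_approximable_simple:
  fixes s :: "('d::finite \<Rightarrow> complex) \<Rightarrow> complex"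
  assumes p: "0 < p" and s: "simple_function torus_haar s"
  shows "lp_approximable p (\<lambda>z. \<Sum>y\<in>s ` space torus_haar. y * indicator (s -` {y} \<inter> space torus_haar) z)"
proof -
  have "lp_approximable p (\<lambda>z. \<Sum>y\<in>Y. y * indicator (s -` {y} \<inter> space torus_haar) z)"
    if "finite Y" for Y
    using that
  proof induction
    case (insert y Y)
    have "lp_approximable p (\<lambda>z. y * indicator (s -` {y} \<inter> space torus_haar) z)"
      using p simple_functionD(2)[OF s, of "{y}"]
      by (intro lp_approximable_scale lp_approximable_indicator) auto
    from lp_approximable_add[OF p this insert.IH] show ?case
      by (simp only: sum.insert[OF insert.hyps])
  qed (use lp_approximable_zero[OF p] in simp)
  then show ?thesis using simple_functionD(1)[OF s] by blast
qed

theorem trig_polys_lp_dense: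
  assumes p: "0 < p" and f: "f \<in> lp_space (ereal p)" and "e > 0"
  obtains T where "T \<in> trig_polys UNIV" "Ip p (\<lambda>z. f z - T z) < e"
proof -
  have fm: "f \<in> borel_measurable torus_haar" and fi: "integrable torus_haar (\<lambda>z. cmod (f z) powr p)"
    using f by (auto simp: lp_space_ereal)
  obtain s where s: "\<And>i. simple_function torus_haar (s i)" "\<And>z. z \<in> space torus_haar \<Longrightarrow> (\<lambda>i. s i z) \<longlonglongrightarrow> f z"
    "\<And>i z. z \<in> space torus_haar \<Longrightarrow> cmod (s i z) \<le> 2 * cmod (f z)"
    using borel_measurable_implies_sequence_metric[OF fm, of 0] unfolding dist_norm diff_0_right by metis
  have sm: "s i \<in> borel_measurable torus_haar" for i using borel_measurable_simple_function[OF s(1)] .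
  have "(\<lambda>i. Ip p (\<lambda>z. f z - s i z)) \<longlonglongrightarrow> (LINT z|(torus_haar :: ('a \<Rightarrow> complex) measure). 0)"
  proof (rule integral_dominated_convergence[where w="\<lambda>z. 3 powr p * cmod (f z) powr p"])
    show "(\<lambda>z. cmod (f z - s i z) powr p) \<in> borel_measurable torus_haar" for i
      using fm sm by measurable
    show "AE z in torus_haar. (\<lambda>i. cmod (f z - s i z) powr p) \<longlonglongrightarrow> 0"
    proof (rule AE_I2)
      fix z :: "'a \<Rightarrow> complex" assume "z \<in> space torus_haar"
      then have "(\<lambda>i. cmod (f z - s i z)) \<longlonglongrightarrow> cmod (f z - f z)"
        by (intro tendsto_intros s)
      then have "(\<lambda>i. cmod (f z - s i z) powr p) \<longlonglongrightarrow> 0 powr p"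
        using p by (intro tendsto_powr2) auto
      then show "(\<lambda>i. cmod (f z - s i z) powr p) \<longlonglongrightarrow> 0" by simp
    qed
    show "AE z in torus_haar. norm (cmod (f z - s i z) powr p) \<le> 3 powr p * cmod (f z) powr p" for i
    proof (rule AE_I2)
      fix z :: "'a \<Rightarrow> complex" assume "z \<in> space torus_haar"
      then have "cmod (f z - s i z) \<le> 3 * cmod (f z)"
        using norm_triangle_ineq4[of "f z" "s i z"] s(3)[of z i] by linarith
      then have "cmod (f z - s i z) powr p \<le> (3 * cmod (f z)) powr p"
        using p by (intro powr_mono2) auto
      then show "norm (cmod (f z - s i z) powr p) \<le> 3 powr p * cmod (f z) powr p"
        by (simp add: powr_mult)
    qed
  qed (use fi in auto)
  then have L: "(\<lambda>i. Ip p (\<lambda>z. f z - s i z)) \<longlonglongrightarrow> 0" by simp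
  have "lp_approximable p f"
  proof (rule lp_approximable_closed[OF p f])
    fix e :: real assume "e > 0"
    then obtain i where i: "Ip p (\<lambda>z. f z - s i z) < e"
      using order_tendstoD(2)[OF L] by (auto simp: eventually_sequentially)
    define g where "g = (\<lambda>z. \<Sum>y\<in>s i ` space torus_haar. y * indicator (s i -` {y} \<inter> space torus_haar) z)"
    have "s i z = g z" if "z \<in> space torus_haar" for z
    proof -
      have "g z = (\<Sum>y\<in>s i ` space torus_haar. if y = s i z then y else 0)"
        unfolding g_def using that by (intro sum.cong) (auto simp: indicator_def)
      also have "\<dots> = s i z" using simple_functionD(1)[OF s(1)] that by simp
      finally show ?thesis ..
    qed
    then have "Ip p (\<lambda>z. f z - g z) = Ip p (\<lambda>z. f z - s i z)"
      by (intro Bochner_Integration.integral_cong) auto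
    then show "\<exists>g. lp_approximable p g \<and> Ip p (\<lambda>z. f z - g z) < e"
      using i lp_approximable_simple[OF p s(1), of i] unfolding g_def by auto
  qed
  then show ?thesis using that \<open>e > 0\<close> unfolding lp_approximable_def by blast
qed

section \<open>Fejer means\<close>

definition cube :: "nat \<Rightarrow> ('d::finite \<Rightarrow> int) set" where
  "cube N = PiE UNIV (\<lambda>_. {0..<int N})"

lemma finite_cube [simp]: "finite (cube N)"
  unfolding cube_def by (intro finite_PiE) auto

lemma card_cube: "card (cube N :: ('d::finite \<Rightarrow> int) set) = N ^ CARD('d)"
  unfolding cube_def by (subst card_PiE) auto

text \<open>The Fejer mean as an average over pairs in a cube. In this form the kernel is visibly a
  squared modulus, and the pairing of the mean of a function with the function itself is visibly
  nonnegative. The cube for \<open>N = 0\<close> is empty and its mean is 0, which is why limits run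
  over \<open>Suc n\<close>.\<close>

definition fejer :: "nat \<Rightarrow> (('d::finite \<Rightarrow> complex) \<Rightarrow> complex) \<Rightarrow> ('d \<Rightarrow> complex) \<Rightarrow> complex" where
  "fejer N f z = (\<Sum>\<beta>\<in>cube N. \<Sum>\<gamma>\<in>cube N. fourier f (\<lambda>i. \<beta> i - \<gamma> i) * character (\<lambda>i. \<beta> i - \<gamma> i) z)
     / of_nat (card (cube N :: ('d \<Rightarrow> int) set))"

text \<open>The squared modulus of the Dirichlet kernel of the cube, normalized to integral 1 for
  \<open>N > 0\<close>. Expanding the square produces the index differences in
  \<open>fejer\<close>.\<close>

definition fejer_kernel :: "nat \<Rightarrow> ('d::finite \<Rightarrow> complex) \<Rightarrow> ('d \<Rightarrow> complex) \<Rightarrow> real" where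
  "fejer_kernel N z w = (cmod (\<Sum>\<beta>\<in>cube N. character \<beta> z * cnj (character \<beta> w)))\<^sup>2
     / real (card (cube N :: ('d \<Rightarrow> int) set))"

text \<open>The share of pairs in the cube with difference \<open>\<delta>\<close>. For
  \<open>N > 0\<close> it is the usual Fejer multiplier, the product over i of max(0, 1 - |\<delta>
  i| / N).\<close>

definition fejer_coeff :: "nat \<Rightarrow> ('d::finite \<Rightarrow> int) \<Rightarrow> real" where
  "fejer_coeff N \<delta> = real (card {\<gamma>\<in>cube N. (\<lambda>i. \<gamma> i + \<delta> i) \<in> cube N}) / real (card (cube N :: ('d \<Rightarrow> int) set))"

lemma sum_cube_diff:
  "(\<Sum>\<beta>\<in>cube N. \<Sum>\<gamma>\<in>cube N. if \<delta> = (\<lambda>i. \<beta> i - \<gamma> i) then x else (0::complex)) / of_nat (card (cube N :: ('d::finite \<Rightarrow> int) set)) =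
     of_real (fejer_coeff N (\<delta> :: 'd \<Rightarrow> int)) * x"
proof -
  have "(\<Sum>\<beta>\<in>cube N. \<Sum>\<gamma>\<in>cube N. if \<delta> = (\<lambda>i. \<beta> i - \<gamma> i) then x else 0) =
      (\<Sum>\<gamma>\<in>cube N. \<Sum>\<beta>\<in>cube N. if \<beta> = (\<lambda>i. \<gamma> i + \<delta> i) then x else 0)"
  proof (subst sum.swap, intro sum.cong refl)
    show "(if \<delta> = (\<lambda>i. \<beta> i - \<gamma> i) then x else 0) = (if \<beta> = (\<lambda>i. \<gamma> i + \<delta> i) then x else 0)" for \<beta> \<gamma> :: "'d \<Rightarrow> int"
      by (auto simp: fun_eq_iff)
  qed
  also have "\<dots> = (\<Sum>\<gamma>\<in>cube N. if (\<lambda>i. \<gamma> i + \<delta> i) \<in> cube N then x else 0)"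
    by (intro sum.cong) auto
  also have "\<dots> = of_nat (card {\<gamma>\<in>cube N. (\<lambda>i. \<gamma> i + \<delta> i) \<in> cube N}) * x"
    by (subst sum.inter_filter[symmetric]) auto
  finally show ?thesis by (simp add: fejer_coeff_def)
qed

lemma fejer_coeff_zero: "N > 0 \<Longrightarrow> fejer_coeff N (\<lambda>_. 0) = 1"
  by (simp add: fejer_coeff_def card_cube)

lemma fejer_coeff_tendsto: "(\<lambda>n. fejer_coeff (Suc n) (\<delta> :: 'd::finite \<Rightarrow> int)) \<longlonglongrightarrow> 1"
proof -
  have coeff: "fejer_coeff N \<delta> = (\<Prod>i\<in>UNIV. real (nat (int N - \<bar>\<delta> i\<bar>)) / real N)" for N
  proof -
    \<comment> \<open>The condition splits over coordinates; each one asks for membership in an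
      interval and in its translate, which intersect in an interval of length N - |\<delta> i| when
      this is positive.\<close>
    have "{\<gamma>\<in>cube N. (\<lambda>i. \<gamma> i + \<delta> i) \<in> cube N} = PiE UNIV (\<lambda>i. {max 0 (- \<delta> i)..<min (int N) (int N - \<delta> i)})"
      by (auto simp: cube_def PiE_iff) (smt (verit))+
    then have "card {\<gamma>\<in>cube N. (\<lambda>i. \<gamma> i + \<delta> i) \<in> cube N} = (\<Prod>i\<in>UNIV. nat (min (int N) (int N - \<delta> i) - max 0 (- \<delta> i)))"
      by (simp add: card_PiE)
    also have "\<dots> = (\<Prod>i\<in>UNIV. nat (int N - \<bar>\<delta> i\<bar>))"
      by (intro prod.cong) auto
    finally show ?thesis
      by (simp add: fejer_coeff_def card_cube prod_dividef)
  qed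
  have "(\<lambda>n. real (nat (int (Suc n) - \<bar>\<delta> i\<bar>)) / real (Suc n)) \<longlonglongrightarrow> 1" for i
  proof -
    have "(\<lambda>n. 1 - real_of_int \<bar>\<delta> i\<bar> / real (Suc n)) \<longlonglongrightarrow> 1 - 0"
      by (intro tendsto_intros LIMSEQ_Suc[OF lim_const_over_n])
    moreover have "\<forall>\<^sub>F n in sequentially. 1 - real_of_int \<bar>\<delta> i\<bar> / real (Suc n) = real (nat (int (Suc n) - \<bar>\<delta> i\<bar>)) / real (Suc n)"
      using eventually_ge_at_top[of "nat \<bar>\<delta> i\<bar>"]
    proof eventually_elim
      case (elim n)
      then have "real (nat (int (Suc n) - \<bar>\<delta> i\<bar>)) = real (Suc n) - real_of_int \<bar>\<delta> i\<bar>"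
        by (simp add: of_nat_nat)
      then show ?case by (simp add: diff_divide_distrib)
    qed
    ultimately show ?thesis by (simp add: tendsto_cong)
  qed
  then have "(\<lambda>n. \<Prod>i\<in>UNIV. real (nat (int (Suc n) - \<bar>\<delta> i\<bar>)) / real (Suc n)) \<longlonglongrightarrow> (\<Prod>i\<in>(UNIV :: 'd set). 1)"
    by (intro tendsto_prod)
  then show ?thesis by (simp add: coeff)
qed

text \<open>Fejer means never enlarge the spectrum. Thus Hardy functions have analytic polynomials
  as means, and an index singled out by the spectrum of a function stays singled out for its
  means.\<close>

lemma fejer_trig_polys:
  assumes "\<And>\<alpha>. \<alpha> \<notin> S \<Longrightarrow> fourier f \<alpha> = 0"
  shows "fejer N f \<in> trig_polys S"
proof -
  have "(\<lambda>z. fourier f \<alpha> * character \<alpha> z) \<in> trig_polys S" for \<alpha>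
    using assms[of \<alpha>] by (cases "\<alpha> \<in> S") (auto intro: trig_polys_character trig_polys_zero)
  then have "(\<lambda>z. \<Sum>\<beta>\<in>cube N. \<Sum>\<gamma>\<in>cube N. fourier f (\<lambda>i. \<beta> i - \<gamma> i) * character (\<lambda>i. \<beta> i - \<gamma> i) z) \<in> trig_polys S"
    by (intro trig_polys_sum)
  then have "(\<lambda>z. inverse (of_nat (card (cube N :: ('a \<Rightarrow> int) set))) *
      (\<Sum>\<beta>\<in>cube N. \<Sum>\<gamma>\<in>cube N. fourier f (\<lambda>i. \<beta> i - \<gamma> i) * character (\<lambda>i. \<beta> i - \<gamma> i) z)) \<in> trig_polys S"
    by (rule trig_polys_scale)
  also have "(\<lambda>z. inverse (of_nat (card (cube N :: ('a \<Rightarrow> int) set))) *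
      (\<Sum>\<beta>\<in>cube N. \<Sum>\<gamma>\<in>cube N. fourier f (\<lambda>i. \<beta> i - \<gamma> i) * character (\<lambda>i. \<beta> i - \<gamma> i) z)) = fejer N f"
    by (simp add: fejer_def[abs_def] divide_inverse mult.commute)
  finally show ?thesis .
qed

lemma fejer_trig_polys_UNIV: "fejer N f \<in> trig_polys UNIV"
  by (rule fejer_trig_polys) auto

lemma fejer_diff:
  assumes "integrable torus_haar f" "integrable torus_haar g"
  shows "fejer N (\<lambda>z. f z - g z) z = fejer N f z - fejer N g z"
  by (simp add: fejer_def fourier_diff[OF assms] left_diff_distrib sum_subtractf diff_divide_distrib)

lemma fejer_sum_characters:
  assumes "finite A"
  shows "fejer N (\<lambda>z. \<Sum>\<alpha>\<in>A. c \<alpha> * character \<alpha> z) z =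
    (\<Sum>\<alpha>\<in>A. of_real (fejer_coeff N \<alpha>) * (c \<alpha> * character \<alpha> z))"
proof -
  have *: "(if \<delta> \<in> A then c \<delta> else 0) * character \<delta> z = (\<Sum>\<alpha>\<in>A. if \<alpha> = \<delta> then c \<alpha> * character \<alpha> z else 0)" for \<delta>
    using assms by (simp add: sum.delta)
  have "fejer N (\<lambda>z. \<Sum>\<alpha>\<in>A. c \<alpha> * character \<alpha> z) z =
     (\<Sum>\<beta>\<in>cube N. \<Sum>\<gamma>\<in>cube N. \<Sum>\<alpha>\<in>A. if \<alpha> = (\<lambda>i. \<beta> i - \<gamma> i) then c \<alpha> * character \<alpha> z else 0)
       / of_nat (card (cube N :: ('a \<Rightarrow> int) set))"
    by (simp only: fejer_def fourier_sum_characters[OF assms] *)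
  also have "(\<Sum>\<beta>\<in>cube N. \<Sum>\<gamma>\<in>cube N. \<Sum>\<alpha>\<in>A. if \<alpha> = (\<lambda>i. \<beta> i - \<gamma> i) then c \<alpha> * character \<alpha> z else 0) =
     (\<Sum>\<alpha>\<in>A. \<Sum>\<beta>\<in>cube N. \<Sum>\<gamma>\<in>cube N. if \<alpha> = (\<lambda>i. \<beta> i - \<gamma> i) then c \<alpha> * character \<alpha> z else 0)"
    by (subst sum.swap[of _ A], subst sum.swap[of _ A]) simp
  finally show ?thesis
    by (simp only: sum_divide_distrib[of _ A] sum_cube_diff)
qed

lemma pairing_character: "pairing (character \<alpha>) g = cnj (fourier g \<alpha>)"
  using Bochner_Integration.integral_cnj[of torus_haar "\<lambda>z. g z * cnj (character \<alpha> z)"]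
  by (simp add: pairing_def fourier_def mult.commute)

text \<open>A Parseval identity for merely integrable \<open>g\<close>: the mean is a bounded
  trigonometric polynomial. It reduces statements about pairings with \<open>\<phi>\<close> and with
  its dual function to statements about coefficients.\<close>

lemma pairing_fejer:
  fixes g :: "('d::finite \<Rightarrow> complex) \<Rightarrow> complex"
  assumes "integrable torus_haar g"
  shows "pairing (fejer N f) g = (\<Sum>\<beta>\<in>cube N. \<Sum>\<gamma>\<in>cube N.
      fourier f (\<lambda>i. \<beta> i - \<gamma> i) * cnj (fourier g (\<lambda>i. \<beta> i - \<gamma> i))) / of_nat (card (cube N :: ('d::finite \<Rightarrow> int) set))"
proof -
  have int: "integrable torus_haar (\<lambda>z. character \<alpha> z * cnj (g z))" for \<alpha> :: "'d \<Rightarrow> int"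
    using integrable_mult_character(1)[of "\<lambda>z. cnj (g z)" \<alpha>] assms by (simp add: mult.commute)
  show ?thesis
    unfolding pairing_def fejer_def
    by (simp add: sum_distrib_right int mult.assoc pairing_character[unfolded pairing_def])
qed

lemma fourier_fejer: "fourier (fejer N f) \<delta> = of_real (fejer_coeff N \<delta>) * fourier f \<delta>"
proof -
  have "fourier (fejer N f) \<delta> = pairing (fejer N f) (character \<delta>)"
    by (simp add: fourier_def pairing_def)
  also have "\<dots> = (\<Sum>\<beta>\<in>cube N. \<Sum>\<gamma>\<in>cube N. if \<delta> = (\<lambda>i. \<beta> i - \<gamma> i) then fourier f \<delta> else 0)
       / of_nat (card (cube N :: ('a \<Rightarrow> int) set))"
    by (subst pairing_fejer) (auto simp: fourier_character if_distrib cong: if_cong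
        intro!: arg_cong2[of _ _ _ _ "(/)"] sum.cong)
  finally show ?thesis by (simp only: sum_cube_diff)
qed

lemma fejer_kernel_nonneg: "0 \<le> fejer_kernel N z w"
  by (simp add: fejer_kernel_def)

lemma fejer_kernel_measurable: "fejer_kernel N z \<in> borel_measurable torus_haar"
  unfolding fejer_kernel_def[abs_def] by measurable

lemma fejer_kernel_bounded:
  fixes z :: "'a::finite \<Rightarrow> complex"
  assumes "z \<in> space torus_haar"
  obtains B where "\<And>w. w \<in> space torus_haar \<Longrightarrow> fejer_kernel N z w \<le> B"
proof
  fix w :: "'a \<Rightarrow> complex" assume w: "w \<in> space torus_haar"
  have "cmod (\<Sum>\<beta>\<in>cube N. character \<beta> z * cnj (character \<beta> w)) \<le> (\<Sum>\<beta>\<in>(cube N :: ('a \<Rightarrow> int) set). 1)"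
    using assms w by (intro sum_norm_le) (simp add: norm_mult)
  then show "fejer_kernel N z w \<le> (real (card (cube N :: ('a \<Rightarrow> int) set)))\<^sup>2 / real (card (cube N :: ('a \<Rightarrow> int) set))"
    unfolding fejer_kernel_def by (intro divide_right_mono power_mono) auto
qed

lemma integrable_fejer_kernel:
  assumes "z \<in> space torus_haar" "integrable torus_haar f"
  shows "integrable torus_haar (\<lambda>w. f w * complex_of_real (fejer_kernel N z w))"
proof -
  obtain B where "\<And>w. w \<in> space torus_haar \<Longrightarrow> fejer_kernel N z w \<le> B"
    using fejer_kernel_bounded[OF assms(1)] by blast
  then show ?thesis
    using fejer_kernel_measurable[of N z] fejer_kernel_nonneg[of N z]
    by (intro integrable_mult_bounded[OF assms(2), where B=B]) auto
qed

lemma integrable_fejer_kernel_real: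
  assumes "z \<in> space torus_haar" "integrable torus_haar (f :: _ \<Rightarrow> real)"
  shows "integrable torus_haar (\<lambda>w. f w * fejer_kernel N z w)"
  using integrable_fejer_kernel[OF assms(1), of "\<lambda>w. complex_of_real (f w)" N] assms(2)
    complex_of_real_integrable_eq[of torus_haar "\<lambda>w. f w * fejer_kernel N z w"] by simp

lemma fejer_integral:
  fixes f :: "('d::finite \<Rightarrow> complex) \<Rightarrow> complex"
  assumes z: "z \<in> space torus_haar" and f: "integrable torus_haar f"
  shows "fejer N f z = (LINT w|torus_haar. f w * complex_of_real (fejer_kernel N z w))"
proof -
  have K: "complex_of_real (fejer_kernel N z w) = (\<Sum>\<beta>\<in>cube N. \<Sum>\<gamma>\<in>cube N.
      character (\<lambda>i. \<beta> i - \<gamma> i) z * cnj (character (\<lambda>i. \<beta> i - \<gamma> i) w)) / of_nat (card (cube N :: ('d \<Rightarrow> int) set))"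
    if w: "w \<in> space torus_haar" for w
  proof -
    define a where "a \<beta> = character \<beta> z * cnj (character \<beta> w)" for \<beta>
    have "complex_of_real ((cmod (\<Sum>\<beta>\<in>cube N. a \<beta>))\<^sup>2) = (\<Sum>\<beta>\<in>cube N. \<Sum>\<gamma>\<in>cube N. a \<beta> * cnj (a \<gamma>))"
      by (simp only: complex_norm_square cnj_sum sum_product)
    moreover have "a \<beta> * cnj (a \<gamma>) = character (\<lambda>i. \<beta> i - \<gamma> i) z * cnj (character (\<lambda>i. \<beta> i - \<gamma> i) w)" for \<beta> \<gamma>
      by (simp add: a_def character_diff[OF z] character_diff[OF w] mult_ac)
    ultimately show ?thesis
      unfolding fejer_kernel_def of_real_divide a_def by simp
  qed
  have "(LINT w|torus_haar. f w * complex_of_real (fejer_kernel N z w)) =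
     (LINT w|torus_haar. (\<Sum>\<beta>\<in>cube N. \<Sum>\<gamma>\<in>cube N.
      character (\<lambda>i. \<beta> i - \<gamma> i) z * (f w * cnj (character (\<lambda>i. \<beta> i - \<gamma> i) w))) / of_nat (card (cube N :: ('d \<Rightarrow> int) set)))"
    by (intro Bochner_Integration.integral_cong) (auto simp: K sum_distrib_left mult_ac)
  also have "\<dots> = fejer N f z"
    by (simp add: fejer_def integrable_mult_character[OF f] fourier_def[symmetric] mult.commute)
  finally show ?thesis ..
qed

lemma integral_fejer_kernel:
  assumes "z \<in> space (torus_haar :: ('d::finite \<Rightarrow> complex) measure)" "N > 0"
  shows "(LINT w|torus_haar. fejer_kernel N z w) = 1"
proof -
  have *: "(\<lambda>z :: 'd \<Rightarrow> complex. 1) = (\<lambda>z. \<Sum>\<alpha>\<in>{\<lambda>_. 0}. 1 * character \<alpha> z)" by simp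
  have "complex_of_real (LINT w|torus_haar. fejer_kernel N z w) = fejer N (\<lambda>z. 1) z"
    using fejer_integral[OF assms(1), of "\<lambda>_. 1" N] by simp
  also have "\<dots> = 1"
    unfolding * by (subst fejer_sum_characters) (simp_all add: fejer_coeff_zero[OF assms(2)])
  finally show ?thesis by simp
qed

text \<open>By Jensen's inequality for the probability densities \<open>fejer_kernel N z\<close>, \<open>\<bar>fejer N f\<bar>\<^sup>p\<close> is at
  most the Fejer mean of \<open>\<bar>f\<bar>\<^sup>p\<close>, which has the same integral as \<open>\<bar>f\<bar>\<^sup>p\<close>.\<close>

lemma Ip_fejer_le:
  fixes f :: "('d::finite \<Rightarrow> complex) \<Rightarrow> complex"
  assumes p: "1 \<le> p" and f: "f \<in> lp_space (ereal p)" and N: "N > 0"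
  shows "Ip p (fejer N f) \<le> Ip p f"
proof -
  define g where "g = (\<lambda>w. complex_of_real (cmod (f w) powr p))"
  have int_f: "integrable torus_haar f" by (rule lp_integrable[OF p f])
  have int_p: "integrable torus_haar (\<lambda>w. cmod (f w) powr p)" using f by (simp add: lp_space_ereal)
  have int_g: "integrable torus_haar g" unfolding g_def using int_p by simp
  have le: "cmod (fejer N f z) powr p \<le> Re (fejer N g z)" if z: "z \<in> space torus_haar" for z
  proof -
    define a where "a = (LINT w|torus_haar. cmod (f w) * fejer_kernel N z w)"
    have a: "a \<ge> 0" unfolding a_def by (intro integral_nonneg_AE AE_I2) (simp add: fejer_kernel_nonneg)
    note I = integrable_fejer_kernel_real[OF z, of _ N]
    have "cmod (fejer N f z) \<le> (LINT w|torus_haar. norm (f w * complex_of_real (fejer_kernel N z w)))"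
      unfolding fejer_integral[OF z int_f] by (rule integral_norm_bound)
    also have "\<dots> = a" by (simp add: a_def norm_mult fejer_kernel_nonneg)
    finally have "cmod (fejer N f z) powr p \<le> a powr p" using p by (intro powr_mono2) auto
    \<comment> \<open>Jensen's inequality: the tangent inequality at the mean value \<open>a\<close>
      is integrated against the kernel, whose total mass is 1.\<close>
    moreover have "a powr p \<le> (LINT w|torus_haar. cmod (f w) powr p * fejer_kernel N z w)"
    proof -
      have "(LINT w|torus_haar. (p * a powr (p - 1)) * (cmod (f w) * fejer_kernel N z w))
          \<le> (LINT w|torus_haar. cmod (f w) powr p * fejer_kernel N z w + ((p - 1) * a powr p) * (1 * fejer_kernel N z w))"
      proof (rule integral_mono)
        show "integrable torus_haar (\<lambda>w. (p * a powr (p - 1)) * (cmod (f w) * fejer_kernel N z w))"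
          by (intro integrable_mult_right I) (use int_f in auto)
        show "integrable torus_haar (\<lambda>w. cmod (f w) powr p * fejer_kernel N z w + ((p - 1) * a powr p) * (1 * fejer_kernel N z w))"
          by (intro Bochner_Integration.integrable_add integrable_mult_right I) (use int_p in auto)
        fix w
        show "(p * a powr (p - 1)) * (cmod (f w) * fejer_kernel N z w)
          \<le> cmod (f w) powr p * fejer_kernel N z w + ((p - 1) * a powr p) * (1 * fejer_kernel N z w)"
          using mult_right_mono[OF Young_tangent[OF p _ a, of "cmod (f w)"] fejer_kernel_nonneg[of N z w]]
          by (simp add: algebra_simps)
      qed
      also have "\<dots> = (LINT w|torus_haar. cmod (f w) powr p * fejer_kernel N z w) + (p - 1) * a powr p"
        using I[OF int_p] I[of "\<lambda>_. 1"] integral_fejer_kernel[OF z N] by simp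
      also have "(LINT w|torus_haar. (p * a powr (p - 1)) * (cmod (f w) * fejer_kernel N z w)) = p * (a powr (p - 1) * a)"
        by (simp add: a_def)
      also have "a powr (p - 1) * a = a powr p"
        using a by (cases "a = 0") (simp_all add: powr_diff)
      finally show ?thesis by (simp add: algebra_simps)
    qed
    moreover have "fejer N g z = complex_of_real (LINT w|torus_haar. cmod (f w) powr p * fejer_kernel N z w)"
      unfolding fejer_integral[OF z int_g] by (simp add: g_def flip: of_real_mult)
    ultimately show ?thesis by simp
  qed
  have int: "integrable torus_haar (fejer N g)"
    by (rule trig_polys_integrable[OF fejer_trig_polys_UNIV])
  have "Ip p (fejer N f) \<le> (LINT z|torus_haar. Re (fejer N g z))"
    using trig_polys_lp[OF fejer_trig_polys_UNIV[of N f], of p] p int le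
    by (intro integral_mono) (auto simp: lp_space_ereal)
  \<comment> \<open>The integral of a Fejer mean is its coefficient at index zero, where the
    multiplier is 1. This takes the place of an interchange of integrals.\<close>
  also have "\<dots> = Re (fourier (fejer N g) (\<lambda>_. 0))"
    using int by (simp add: fourier_def)
  also have "\<dots> = Re (fourier g (\<lambda>_. 0))"
    by (simp add: fourier_fejer fejer_coeff_zero[OF N])
  also have "\<dots> = Ip p f"
    by (simp add: fourier_def g_def)
  finally show ?thesis .
qed

lemma fejer_tendsto_trig_polys:
  fixes T :: "('d::finite \<Rightarrow> complex) \<Rightarrow> complex"
  assumes p: "0 < p" and T: "T \<in> trig_polys UNIV"
  shows "(\<lambda>n. Ip p (\<lambda>z. fejer (Suc n) T z - T z)) \<longlonglongrightarrow> 0"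
proof -
  obtain A c where A: "finite A" and T_eq: "T = (\<lambda>z. \<Sum>\<alpha>\<in>A. c \<alpha> * character \<alpha> z)"
    using T by (auto simp: trig_polys_def)
  define b where "b n = (\<Sum>\<alpha>\<in>A. \<bar>fejer_coeff (Suc n) \<alpha> - 1\<bar> * cmod (c \<alpha>))" for n
  have "b \<longlonglongrightarrow> (\<Sum>\<alpha>\<in>A. \<bar>1 - 1\<bar> * cmod (c \<alpha>))"
    unfolding b_def by (intro tendsto_intros fejer_coeff_tendsto)
  then have b: "b \<longlonglongrightarrow> 0" by simp
  have bn: "b n \<ge> 0" for n unfolding b_def by (intro sum_nonneg) auto
  have le: "Ip p (\<lambda>z. fejer (Suc n) T z - T z) \<le> b n powr p" for n
  proof (rule lp_bounded(2))
    show "(\<lambda>z. fejer (Suc n) T z - T z) \<in> borel_measurable torus_haar"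
      using trig_polys_measurable[OF T] trig_polys_measurable[OF fejer_trig_polys_UNIV[of "Suc n" T]] by measurable
    fix z :: "'d \<Rightarrow> complex" assume z: "z \<in> space torus_haar"
    have "fejer (Suc n) T z - T z = (\<Sum>\<alpha>\<in>A. of_real (fejer_coeff (Suc n) \<alpha> - 1) * (c \<alpha> * character \<alpha> z))"
      unfolding T_eq fejer_sum_characters[OF A] by (simp add: sum_subtractf left_diff_distrib)
    then show "cmod (fejer (Suc n) T z - T z) \<le> b n"
      unfolding b_def by (auto intro!: sum_norm_le simp: norm_mult z simp del: of_real_diff)
  qed (use p in auto)
  have "(\<lambda>n. b n powr p) \<longlonglongrightarrow> 0 powr p"
    using b bn p by (intro tendsto_powr2 tendsto_const) auto
  then have "(\<lambda>n. b n powr p) \<longlonglongrightarrow> 0" by simp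
  then show ?thesis
    by (rule tendsto_sandwich[OF _ _ tendsto_const, rotated 2]) (use le in auto)
qed

theorem fejer_tendsto:
  assumes p: "1 \<le> p" and f: "f \<in> lp_space (ereal p)"
  shows "lp_tendsto (ereal p) (\<lambda>n. fejer (Suc n) f) f"
proof -
  have p0: "0 < p" using p by simp
  have "(\<lambda>n. Ip p (\<lambda>z. fejer (Suc n) f z - f z)) \<longlonglongrightarrow> 0"
  proof (rule tendstoI)
    fix e :: real assume "e > 0"
    define C where "C = 2 powr p"
    have C: "C > 0" by (simp add: C_def)
    \<comment> \<open>Three errors below \<open>e'\<close> are combined by two applications of
      \<open>lp_add\<close>, so the total is below \<open>C * (e' + C * (e' + e'))\<close>.\<close>
    define e' where "e' = e / (C + 2 * C\<^sup>2)"
    have e': "e' > 0" "(C + 2 * C\<^sup>2) * e' = e"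
      using \<open>e > 0\<close> C by (simp_all add: e'_def add_pos_pos)
        (metis add_pos_pos less_irrefl mult_pos_pos zero_less_numeral zero_less_power)
    obtain T where T: "T \<in> trig_polys UNIV" "Ip p (\<lambda>z. f z - T z) < e'"
      using trig_polys_lp_dense[OF p0 f e'(1)] by metis
    have Tl: "T \<in> lp_space (ereal p)" using trig_polys_lp[OF T(1)] p0 by simp
    have "\<forall>\<^sub>F n in sequentially. Ip p (\<lambda>z. fejer (Suc n) T z - T z) < e'"
      using order_tendstoD(2)[OF fejer_tendsto_trig_polys[OF p0 T(1)] e'(1)] .
    then show "\<forall>\<^sub>F n in sequentially. dist (Ip p (\<lambda>z. fejer (Suc n) f z - f z)) 0 < e"
    proof eventually_elim
      case (elim n)
      let ?S = "fejer (Suc n)"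
      have Sl: "?S g \<in> lp_space (ereal p)" for g
        using trig_polys_lp[OF fejer_trig_polys_UNIV, of p] p0 by simp
      have 1: "Ip p (?S (\<lambda>z. f z - T z)) \<le> Ip p (\<lambda>z. f z - T z)"
        by (intro Ip_fejer_le p lp_diff(1) p0 f Tl) simp
      have eq: "?S (\<lambda>z. f z - T z) z = ?S f z - ?S T z" for z
        by (rule fejer_diff) (use lp_integrable[OF p] f Tl in auto)
      have sym: "Ip p (\<lambda>z. T z - f z) = Ip p (\<lambda>z. f z - T z)" by (simp add: norm_minus_commute)
      have "Ip p (\<lambda>z. ?S f z - f z) = Ip p (\<lambda>z. ?S (\<lambda>z. f z - T z) z + ((?S T z - T z) + (T z - f z)))"
        by (simp add: eq)
      also have "\<dots> \<le> C * (Ip p (?S (\<lambda>z. f z - T z)) + Ip p (\<lambda>z. (?S T z - T z) + (T z - f z)))"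
        unfolding C_def by (intro lp_add p0 lp_diff(1) Sl Tl f)
      also have "\<dots> \<le> C * (Ip p (?S (\<lambda>z. f z - T z)) + C * (Ip p (\<lambda>z. ?S T z - T z) + Ip p (\<lambda>z. T z - f z)))"
        unfolding C_def by (intro mult_left_mono add_left_mono lp_add(2) p0 lp_diff(1) Sl Tl f) auto
      also have "\<dots> < C * (e' + C * (e' + e'))"
        using C 1 T(2) elim by (intro mult_strict_left_mono add_strict_mono) (auto simp: sym)
      also have "\<dots> = e" using e'(2) by (simp add: algebra_simps power2_eq_square)
      finally show ?case by simp
    qed
  qed
  then show ?thesis
    using f trig_polys_lp[OF fejer_trig_polys_UNIV, of p] p0 unfolding lp_tendsto_iff[OF p0] by auto
qed

section \<open>Functions in the Hardy space vanish only on null sets\<close>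

definition weight :: "('d::finite \<Rightarrow> int) \<Rightarrow> ('d \<Rightarrow> int) \<Rightarrow> int" where
  "weight v \<beta> = (\<Sum>i\<in>UNIV. v i * \<beta> i)"

text \<open>For fixed \<open>w\<close> and \<zeta> on the unit circle this runs through an orbit of
  the one-parameter subgroup with direction \<open>v\<close>. Restriction to such orbits reduces the
  torus to one complex variable, with characters becoming powers.\<close>

definition torus_rotate :: "('d::finite \<Rightarrow> int) \<Rightarrow> complex \<Rightarrow> ('d \<Rightarrow> complex) \<Rightarrow> 'd \<Rightarrow> complex" where
  "torus_rotate v \<zeta> w = (\<lambda>i. \<zeta> powi v i * w i)"

lemma rotate_torus: "cmod \<zeta> = 1 \<Longrightarrow> w \<in> space torus_haar \<Longrightarrow> torus_rotate v \<zeta> w \<in> space torus_haar"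
  by (simp add: space_torus_haar torus_rotate_def norm_mult norm_power_int)

lemma powi_sum:
  fixes z :: complex
  assumes "z \<noteq> 0" "finite I"
  shows "z powi (\<Sum>i\<in>I. f i) = (\<Prod>i\<in>I. z powi f i)"
  using assms(2) by induction (simp_all add: assms(1) power_int_add)

lemma character_rotate:
  assumes "\<zeta> \<noteq> 0"
  shows "character \<beta> (torus_rotate v \<zeta> w) = \<zeta> powi weight v \<beta> * character \<beta> w"
  by (simp add: character_def torus_rotate_def weight_def power_int_mult_distrib prod.distrib powi_sum[OF assms]
      flip: power_int_mult)

text \<open>In several variables a spectrum has no lowest frequency. As a substitute, a direction is
  found in which a single index has least weight, so that this index alone supplies the leading
  coefficient along the orbits. The set may be infinite; nonnegativity leaves only finitely many
  elements of least degree.\<close>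

lemma exposed_index:
  fixes S :: "('d::finite \<Rightarrow> int) set"
  assumes "S \<subseteq> nonneg_indices" "S \<noteq> {}"
  obtains \<alpha> v where "\<alpha> \<in> S" "\<And>\<beta>. \<beta> \<in> S \<Longrightarrow> \<beta> \<noteq> \<alpha> \<Longrightarrow> weight v \<alpha> < weight v \<beta>"
proof -
  define deg :: "('d \<Rightarrow> int) \<Rightarrow> int" where "deg \<beta> = (\<Sum>i\<in>UNIV. \<beta> i)" for \<beta>
  have nn: "\<beta> i \<ge> 0" if "\<beta> \<in> S" for \<beta> i using that assms(1) by (auto simp: nonneg_indices_def)
  have deg_nn: "deg \<beta> \<ge> 0" if "\<beta> \<in> S" for \<beta> unfolding deg_def using nn[OF that] by (intro sum_nonneg) auto
  obtain \<beta>0 where \<beta>0: "\<beta>0 \<in> S" "\<And>\<beta>. \<beta> \<in> S \<Longrightarrow> nat (deg \<beta>0) \<le> nat (deg \<beta>)"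
    using ex_has_least_nat[of "\<lambda>\<beta>. \<beta> \<in> S" _ "\<lambda>\<beta>. nat (deg \<beta>)"] assms(2) by (metis equals0I)
  define m where "m = deg \<beta>0"
  have m: "m \<le> deg \<beta>" if "\<beta> \<in> S" for \<beta>
    using \<beta>0(2)[OF that] deg_nn[OF that] by (simp add: m_def)
  define S0 where "S0 = {\<beta> \<in> S. deg \<beta> = m}"
  have le_deg: "\<beta> i \<le> deg \<beta>" if "\<beta> \<in> S" for \<beta> i
    unfolding deg_def using nn[OF that] by (intro member_le_sum) auto
  have "S0 \<subseteq> PiE UNIV (\<lambda>_. {0..m})"
    using nn le_deg by (auto simp: S0_def PiE_def)
  then have fin: "finite S0" by (rule finite_subset) (intro finite_PiE; simp)
  have "S0 \<noteq> {}" using \<beta>0(1) by (auto simp: S0_def m_def)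
  then have "Max ((\<lambda>\<beta>. weight \<beta> \<beta>) ` S0) \<in> (\<lambda>\<beta>. weight \<beta> \<beta>) ` S0"
    using fin by (intro Max_in) auto
  then obtain \<alpha> where \<alpha>: "\<alpha> \<in> S0" "\<And>\<beta>. \<beta> \<in> S0 \<Longrightarrow> weight \<beta> \<beta> \<le> weight \<alpha> \<alpha>"
    using Max_ge[OF finite_imageI[OF fin]] by (metis (no_types, lifting) image_eqI imageE)
  \<comment> \<open>Among the elements of least degree, \<open>\<alpha>\<close> maximizes the Euclidean norm, hence strictly maximizes
    \<open>\<beta> \<mapsto> weight \<alpha> \<beta>\<close> by Cauchy-Schwarz; \<open>M\<close> is large enough to make higher degrees heavier.\<close>
  define M where "M = m * m + m + 1"
  define v where "v = (\<lambda>i. M - \<alpha> i)"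
  have v: "weight v \<beta> = M * deg \<beta> - weight \<alpha> \<beta>" for \<beta>
    by (simp add: weight_def v_def deg_def left_diff_distrib sum_subtractf sum_distrib_left)
  have \<alpha>S: "\<alpha> \<in> S" "deg \<alpha> = m" using \<alpha>(1) by (auto simp: S0_def)
  have m0: "m \<ge> 0" using deg_nn[OF \<alpha>S(1)] \<alpha>S(2) by simp
  have "weight v \<alpha> < weight v \<beta>" if \<beta>: "\<beta> \<in> S" "\<beta> \<noteq> \<alpha>" for \<beta>
  proof (cases "deg \<beta> = m")
    case True
    obtain i where "\<beta> i \<noteq> \<alpha> i" using \<beta>(2) by auto
    then have "0 < (\<Sum>i\<in>UNIV. (\<alpha> i - \<beta> i)\<^sup>2)" by (intro sum_pos2[of UNIV i]) auto
    also have "\<dots> = weight \<alpha> \<alpha> + weight \<beta> \<beta> - 2 * weight \<alpha> \<beta>"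
      unfolding power2_diff by (simp add: weight_def power2_eq_square sum_subtractf sum.distrib sum_distrib_left mult.assoc)
    finally have "weight \<alpha> \<beta> < weight \<alpha> \<alpha>" using \<alpha>(2)[of \<beta>] True \<beta>(1) by (simp add: S0_def)
    then show ?thesis using True by (simp add: v \<alpha>S)
  next
    case False
    then have deg: "deg \<beta> \<ge> m + 1" using m[OF \<beta>(1)] by simp
    have "weight \<alpha> \<beta> \<le> m * deg \<beta>"
      unfolding weight_def deg_def sum_distrib_left
      using nn[OF \<beta>(1)] le_deg[OF \<alpha>S(1)] \<alpha>S(2) by (intro sum_mono mult_right_mono) auto
    moreover have "weight \<alpha> \<alpha> \<ge> 0" unfolding weight_def by (intro sum_nonneg) auto
    \<comment> \<open>Since \<open>M - m = m * m + 1\<close>, the left side equals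
      \<open>M * m + 1\<close>, just above the bound \<open>M * m\<close> for the weight of
      \<open>\<alpha>\<close>.\<close>
    moreover have "(M - m) * (m + 1) \<le> (M - m) * deg \<beta>"
      using deg m0 by (intro mult_left_mono) (auto simp: M_def)
    ultimately show ?thesis
      by (simp add: v \<alpha>S M_def algebra_simps)
  qed
  then show ?thesis using that \<alpha>S(1) by blast
qed

text \<open>A torus version of Jensen's formula: along the curves \<open>\<zeta> \<mapsto> torus_rotate v \<zeta> w\<close> the polynomial \<open>P\<close> is
  \<open>\<zeta>\<close> to the power \<open>weight v \<alpha>\<close> times a polynomial in \<open>\<zeta>\<close>, whose constant coefficient has modulus
  \<open>\<bar>fourier P \<alpha>\<bar>\<close>, and \<open>Re T\<close> is the real part of a polynomial in \<open>\<zeta>\<close>.\<close>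

lemma ln_cmod_fourier_le:
  fixes P T :: "('d::finite \<Rightarrow> complex) \<Rightarrow> complex"
  assumes P: "P \<in> trig_polys S" and v: "\<And>\<beta>. \<beta> \<in> S \<Longrightarrow> \<beta> \<noteq> \<alpha> \<Longrightarrow> weight v \<alpha> < weight v \<beta>"
    and T: "T \<in> trig_polys UNIV" and le: "\<And>z. z \<in> space torus_haar \<Longrightarrow> cmod (P z) \<le> exp (Re (T z))"
    and nz: "fourier P \<alpha> \<noteq> 0"
  shows "ln (cmod (fourier P \<alpha>)) \<le> Re (fourier T (\<lambda>_. 0))"
proof -
  obtain A c where A: "finite A" "A \<subseteq> S" and P_eq: "P = (\<lambda>z. \<Sum>\<beta>\<in>A. c \<beta> * character \<beta> z)"
    using P by (auto simp: trig_polys_def)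
  obtain B e where B: "finite B" and T_eq: "T = (\<lambda>z. \<Sum>\<beta>\<in>B. e \<beta> * character \<beta> z)"
    using T by (auto simp: trig_polys_def)
  have \<alpha>: "\<alpha> \<in> A" "fourier P \<alpha> = c \<alpha>"
    using nz fourier_sum_characters[OF A(1), of c \<alpha>] by (auto simp: P_eq split: if_splits)
  define k0 where "k0 w = (\<Sum>\<gamma>\<in>B. if weight v \<gamma> = 0 then e \<gamma> * character \<gamma> w else 0)" for w
  have bound: "ln (cmod (c \<alpha>)) \<le> Re (k0 w)" if w: "w \<in> space torus_haar" for w
  proof -
    define q where "q \<zeta> = (\<Sum>\<beta>\<in>A. c \<beta> * character \<beta> w * \<zeta> ^ nat (weight v \<beta> - weight v \<alpha>))" for \<zeta>
    \<comment> \<open>On the unit circle, conjugating a term keeps its real part and turns a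
      negative power of \<zeta> into a positive one. So \<open>k\<close> is a polynomial whose real
      part there is that of \<open>T\<close> on the orbit.\<close>
    define k where "k \<zeta> = (\<Sum>\<gamma>\<in>B. if weight v \<gamma> \<ge> 0 then e \<gamma> * character \<gamma> w * \<zeta> ^ nat (weight v \<gamma>)
        else cnj (e \<gamma> * character \<gamma> w) * \<zeta> ^ nat (- weight v \<gamma>))" for \<zeta>
    \<comment> \<open>On the unit circle the modulus of \<open>q\<close> is that of
      \<open>P\<close>, and the majorant of \<open>P\<close> is the modulus of
      \<open>exp (k \<zeta>)\<close>; the maximum principle carries the bound to the centre.\<close>
    have "cmod (q 0 * exp (- k 0)) \<le> 1"
    proof (rule maximum_modulus_frontier[where S="cball 0 1" and f="\<lambda>\<zeta>. q \<zeta> * exp (- k \<zeta>)"])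
      have "(\<lambda>\<zeta>. q \<zeta> * exp (- k \<zeta>)) holomorphic_on UNIV"
      proof -
        have "q holomorphic_on UNIV" unfolding q_def by (intro holomorphic_intros)
        moreover have "k holomorphic_on UNIV"
          unfolding k_def
        proof (intro holomorphic_on_sum)
          show "(\<lambda>\<zeta>. if weight v \<gamma> \<ge> 0 then e \<gamma> * character \<gamma> w * \<zeta> ^ nat (weight v \<gamma>)
            else cnj (e \<gamma> * character \<gamma> w) * \<zeta> ^ nat (- weight v \<gamma>)) holomorphic_on UNIV" for \<gamma>
            by (cases "weight v \<gamma> \<ge> 0") (auto intro!: holomorphic_intros)
        qed
        ultimately show ?thesis by (intro holomorphic_intros)
      qed
      then show "(\<lambda>\<zeta>. q \<zeta> * exp (- k \<zeta>)) holomorphic_on interior (cball 0 1)"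
        "continuous_on (closure (cball 0 1)) (\<lambda>\<zeta>. q \<zeta> * exp (- k \<zeta>))"
        by (auto intro: holomorphic_on_subset holomorphic_on_imp_continuous_on)
      fix \<zeta> :: complex assume "\<zeta> \<in> frontier (cball 0 1)"
      then have \<zeta>: "cmod \<zeta> = 1" "\<zeta> \<noteq> 0" by auto
      have cnj_\<zeta>: "cnj \<zeta> = inverse \<zeta>"
        using complex_norm_square[of \<zeta>] \<zeta> by (intro inverse_unique[symmetric]) auto
      have "P (torus_rotate v \<zeta> w) = \<zeta> powi weight v \<alpha> * q \<zeta>"
      proof -
        have "c \<beta> * character \<beta> (torus_rotate v \<zeta> w) = \<zeta> powi weight v \<alpha> * (c \<beta> * character \<beta> w * \<zeta> ^ nat (weight v \<beta> - weight v \<alpha>))"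
          if "\<beta> \<in> A" for \<beta>
        proof -
          have "weight v \<alpha> \<le> weight v \<beta>" using v[of \<beta>] A(2) that by (cases "\<beta> = \<alpha>") auto
          then have "\<zeta> ^ nat (weight v \<beta> - weight v \<alpha>) = \<zeta> powi (weight v \<beta> - weight v \<alpha>)"
            by (simp add: power_int_def)
          then have "\<zeta> powi weight v \<alpha> * \<zeta> ^ nat (weight v \<beta> - weight v \<alpha>) = \<zeta> powi weight v \<beta>"
            using \<zeta>(2) by (simp flip: power_int_add)
          then show ?thesis by (simp add: character_rotate[OF \<zeta>(2)] mult_ac)
        qed
        then show ?thesis unfolding P_eq q_def sum_distrib_left by (intro sum.cong refl)
      qed
      then have "cmod (q \<zeta>) = cmod (P (torus_rotate v \<zeta> w))"
        by (simp add: norm_mult norm_power_int \<zeta>)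
      moreover have "Re (k \<zeta>) = Re (T (torus_rotate v \<zeta> w))"
        unfolding k_def T_eq Re_sum
      proof (intro sum.cong refl)
        fix \<gamma>
        show "Re (if weight v \<gamma> \<ge> 0 then e \<gamma> * character \<gamma> w * \<zeta> ^ nat (weight v \<gamma>)
            else cnj (e \<gamma> * character \<gamma> w) * \<zeta> ^ nat (- weight v \<gamma>)) = Re (e \<gamma> * character \<gamma> (torus_rotate v \<zeta> w))"
        proof (cases "weight v \<gamma> \<ge> 0")
          case True
          then show ?thesis by (simp add: character_rotate[OF \<zeta>(2)] power_int_def mult_ac)
        next
          case False
          have "cnj (e \<gamma> * character \<gamma> w) * \<zeta> ^ nat (- weight v \<gamma>) = cnj (e \<gamma> * character \<gamma> (torus_rotate v \<zeta> w))"
            using False by (simp add: character_rotate[OF \<zeta>(2)] power_int_def cnj_\<zeta> mult_ac)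
          then show ?thesis using False by (simp only: if_False cnj.sel)
        qed
      qed
      ultimately show "cmod (q \<zeta> * exp (- k \<zeta>)) \<le> 1"
        using le[OF rotate_torus[OF \<zeta>(1) w], of v]
        by (simp add: norm_mult norm_divide norm_exp_eq_Re exp_minus pos_divide_le_eq flip: divide_inverse)
    qed auto
    moreover have "q 0 = c \<alpha> * character \<alpha> w"
    proof -
      have "q 0 = (\<Sum>\<beta>\<in>A. if \<beta> = \<alpha> then c \<beta> * character \<beta> w else 0)"
        unfolding q_def using v A(2) by (intro sum.cong) (force simp: power_0_left)+
      then show ?thesis using A(1) \<alpha>(1) by simp
    qed
    moreover have "k 0 = k0 w"
      unfolding k_def k0_def by (intro sum.cong) (auto simp: power_0_left)
    ultimately have "cmod (c \<alpha>) \<le> exp (Re (k0 w))"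
      using w by (simp add: norm_mult norm_divide norm_exp_eq_Re exp_minus pos_divide_le_eq flip: divide_inverse)
    then show ?thesis
      using nz \<alpha>(2) ln_le_cancel_iff[of "cmod (c \<alpha>)" "exp (Re (k0 w))"] by simp
  qed
  have k0: "k0 = (\<lambda>w. \<Sum>\<gamma>\<in>{\<gamma>\<in>B. weight v \<gamma> = 0}. e \<gamma> * character \<gamma> w)"
    unfolding k0_def[abs_def] using B by (simp add: sum.inter_filter)
  have k0_poly: "k0 \<in> trig_polys UNIV" unfolding k0 trig_polys_def
    using B by (intro CollectI exI[of _ "{\<gamma>\<in>B. weight v \<gamma> = 0}"] exI[of _ e]) auto
  \<comment> \<open>Integration over the starting point \<open>w\<close> removes every weight-zero
    character except the constant one, leaving the mean of \<open>T\<close>.\<close>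
  have "ln (cmod (c \<alpha>)) \<le> (LINT w|torus_haar. Re (k0 w))"
    using bound trig_polys_integrable[OF k0_poly] by (intro torus.integral_ge_const) auto
  also have "\<dots> = Re (fourier k0 (\<lambda>_. 0))"
    using trig_polys_integrable[OF k0_poly] by (simp add: fourier_def)
  also have "fourier k0 (\<lambda>_. 0) = fourier T (\<lambda>_. 0)"
    unfolding k0 T_eq using B by (simp add: fourier_sum_characters weight_def)
  finally show ?thesis using \<alpha>(2) by simp
qed

text \<open>The summand \<open>\<delta>\<close> keeps the logarithm continuous at zeros of
  \<open>P\<close>, so it can be approximated uniformly by trigonometric polynomials. Raising it by
  \<open>e / 2\<close> before approximating within \<open>e / 2\<close> makes the real part of
  \<open>T\<close> a majorant.\<close>

lemma ln_cmod_fourier_le_integral: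
  fixes P :: "('d::finite \<Rightarrow> complex) \<Rightarrow> complex"
  assumes P: "P \<in> trig_polys S" and v: "\<And>\<beta>. \<beta> \<in> S \<Longrightarrow> \<beta> \<noteq> \<alpha> \<Longrightarrow> weight v \<alpha> < weight v \<beta>"
    and nz: "fourier P \<alpha> \<noteq> 0" and \<delta>: "\<delta> > 0"
  shows "ln (cmod (fourier P \<alpha>)) \<le> (LINT z|torus_haar. ln (cmod (P z) + \<delta>))"
proof (rule field_le_epsilon)
  fix e :: real assume "e > 0"
  define g where "g z = ln (cmod (P z) + \<delta>)" for z
  have pos: "cmod (P z) + \<delta> > 0" for z using \<delta> by (simp add: add_nonneg_pos)
  have g_cont: "continuous_on (space torus_haar) (\<lambda>z. g z + e / 2)"
    unfolding g_def by (intro continuous_intros continuous_on_trig_polys[OF P]) (use pos in \<open>simp add: less_imp_neq[symmetric]\<close>)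
  obtain T where T: "T \<in> trig_polys UNIV"
    "\<And>z. z \<in> space torus_haar \<Longrightarrow> cmod (complex_of_real (g z + e / 2) - T z) < e / 2"
    using trig_polys_uniform_approx[OF g_cont, of "e / 2"] \<open>e > 0\<close> by (metis half_gt_zero)
  have bd: "g z \<le> Re (T z)" "Re (T z) \<le> g z + e" if "z \<in> space torus_haar" for z
    using abs_Re_le_cmod[of "complex_of_real (g z + e / 2) - T z"] T(2)[OF that] by auto
  have g_int: "integrable torus_haar g"
  proof -
    obtain B where B: "\<And>z. z \<in> space torus_haar \<Longrightarrow> cmod (T z) \<le> B" using trig_polys_bounded[OF T(1)] by metis
    show ?thesis
    proof (rule integrable_torus_bounded)
      show "g \<in> borel_measurable torus_haar"
        unfolding g_def[abs_def] using trig_polys_measurable[OF P] by measurable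
      show "norm (g z) \<le> B + e" if "z \<in> space torus_haar" for z
        using bd[OF that] B[OF that] abs_Re_le_cmod[of "T z"] \<open>e > 0\<close> unfolding real_norm_def by linarith
    qed
  qed
  have "cmod (P z) \<le> exp (Re (T z))" if "z \<in> space torus_haar" for z
  proof -
    have "cmod (P z) \<le> exp (g z)" using pos[of z] \<delta> by (simp add: g_def)
    also have "\<dots> \<le> exp (Re (T z))" using bd(1)[OF that] by simp
    finally show ?thesis .
  qed
  then have "ln (cmod (fourier P \<alpha>)) \<le> Re (fourier T (\<lambda>_. 0))"
    by (intro ln_cmod_fourier_le[OF P v T(1)] nz) auto
  also have "\<dots> = (LINT z|torus_haar. Re (T z))"
    using trig_polys_integrable[OF T(1)] by (simp add: fourier_def)
  also have "\<dots> \<le> (LINT z|torus_haar. g z + e)"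
    using bd(2) trig_polys_integrable[OF T(1)] g_int by (intro integral_mono) auto
  also have "\<dots> = (LINT z|torus_haar. g z) + e"
    using g_int by (simp add: torus.prob_space)
  finally show "ln (cmod (fourier P \<alpha>)) \<le> (LINT z|torus_haar. ln (cmod (P z) + \<delta>)) + e"
    by (simp add: g_def)
qed

lemma fourier_zero_imp_AE_zero:
  fixes f :: "('d::finite \<Rightarrow> complex) \<Rightarrow> complex"
  assumes p: "1 \<le> p" and f: "f \<in> lp_space (ereal p)" and zero: "\<And>\<alpha>. fourier f \<alpha> = 0"
  shows "AE z in torus_haar. f z = 0"
proof -
  have "fejer N f z = 0" for N z by (simp add: fejer_def zero)
  then have "(\<lambda>n::nat. Ip p f) \<longlonglongrightarrow> 0"
    using fejer_tendsto[OF p f] p by (simp add: lp_tendsto_iff)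
  then have "Ip p f = 0" by (simp add: LIMSEQ_const_iff)
  then show ?thesis using Ip_eq_0_iff[OF f] by simp
qed

lemma hardy_integrable: "1 \<le> p \<Longrightarrow> f \<in> hardy (ereal p) \<Longrightarrow> integrable torus_haar f"
  by (auto simp: hardy_def intro: lp_integrable)

text \<open>If \<open>f\<close> vanished on a set of positive measure, the integrals of
  \<open>ln (cmod (f z) + \<delta>)\<close> would tend to minus infinity as \<open>\<delta>\<close>
  decreases to 0. The Jensen inequality bounds them below by the logarithm of one nonzero Fourier
  coefficient, independently of \<open>\<delta>\<close>.\<close>

theorem hardy_AE_nonzero:
  fixes f :: "('d::finite \<Rightarrow> complex) \<Rightarrow> complex"
  assumes f: "f \<in> hardy (ereal 1)" and nontriv: "nontrivial f"
  shows "AE z in torus_haar. f z \<noteq> 0"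
proof -
  have fl: "f \<in> lp_space (ereal 1)" using f by (simp add: hardy_def)
  have fi: "integrable torus_haar f" using hardy_integrable[OF _ f] by simp
  have fm [measurable]: "f \<in> borel_measurable torus_haar" using fi by (rule borel_measurable_integrable)
  define S where "S = {\<alpha>. fourier f \<alpha> \<noteq> 0}"
  have "S \<subseteq> nonneg_indices" using f by (auto simp: S_def hardy_def)
  moreover have "S \<noteq> {}"
    using fourier_zero_imp_AE_zero[OF _ fl] nontriv by (auto simp: S_def nontrivial_def)
  ultimately obtain \<alpha> v where \<alpha>: "\<alpha> \<in> S" and v: "\<And>\<beta>. \<beta> \<in> S \<Longrightarrow> \<beta> \<noteq> \<alpha> \<Longrightarrow> weight v \<alpha> < weight v \<beta>"
    using exposed_index by metis
  define P where "P n = fejer (Suc n) f" for n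
  have P: "P n \<in> trig_polys S" for n
    unfolding P_def by (rule fejer_trig_polys) (simp add: S_def)
  have lim: "(\<lambda>n. fourier (P n) \<alpha>) \<longlonglongrightarrow> fourier f \<alpha>"
  proof -
    have "(\<lambda>n. complex_of_real (fejer_coeff (Suc n) \<alpha>) * fourier f \<alpha>) \<longlonglongrightarrow> complex_of_real 1 * fourier f \<alpha>"
      by (intro tendsto_intros tendsto_of_real fejer_coeff_tendsto)
    then show ?thesis by (simp add: P_def fourier_fejer)
  qed
  have nz: "fourier f \<alpha> \<noteq> 0" using \<alpha> by (simp add: S_def)
  have int_ln: "integrable torus_haar (\<lambda>z. ln (cmod (g z) + \<delta>))" if "integrable torus_haar g" "\<delta> > 0"
    for g :: "('d \<Rightarrow> complex) \<Rightarrow> complex" and \<delta>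
  proof (rule Bochner_Integration.integrable_bound)
    show "integrable torus_haar (\<lambda>z. cmod (g z) + (\<bar>ln \<delta>\<bar> + \<delta>))" using that by simp
    have [measurable]: "g \<in> borel_measurable torus_haar" using that(1) by (rule borel_measurable_integrable)
    show "(\<lambda>z. ln (cmod (g z) + \<delta>)) \<in> borel_measurable torus_haar" by measurable
    have "\<bar>ln (cmod (g z) + \<delta>)\<bar> \<le> cmod (g z) + (\<bar>ln \<delta>\<bar> + \<delta>)" for z
    proof -
      have "ln \<delta> \<le> ln (cmod (g z) + \<delta>)" using that(2) by (subst ln_le_cancel_iff) (auto intro: add_nonneg_pos)
      moreover have "ln (cmod (g z) + \<delta>) \<le> cmod (g z) + \<delta> - 1"
        using that(2) by (intro ln_le_minus_one add_nonneg_pos) auto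
      ultimately show ?thesis using that(2) norm_ge_zero[of "g z"] by linarith
    qed
    then show "AE z in torus_haar. norm (ln (cmod (g z) + \<delta>)) \<le> norm (cmod (g z) + (\<bar>ln \<delta>\<bar> + \<delta>))"
      using that(2) by (intro AE_I2) simp
  qed
  have ln_le: "ln (cmod (fourier f \<alpha>)) \<le> (LINT z|torus_haar. ln (cmod (f z) + \<delta>))" if \<delta>: "\<delta> > 0" for \<delta>
  \<comment> \<open>The inequality holds for the Fejer means. For fixed \<open>\<delta>\<close> the
    function \<open>ln (x + \<delta>)\<close> has Lipschitz constant \<open>1 / \<delta>\<close> on
    \<open>x \<ge> 0\<close>, so convergence in L^1 passes it on to \<open>f\<close>.\<close>
  proof (rule tendsto_le[OF _ _ tendsto_ln[OF tendsto_norm[OF lim]]])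
    have "(\<lambda>n. (LINT z|torus_haar. ln (cmod (f z) + \<delta>)) + Ip 1 (\<lambda>z. P n z - f z) / \<delta>)
        \<longlonglongrightarrow> (LINT z|torus_haar. ln (cmod (f z) + \<delta>)) + 0 / \<delta>"
      using fejer_tendsto[OF _ fl] \<delta> by (intro tendsto_intros) (auto simp: P_def lp_tendsto_iff)
    then show "(\<lambda>n. (LINT z|torus_haar. ln (cmod (f z) + \<delta>)) + Ip 1 (\<lambda>z. P n z - f z) / \<delta>)
        \<longlonglongrightarrow> (LINT z|torus_haar. ln (cmod (f z) + \<delta>))" by simp
    have "\<forall>\<^sub>F n in sequentially. fourier (P n) \<alpha> \<noteq> 0"
      using lim nz by (rule tendsto_imp_eventually_ne)
    then show "\<forall>\<^sub>F n in sequentially. ln (cmod (fourier (P n) \<alpha>)) \<le>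
        (LINT z|torus_haar. ln (cmod (f z) + \<delta>)) + Ip 1 (\<lambda>z. P n z - f z) / \<delta>"
    proof eventually_elim
      case (elim n)
      have Pi: "integrable torus_haar (P n)" by (rule trig_polys_integrable[OF P])
      have "ln (cmod (fourier (P n) \<alpha>)) \<le> (LINT z|torus_haar. ln (cmod (P n z) + \<delta>))"
        by (rule ln_cmod_fourier_le_integral[OF P v elim \<delta>])
      also have "\<dots> \<le> (LINT z|torus_haar. ln (cmod (f z) + \<delta>) + cmod (P n z - f z) / \<delta>)"
      proof (rule integral_mono)
        fix z
        have pos: "cmod (f z) + \<delta> > 0" "cmod (P n z) + \<delta> > 0" using \<delta> by (auto intro: add_nonneg_pos)
        have "ln (cmod (P n z) + \<delta>) - ln (cmod (f z) + \<delta>) = ln ((cmod (P n z) + \<delta>) / (cmod (f z) + \<delta>))"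
          using pos by (simp add: ln_div)
        also have "\<dots> \<le> (cmod (P n z) + \<delta>) / (cmod (f z) + \<delta>) - 1"
          using pos by (intro ln_le_minus_one) simp
        also have "\<dots> = (cmod (P n z) - cmod (f z)) / (cmod (f z) + \<delta>)"
          using pos by (simp add: field_simps)
        also have "\<dots> \<le> cmod (P n z - f z) / (cmod (f z) + \<delta>)"
          using pos by (intro divide_right_mono norm_triangle_ineq2) simp
        also have "\<dots> \<le> cmod (P n z - f z) / \<delta>"
          using \<delta> pos by (intro divide_left_mono mult_pos_pos) auto
        finally show "ln (cmod (P n z) + \<delta>) \<le> ln (cmod (f z) + \<delta>) + cmod (P n z - f z) / \<delta>" by simp
      qed (use Pi fi \<delta> in \<open>auto intro!: int_ln\<close>)
      also have "\<dots> = (LINT z|torus_haar. ln (cmod (f z) + \<delta>)) + Ip 1 (\<lambda>z. P n z - f z) / \<delta>"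
        using Pi fi \<delta> by (simp add: int_ln)
      finally show ?case .
    qed
  qed (use nz in auto)
  define E where "E = {z \<in> space torus_haar. f z = 0}"
  have E [measurable]: "E \<in> sets torus_haar" unfolding E_def by measurable
  define I where "I = (LINT z|torus_haar. cmod (f z))"
  define L where "L = ln (cmod (fourier f \<alpha>))"
  \<comment> \<open>Here \<open>\<delta>\<close> is \<open>exp (- t)\<close>: the logarithm equals
    \<open>- t\<close> on \<open>E\<close>, and elsewhere it is at most \<open>cmod (f z)\<close>
    because \<open>ln y \<le> y - 1\<close> and \<open>exp (- t) \<le> 1\<close>.\<close>
  have bound: "L \<le> I - t * measure torus_haar E" if t: "t > 0" for t
  proof -
    have int_E: "integrable torus_haar (indicat_real E)"
      by (intro integrable_real_indicator E) (simp add: torus.emeasure_eq_measure)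
    have "L \<le> (LINT z|torus_haar. ln (cmod (f z) + exp (- t)))"
      unfolding L_def by (rule ln_le) simp
    also have "\<dots> \<le> (LINT z|torus_haar. cmod (f z) - t * indicator E z)"
    proof (rule integral_mono)
      fix z :: "'d \<Rightarrow> complex" assume z: "z \<in> space torus_haar"
      have "ln (cmod (f z) + exp (- t)) \<le> cmod (f z) + exp (- t) - 1"
        by (intro ln_le_minus_one add_nonneg_pos) auto
      also have "\<dots> \<le> cmod (f z)" using t by simp
      finally show "ln (cmod (f z) + exp (- t)) \<le> cmod (f z) - t * indicator E z"
        using z by (cases "z \<in> E") (auto simp: E_def)
    qed (use fi int_ln int_E in auto)
    also have "\<dots> = I - t * measure torus_haar E"
      using fi E int_E by (simp add: I_def)
    finally show ?thesis .
  qed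
  have "measure torus_haar E = 0"
  proof (rule ccontr)
    assume "measure torus_haar E \<noteq> 0"
    then have pos: "measure torus_haar E > 0" by (simp add: zero_less_measure_iff)
    \<comment> \<open>Chosen so that \<open>t * measure torus_haar E\<close> exceeds
      \<open>I - L\<close> by at least 1.\<close>
    define t where "t = (\<bar>I - L\<bar> + 1) / measure torus_haar E"
    have "t > 0" unfolding t_def using pos by (intro divide_pos_pos) auto
    then show False using bound[of t] pos by (simp add: t_def)
  qed
  then have "E \<in> null_sets torus_haar"
    using E by (auto simp: null_sets_def torus.emeasure_eq_measure)
  then show ?thesis
    by (intro AE_I'[of E]) (auto simp: E_def)
qed

text \<open>Fatou's lemma along an almost everywhere convergent subsequence. It serves to raise the
  integrability of \<open>\<phi>\<close> from L^1 to L^2 when p = 1.\<close>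

lemma lp2_limit:
  fixes f :: "('d::finite \<Rightarrow> complex) \<Rightarrow> complex"
  assumes lim: "lp_tendsto (ereal 1) F f" and F: "\<And>n. F n \<in> lp_space (ereal 2)" and C: "\<And>n. Ip 2 (F n) \<le> C"
  shows "f \<in> lp_space (ereal 2)"
proof -
  have F1: "F n \<in> lp_space (ereal 1)" "f \<in> lp_space (ereal 1)"
    and L: "(\<lambda>n. Ip 1 (\<lambda>z. F n z - f z)) \<longlonglongrightarrow> 0" for n
    using lim by (auto simp: lp_tendsto_iff)
  have fm [measurable]: "f \<in> borel_measurable torus_haar" "\<And>n. F n \<in> borel_measurable torus_haar"
    using F1 by (auto simp: lp_space_ereal)
  have "integrable torus_haar (\<lambda>z. F n z - f z)" for n
    using lp_integrable[OF _ F1(1)] lp_integrable[OF _ F1(2)] by auto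
  then obtain r where r: "strict_mono (r :: nat \<Rightarrow> nat)"
    "AE z in torus_haar. (\<lambda>n. F (r n) z - f z) \<longlonglongrightarrow> 0"
    using tendsto_L1_AE_subseq[of torus_haar "\<lambda>n z. F n z - f z"] L by auto
  have "(\<integral>\<^sup>+ z. ennreal (cmod (f z) powr 2) \<partial>torus_haar) = (\<integral>\<^sup>+ z. liminf (\<lambda>n. ennreal (cmod (F (r n) z) powr 2)) \<partial>torus_haar)"
  proof (rule nn_integral_cong_AE, use r(2) in eventually_elim)
    case (elim z)
    have "(\<lambda>n. F (r n) z) \<longlonglongrightarrow> f z" using elim by (simp add: LIM_zero_iff)
    then have "(\<lambda>n. ennreal (cmod (F (r n) z) powr 2)) \<longlonglongrightarrow> ennreal (cmod (f z) powr 2)"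
      by (intro tendsto_ennrealI tendsto_powr2 tendsto_norm tendsto_const) auto
    then show ?case by (intro lim_imp_Liminf[symmetric]) auto
  qed
  also have "\<dots> \<le> liminf (\<lambda>n. \<integral>\<^sup>+ z. ennreal (cmod (F (r n) z) powr 2) \<partial>torus_haar)"
    by (rule nn_integral_liminf) measurable
  also have "\<dots> \<le> liminf (\<lambda>n::nat. ennreal C)"
  proof (intro Liminf_mono always_eventually allI)
    fix n
    have "(\<integral>\<^sup>+ z. ennreal (cmod (F (r n) z) powr 2) \<partial>torus_haar) = ennreal (Ip 2 (F (r n)))"
      using F[of "r n"] by (intro nn_integral_eq_integral) (auto simp: lp_space_ereal)
    then show "(\<integral>\<^sup>+ z. ennreal (cmod (F (r n) z) powr 2) \<partial>torus_haar) \<le> ennreal C"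
      using C[of "r n"] by (simp add: ennreal_leI)
  qed
  also have "\<dots> = ennreal C" by (simp add: Liminf_const)
  finally have "(\<integral>\<^sup>+ z. ennreal (cmod (f z) powr 2) \<partial>torus_haar) < \<infinity>"
    by (simp add: le_less_trans)
  then show ?thesis by (auto simp: lp_space_ereal intro!: integrableI_bounded)
qed

section \<open>The duality map\<close>

text \<open>At zeros of \<open>\<phi>\<close> the second factor makes the value 0, also for
  \<open>p < 2\<close>, in accordance with the convention on the power.\<close>

definition duality_map :: "real \<Rightarrow> (('d::finite \<Rightarrow> complex) \<Rightarrow> complex) \<Rightarrow> ('d \<Rightarrow> complex) \<Rightarrow> complex" where
  "duality_map p \<phi> = (\<lambda>z. complex_of_real (cmod (\<phi> z) powr (p - 2)) * \<phi> z)"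

lemma norm_duality_map: "cmod (duality_map p \<phi> z) = cmod (\<phi> z) powr (p - 1)"
proof (cases "\<phi> z = 0")
  case False
  then have "cmod (\<phi> z) powr (p - 1) = cmod (\<phi> z) powr (p - 2) * cmod (\<phi> z)"
    using powr_add[of "cmod (\<phi> z)" "p - 2" 1] by simp
  then show ?thesis by (simp add: duality_map_def norm_mult)
qed (simp add: duality_map_def)

lemma duality_map_2: "duality_map 2 \<phi> = \<phi>"
  by (auto simp: duality_map_def)

lemma mult_cnj_duality_map: "\<phi> z * cnj (duality_map p \<phi> z) = complex_of_real (cmod (\<phi> z) powr p)"
proof (cases "\<phi> z = 0")
  case False
  have "\<phi> z * cnj (duality_map p \<phi> z) = complex_of_real (cmod (\<phi> z) powr (p - 2) * (cmod (\<phi> z))\<^sup>2)"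
    unfolding of_real_mult complex_norm_square by (simp add: duality_map_def mult_ac)
  also have "cmod (\<phi> z) powr (p - 2) * (cmod (\<phi> z))\<^sup>2 = cmod (\<phi> z) powr p"
    using False powr_add[of "cmod (\<phi> z)" "p - 2" 2] by (simp add: powr_numeral)
  finally show ?thesis .
qed (simp add: duality_map_def)

lemma duality_map_measurable [measurable]:
  assumes [measurable]: "\<phi> \<in> borel_measurable torus_haar"
  shows "duality_map p \<phi> \<in> borel_measurable torus_haar"
  unfolding duality_map_def by measurable

context
  fixes p :: real and \<phi> :: "('d::finite \<Rightarrow> complex) \<Rightarrow> complex"
  assumes p: "1 \<le> p" and \<phi>: "\<phi> \<in> lp_space (ereal p)"
begin

lemma pairing_duality_map:
  assumes "f \<in> lp_space (ereal p)"
  shows "integrable torus_haar (\<lambda>z. f z * cnj (duality_map p \<phi> z))"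
    and "cmod (pairing f (duality_map p \<phi>)) \<le> lp_norm (ereal p) f * lp_norm (ereal p) \<phi> powr (p - 1)"
proof -
  have [measurable]: "f \<in> borel_measurable torus_haar" "\<phi> \<in> borel_measurable torus_haar"
    using assms \<phi> by (auto simp: lp_space_ereal)
  have "integrable torus_haar (\<lambda>z. norm (f z * cnj (duality_map p \<phi> z)))"
    using Holder(1)[OF p assms \<phi>] by (simp add: norm_mult norm_duality_map)
  moreover have "(\<lambda>z. f z * cnj (duality_map p \<phi> z)) \<in> borel_measurable torus_haar" by measurable
  ultimately show "integrable torus_haar (\<lambda>z. f z * cnj (duality_map p \<phi> z))"
    by (simp only: integrable_norm_iff)
  have "cmod (pairing f (duality_map p \<phi>)) \<le> (LINT z|torus_haar. norm (f z * cnj (duality_map p \<phi> z)))"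
    unfolding pairing_def by (rule integral_norm_bound)
  also have "\<dots> \<le> lp_norm (ereal p) f * lp_norm (ereal p) \<phi> powr (p - 1)"
    using Holder(2)[OF p assms \<phi>] by (simp add: norm_mult norm_duality_map)
  finally show "cmod (pairing f (duality_map p \<phi>)) \<le> lp_norm (ereal p) f * lp_norm (ereal p) \<phi> powr (p - 1)" .
qed

lemma integrable_duality_map: "integrable torus_haar (duality_map p \<phi>)"
proof -
  have "(\<lambda>z. 1) \<in> lp_space (ereal p)" by (simp add: lp_space_ereal)
  from pairing_duality_map(1)[OF this] have "integrable torus_haar (\<lambda>z. cnj (duality_map p \<phi> z))" by simp
  from integrable_cnj[OF this] show ?thesis by simp
qed

lemma pairing_self_duality_map: "pairing \<phi> (duality_map p \<phi>) = complex_of_real (Ip p \<phi>)"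
  by (simp add: pairing_def mult_cnj_duality_map)

text \<open>This continuity in L^p is what the pairing with \<open>\<phi>\<close> itself may lack
  when \<open>p < 2\<close>; every passage from polynomials to H^p below 2 relies on it.\<close>

lemma pairing_duality_map_tendsto:
  assumes "lp_tendsto (ereal p) F f"
  shows "(\<lambda>n. pairing (F n) (duality_map p \<phi>)) \<longlonglongrightarrow> pairing f (duality_map p \<phi>)"
proof -
  have F: "\<And>n. F n \<in> lp_space (ereal p)" and f: "f \<in> lp_space (ereal p)"
    and lim: "(\<lambda>n. lp_norm (ereal p) (\<lambda>z. F n z - f z)) \<longlonglongrightarrow> 0"
    using assms by (auto simp: lp_tendsto_def)
  have "pairing (\<lambda>z. F n z - f z) (duality_map p \<phi>) = pairing (F n) (duality_map p \<phi>) - pairing f (duality_map p \<phi>)" for n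
    unfolding pairing_def left_diff_distrib
    by (intro Bochner_Integration.integral_diff pairing_duality_map F f)
  moreover have "(\<lambda>n. pairing (\<lambda>z. F n z - f z) (duality_map p \<phi>)) \<longlonglongrightarrow> 0"
  proof (rule tendsto_norm_zero_cancel, rule tendsto_sandwich[OF _ _ tendsto_const])
    show "\<forall>\<^sub>F n in sequentially. cmod (pairing (\<lambda>z. F n z - f z) (duality_map p \<phi>)) \<le>
       lp_norm (ereal p) (\<lambda>z. F n z - f z) * lp_norm (ereal p) \<phi> powr (p - 1)"
      using p by (intro always_eventually allI pairing_duality_map(2) lp_diff(1) F f) simp
    show "(\<lambda>n. lp_norm (ereal p) (\<lambda>z. F n z - f z) * lp_norm (ereal p) \<phi> powr (p - 1)) \<longlonglongrightarrow> 0"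
      using tendsto_mult_right[OF lim] by simp
  qed simp
  ultimately show ?thesis by (simp add: LIM_zero_iff)
qed

end

section \<open>Pairings of square integrable functions and of polynomials\<close>

lemma pairing_lp2:
  assumes "f \<in> lp_space 2" "g \<in> lp_space 2"
  shows "integrable torus_haar (\<lambda>z. f z * cnj (g z))"
    and "cmod (pairing f g) \<le> lp_norm 2 f * lp_norm 2 g"
proof -
  have "f \<in> lp_space (ereal 2)" "g \<in> lp_space (ereal 2)" using assms by simp_all
  from pairing_duality_map[OF _ this(2,1)]
  show "integrable torus_haar (\<lambda>z. f z * cnj (g z))" "cmod (pairing f g) \<le> lp_norm 2 f * lp_norm 2 g"
    by (simp_all add: duality_map_2 lp_norm_ereal[of 2, simplified])
qed

lemma lp_norm_2: "(lp_norm 2 f)\<^sup>2 = Ip 2 f"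
  using lp_norm_ereal[of 2 f] Ip_nonneg[of f 2] by (simp add: powr_half_sqrt)

lemma pairing_self: "f \<in> lp_space 2 \<Longrightarrow> pairing f f = complex_of_real ((lp_norm 2 f)\<^sup>2)"
  using pairing_self_duality_map[where p=2 and \<phi>=f] unfolding duality_map_2 lp_norm_2 by simp

lemma pairing_tendsto_lp2:
  assumes "lp_tendsto 2 F f" "g \<in> lp_space 2"
  shows "(\<lambda>n. pairing (F n) g) \<longlonglongrightarrow> pairing f g"
  using pairing_duality_map_tendsto[where p=2 and \<phi>=g and F=F and f=f] assms by (simp add: duality_map_2)

lemma pairing_trig_poly:
  assumes "integrable torus_haar h" "finite A"
  shows "pairing (\<lambda>z. \<Sum>\<alpha>\<in>A. c \<alpha> * character \<alpha> z) h = (\<Sum>\<alpha>\<in>A. c \<alpha> * cnj (fourier h \<alpha>))"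
proof -
  have int: "integrable torus_haar (\<lambda>z. character \<alpha> z * cnj (h z))" for \<alpha>
    using integrable_mult_character(1)[of "\<lambda>z. cnj (h z)" \<alpha>] assms by (simp add: mult.commute)
  show ?thesis
    unfolding pairing_def
    by (simp add: sum_distrib_right int mult.assoc pairing_character[unfolded pairing_def])
qed

lemma integrable_trig_poly_mult:
  assumes "g \<in> trig_polys S" "integrable torus_haar h"
  shows "integrable torus_haar (\<lambda>z. g z * cnj (h z))"
proof -
  obtain B where "\<And>z. z \<in> space torus_haar \<Longrightarrow> cmod (g z) \<le> B" using trig_polys_bounded[OF assms(1)] by metis
  then have "integrable torus_haar (\<lambda>z. cnj (h z) * g z)"
    using assms by (intro integrable_mult_bounded trig_polys_measurable) auto
  then show ?thesis by (simp add: mult.commute)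
qed

lemma trig_polys_hardy:
  assumes "g \<in> trig_polys nonneg_indices" "0 \<le> p"
  shows "g \<in> hardy (ereal p)"
  using assms trig_polys_lp[OF assms]
  by (auto simp: hardy_def trig_polys_def fourier_sum_characters)

lemma hardy_fejer: "f \<in> hardy p \<Longrightarrow> fejer N f \<in> trig_polys nonneg_indices"
  by (rule fejer_trig_polys) (auto simp: hardy_def)

section \<open>Fourier coefficients characterize Hilbert points\<close>

text \<open>The eigenvalue equation for the Riesz projection in weak form. It makes sense as soon as
  both functions are integrable, without an exponent q > 1 in which to project.\<close>

definition hilbert_eigen :: "real \<Rightarrow> real \<Rightarrow> (('d::finite \<Rightarrow> complex) \<Rightarrow> complex) \<Rightarrow> bool" where
  "hilbert_eigen p c \<phi> \<longleftrightarrow>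
     (\<forall>\<alpha>\<in>nonneg_indices. fourier (duality_map p \<phi>) \<alpha> = complex_of_real c * fourier \<phi> \<alpha>)"

context
  fixes p :: real and \<phi> :: "('d::finite \<Rightarrow> complex) \<Rightarrow> complex"
  assumes p: "1 \<le> p" and \<phi>: "\<phi> \<in> hardy (ereal p)" and nontriv: "nontrivial \<phi>"
begin

lemma \<phi>_lp: "\<phi> \<in> lp_space (ereal p)"
  using \<phi> by (simp add: hardy_def)

lemma \<phi>_int: "integrable torus_haar \<phi>"
  by (rule hardy_integrable[OF p \<phi>])

lemma Ip_pos: "Ip p \<phi> > 0"
  using Ip_eq_0_iff[OF \<phi>_lp] nontriv Ip_nonneg[of \<phi> p] unfolding nontrivial_def by linarith

lemma lp_norm_pos: "lp_norm (ereal p) \<phi> > 0"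
  using Ip_pos by (simp add: lp_norm_ereal)

lemma Ip_eq_norm_powr: "Ip p \<phi> = lp_norm (ereal p) \<phi> powr p"
  using p by (simp add: lp_norm_ereal powr_powr)

lemma Ip_eq_norm_mult: "Ip p \<phi> = lp_norm (ereal p) \<phi> * lp_norm (ereal p) \<phi> powr (p - 1)"
  using lp_norm_pos by (simp add: Ip_eq_norm_powr powr_diff)

lemma hilbert_eigen_pairing:
  assumes "hilbert_eigen p c \<phi>" "g \<in> trig_polys nonneg_indices"
  shows "pairing g (duality_map p \<phi>) = complex_of_real c * pairing g \<phi>"
proof -
  obtain A a where A: "finite A" "A \<subseteq> nonneg_indices" and g: "g = (\<lambda>z. \<Sum>\<alpha>\<in>A. a \<alpha> * character \<alpha> z)"
    using assms(2) by (auto simp: trig_polys_def)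
  show ?thesis
    unfolding g pairing_trig_poly[OF integrable_duality_map[OF p \<phi>_lp] A(1)] pairing_trig_poly[OF \<phi>_int A(1)] sum_distrib_left
    using assms(1) A(2) by (intro sum.cong) (auto simp: hilbert_eigen_def)
qed

text \<open>Proportional coefficients turn orthogonality to \<open>\<phi>\<close> into orthogonality
  to its dual function. Then \<open>\<phi> + f\<close> and \<open>\<phi>\<close> have the same
  pairing with the dual function, namely \<open>Ip p \<phi>\<close>, and Holder compares the
  norms.\<close>

lemma hilbert_eigen_imp_hilbert_point:
  assumes "hilbert_eigen p c \<phi>"
  shows "hilbert_point (ereal p) \<phi>"
  unfolding hilbert_point_def
proof (intro conjI ballI impI \<phi> nontriv)
  let ?\<psi> = "duality_map p \<phi>"
  fix f assume f: "f \<in> hardy (ereal p)" and orth: "hardy_orthogonal (ereal p) f \<phi>"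
  have fl: "f \<in> lp_space (ereal p)" using f by (simp add: hardy_def)
  have "pairing f ?\<psi> = 0"
  proof (cases "p < 2")
    case True
    then obtain G where G: "\<And>n. G n \<in> analytic_polys" "\<And>n. pairing (G n) \<phi> = 0" "lp_tendsto (ereal p) G f"
      using orth by (auto simp: hardy_orthogonal_def)
    have "pairing (G n) ?\<psi> = 0" for n
      using hilbert_eigen_pairing[OF assms, of "G n"] G by (simp add: analytic_polys_eq)
    then have "(\<lambda>n::nat. 0) \<longlonglongrightarrow> pairing f ?\<psi>"
      using pairing_duality_map_tendsto[OF p \<phi>_lp G(3)] by simp
    then show ?thesis by (simp add: LIMSEQ_const_iff)
  next
    case False
    then have orth0: "pairing f \<phi> = 0" using orth by (simp add: hardy_orthogonal_def)
    have \<phi>2: "\<phi> \<in> lp_space 2" using lp_mono(1)[of 2 p \<phi>] \<phi>_lp False by simp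
    have lim: "lp_tendsto (ereal p) (\<lambda>n. fejer (Suc n) f) f" by (rule fejer_tendsto[OF p fl])
    \<comment> \<open>The Fejer means of \<open>f\<close> need not be orthogonal to
      \<open>\<phi>\<close>. For \<open>p \<ge> 2\<close> both functions are square integrable, so
      the pairings of the means with \<open>\<phi>\<close> tend to the pairing of
      \<open>f\<close>.\<close>
    then have lim2: "lp_tendsto 2 (\<lambda>n. fejer (Suc n) f) f" using lp_tendsto_mono[of 2 p] False by simp
    have "(\<lambda>n. complex_of_real c * pairing (fejer (Suc n) f) \<phi>) \<longlonglongrightarrow> complex_of_real c * pairing f \<phi>"
      by (intro tendsto_intros pairing_tendsto_lp2[OF lim2 \<phi>2])
    then have "(\<lambda>n. pairing (fejer (Suc n) f) ?\<psi>) \<longlonglongrightarrow> complex_of_real c * pairing f \<phi>"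
      by (simp add: hilbert_eigen_pairing[OF assms hardy_fejer[OF f]])
    moreover have "(\<lambda>n. pairing (fejer (Suc n) f) ?\<psi>) \<longlonglongrightarrow> pairing f ?\<psi>"
      by (rule pairing_duality_map_tendsto[OF p \<phi>_lp lim])
    ultimately show ?thesis using LIMSEQ_unique orth0 by fastforce
  qed
  moreover have "pairing (\<lambda>z. \<phi> z + f z) ?\<psi> = pairing \<phi> ?\<psi> + pairing f ?\<psi>"
    unfolding pairing_def distrib_right
    by (intro Bochner_Integration.integral_add pairing_duality_map(1)[OF p \<phi>_lp] \<phi>_lp fl)
  ultimately have "pairing (\<lambda>z. \<phi> z + f z) ?\<psi> = complex_of_real (Ip p \<phi>)"
    by (simp add: pairing_self_duality_map[OF p \<phi>_lp])
  then have "Ip p \<phi> \<le> lp_norm (ereal p) (\<lambda>z. \<phi> z + f z) * lp_norm (ereal p) \<phi> powr (p - 1)"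
    using pairing_duality_map(2)[OF p \<phi>_lp lp_add(1)[OF _ \<phi>_lp fl]] p by simp
  then show "lp_norm (ereal p) \<phi> \<le> lp_norm (ereal p) (\<lambda>z. \<phi> z + f z)"
    using lp_norm_pos by (simp add: Ip_eq_norm_mult)
qed

end

section \<open>The derivative of the p-th power of the norm\<close>

lemma powr_diff_le:
  fixes x y p :: real
  assumes "1 \<le> p" "0 \<le> y" "y \<le> x"
  shows "x powr p - y powr p \<le> p * (x - y) * x powr (p - 1)"
proof -
  have "x powr p = x * x powr (p - 1)" using assms by (cases "x = 0") (simp_all add: powr_diff)
  then show ?thesis using Young_tangent[of p y x] assms by (simp add: algebra_simps)
qed

lemma abs_powr_diff_le:
  fixes x y p :: real
  assumes "1 \<le> p" "0 \<le> x" "0 \<le> y" "x \<le> m" "y \<le> m"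
  shows "\<bar>x powr p - y powr p\<bar> \<le> p * \<bar>x - y\<bar> * m powr (p - 1)"
proof -
  have *: "p * \<bar>x - y\<bar> * x powr (p - 1) \<le> p * \<bar>x - y\<bar> * m powr (p - 1)"
    "p * \<bar>x - y\<bar> * y powr (p - 1) \<le> p * \<bar>x - y\<bar> * m powr (p - 1)"
    using assms by (auto intro!: mult_left_mono powr_mono2)
  consider "y \<le> x" | "x \<le> y" by linarith
  then show ?thesis
  proof cases
    case 1
    then have "y powr p \<le> x powr p" using assms by (intro powr_mono2) auto
    then have "\<bar>x powr p - y powr p\<bar> \<le> p * \<bar>x - y\<bar> * x powr (p - 1)"
      using powr_diff_le[of p y x] 1 assms by simp
    then show ?thesis using *(1) by (rule order_trans)
  next
    case 2
    then have "x powr p \<le> y powr p" using assms by (intro powr_mono2) auto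
    then have "\<bar>x powr p - y powr p\<bar> \<le> p * \<bar>x - y\<bar> * y powr (p - 1)"
      using powr_diff_le[of p x y] 2 assms by simp
    then show ?thesis using *(2) by (rule order_trans)
  qed
qed

text \<open>For \<open>a \<noteq> 0\<close> the squared modulus along the line is a quadratic
  polynomial positive at 0, so its power \<open>p / 2\<close> is differentiable there. For
  \<open>a = 0\<close> the quotient is \<open>X n powr (p - 1) * cmod b powr p\<close>, which tends
  to 0 when p > 1.\<close>

lemma powr_norm_quotient_tendsto:
  fixes a b :: complex
  assumes "1 < p \<or> (p = 1 \<and> a \<noteq> 0)" and X_pos: "\<And>n. 0 < X n" and X: "X \<longlonglongrightarrow> (0::real)"
  shows "(\<lambda>n. (cmod (a + complex_of_real (X n) * b) powr p - cmod a powr p) / X n)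
     \<longlonglongrightarrow> p * Re (b * cnj (complex_of_real (cmod a powr (p - 2)) * a))"
proof -
  show ?thesis
  proof (cases "a = 0")
    case True
    then have p: "1 < p" using assms by simp
    have "(\<lambda>n. X n powr (p - 1) * cmod b powr p) \<longlonglongrightarrow> 0 powr (p - 1) * cmod b powr p"
      using p X_pos by (intro tendsto_intros tendsto_powr2 X) (auto simp: less_imp_le)
    moreover have "X n powr (p - 1) * cmod b powr p = cmod (complex_of_real (X n) * b) powr p / X n" for n
      using X_pos[of n] by (simp add: norm_mult powr_mult powr_diff)
    ultimately show ?thesis using True p by simp
  next
    case False
    define q where "q t = (Re a + t * Re b)\<^sup>2 + (Im a + t * Im b)\<^sup>2" for t
    have q: "cmod (a + complex_of_real t * b) powr p = q t powr (p / 2)" for t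
    proof -
      have "cmod (a + complex_of_real t * b) = sqrt (q t)" by (simp add: q_def cmod_def)
      moreover have "q t \<ge> 0" by (simp add: q_def)
      ultimately show ?thesis by (simp add: powr_powr flip: powr_half_sqrt)
    qed
    have q0: "q 0 = (cmod a)\<^sup>2" by (simp add: q_def cmod_power2)
    then have q0_pos: "q 0 > 0" using False by simp
    have "((\<lambda>t. q t powr (p / 2)) has_real_derivative (p / 2) * q 0 powr (p / 2 - 1) * (2 * (Re a * Re b + Im a * Im b))) (at 0)"
      using q0_pos unfolding q_def by (auto intro!: derivative_eq_intros simp: algebra_simps)
    then have "((\<lambda>h. (q (0 + h) powr (p / 2) - q 0 powr (p / 2)) / h) \<longlongrightarrow>
        (p / 2) * q 0 powr (p / 2 - 1) * (2 * (Re a * Re b + Im a * Im b))) (at 0)"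
      by (simp only: DERIV_def)
    then have lim: "(\<lambda>n. (q (0 + X n) powr (p / 2) - q 0 powr (p / 2)) / X n) \<longlonglongrightarrow>
        (p / 2) * q 0 powr (p / 2 - 1) * (2 * (Re a * Re b + Im a * Im b))"
      by (rule filterlim_compose) (use X_pos in \<open>auto simp: filterlim_at less_imp_neq[symmetric] intro!: X\<close>)
    have "q 0 = cmod a powr 2" using False by (simp add: q0 powr_numeral)
    then have "q 0 powr (p / 2 - 1) = cmod a powr (p - 2)"
      by (simp only: powr_powr right_diff_distrib) simp
    then have D: "(p / 2) * q 0 powr (p / 2 - 1) * (2 * (Re a * Re b + Im a * Im b)) =
        p * Re (b * cnj (complex_of_real (cmod a powr (p - 2)) * a))"
      by (simp add: algebra_simps)
    have "q 0 powr (p / 2) = cmod a powr p" using q[of 0] by simp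
    then show ?thesis using lim by (simp only: q D add_0)
  qed
qed

lemma Ip_derivative:
  fixes \<phi> g :: "('d::finite \<Rightarrow> complex) \<Rightarrow> complex"
  assumes p: "1 \<le> p" and \<phi>: "\<phi> \<in> lp_space (ereal p)" and nz: "p = 1 \<Longrightarrow> AE z in torus_haar. \<phi> z \<noteq> 0"
    and g: "g \<in> trig_polys S" and X_pos: "\<And>n. 0 < X n" and X_le: "\<And>n. X n \<le> 1" and X: "X \<longlonglongrightarrow> (0::real)"
  shows "(\<lambda>n. (Ip p (\<lambda>z. \<phi> z + complex_of_real (X n) * g z) - Ip p \<phi>) / X n)
     \<longlonglongrightarrow> p * Re (pairing g (duality_map p \<phi>))"
proof -
  have p0: "0 < p" using p by simp
  have gl: "g \<in> lp_space (ereal p)" using trig_polys_lp[OF g, of p] p by simp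
  have [measurable]: "\<phi> \<in> borel_measurable torus_haar" "g \<in> borel_measurable torus_haar"
    using \<phi> trig_polys_measurable[OF g] by (auto simp: lp_space_ereal)
  obtain B where B: "B \<ge> 0" "\<And>z. z \<in> space torus_haar \<Longrightarrow> cmod (g z) \<le> B" using trig_polys_bounded[OF g] by metis
  have int: "integrable torus_haar (\<lambda>z. cmod (\<phi> z + complex_of_real (X n) * g z) powr p)" for n
    using lp_add(1)[OF p0 \<phi> lp_scale[OF gl, of "complex_of_real (X n)"]] by (simp add: lp_space_ereal)
  have int0: "integrable torus_haar (\<lambda>z. cmod (\<phi> z) powr p)" using \<phi> by (simp add: lp_space_ereal)
  \<comment> \<open>With \<open>cmod (g z) \<le> B\<close> and \<open>X n \<le> 1\<close>, all
    moduli stay below \<open>cmod (\<phi> z) + B\<close>, so \<open>abs_powr_diff_le\<close>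
    dominates the quotients. Holder against the constant 1 makes the dominating function
    integrable.\<close>
  have "(\<lambda>n. LINT z|torus_haar. (cmod (\<phi> z + complex_of_real (X n) * g z) powr p - cmod (\<phi> z) powr p) / X n)
      \<longlonglongrightarrow> (LINT z|torus_haar. p * Re (g z * cnj (duality_map p \<phi> z)))"
  proof (rule integral_dominated_convergence[where w="\<lambda>z. p * B * (cmod (\<phi> z) + B) powr (p - 1)"])
    show "AE z in torus_haar. (\<lambda>n. (cmod (\<phi> z + complex_of_real (X n) * g z) powr p - cmod (\<phi> z) powr p) / X n)
      \<longlonglongrightarrow> p * Re (g z * cnj (duality_map p \<phi> z))"
    proof (cases "p = 1")
      case True
      from nz[OF this] show ?thesis
        by eventually_elim (unfold duality_map_def, rule powr_norm_quotient_tendsto[OF _ X_pos X], simp add: True)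
    next
      case False
      then show ?thesis
        using p by (intro AE_I2) (unfold duality_map_def, rule powr_norm_quotient_tendsto[OF _ X_pos X], simp)
    qed
    define h where "h = (\<lambda>z. complex_of_real (cmod (\<phi> z) + B))"
    have h: "h \<in> lp_space (ereal p)"
    proof -
      have "(\<lambda>z. complex_of_real (cmod (\<phi> z))) \<in> lp_space (ereal p)" using int0 by (simp add: lp_space_ereal)
      moreover have "(\<lambda>z. complex_of_real B) \<in> lp_space (ereal p)" by (simp add: lp_space_ereal)
      ultimately show ?thesis using lp_add(1)[OF p0] by (simp add: h_def)
    qed
    have norm_h: "cmod (h z) = cmod (\<phi> z) + B" for z
      using B(1) unfolding h_def norm_of_real by simp
    have "(\<lambda>z. 1) \<in> lp_space (ereal p)" by (simp add: lp_space_ereal)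
    from Holder(1)[OF p this h] show "integrable torus_haar (\<lambda>z. p * B * (cmod (\<phi> z) + B) powr (p - 1))"
      by (simp add: norm_h)
    show "AE z in torus_haar. norm ((cmod (\<phi> z + complex_of_real (X n) * g z) powr p - cmod (\<phi> z) powr p) / X n)
        \<le> p * B * (cmod (\<phi> z) + B) powr (p - 1)" for n
    proof (rule AE_I2)
      fix z :: "'d \<Rightarrow> complex" assume z: "z \<in> space torus_haar"
      note X = X_pos[of n] X_le[of n]
      have Xg: "cmod (complex_of_real (X n) * g z) \<le> X n * B"
        unfolding norm_mult norm_of_real using X B(2)[OF z] by (intro mult_mono) auto
      also have "\<dots> \<le> B" using X B(1) by (intro mult_left_le_one_le) auto
      finally have XB: "cmod (complex_of_real (X n) * g z) \<le> B" .
      have diff: "\<bar>cmod (\<phi> z + complex_of_real (X n) * g z) - cmod (\<phi> z)\<bar> \<le> X n * B"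
        using norm_triangle_ineq3[of "\<phi> z + complex_of_real (X n) * g z" "\<phi> z"] Xg by simp
      have "\<bar>cmod (\<phi> z + complex_of_real (X n) * g z) powr p - cmod (\<phi> z) powr p\<bar>
          \<le> p * \<bar>cmod (\<phi> z + complex_of_real (X n) * g z) - cmod (\<phi> z)\<bar> * (cmod (\<phi> z) + B) powr (p - 1)"
        using norm_triangle_ineq[of "\<phi> z" "complex_of_real (X n) * g z"] XB B(1)
        by (intro abs_powr_diff_le p) auto
      also have "\<dots> \<le> p * (X n * B) * (cmod (\<phi> z) + B) powr (p - 1)"
        using p diff by (intro mult_right_mono mult_left_mono) auto
      finally have "\<bar>cmod (\<phi> z + complex_of_real (X n) * g z) powr p - cmod (\<phi> z) powr p\<bar>
          \<le> (p * B * (cmod (\<phi> z) + B) powr (p - 1)) * X n" by (simp only: mult_ac)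
      then show "norm ((cmod (\<phi> z + complex_of_real (X n) * g z) powr p - cmod (\<phi> z) powr p) / X n)
          \<le> p * B * (cmod (\<phi> z) + B) powr (p - 1)"
        unfolding real_norm_def abs_divide abs_of_pos[OF X(1)] by (simp only: pos_divide_le_eq[OF X(1)])
    qed
  qed (measurable)
  also have "(LINT z|torus_haar. p * Re (g z * cnj (duality_map p \<phi> z))) = p * Re (pairing g (duality_map p \<phi>))"
    using pairing_duality_map(1)[OF p \<phi> gl] by (simp only: pairing_def integral_Re integral_mult_right_zero)
  also have "(\<lambda>n. LINT z|torus_haar. (cmod (\<phi> z + complex_of_real (X n) * g z) powr p - cmod (\<phi> z) powr p) / X n)
     = (\<lambda>n. (Ip p (\<lambda>z. \<phi> z + complex_of_real (X n) * g z) - Ip p \<phi>) / X n)"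
    using int int0 by (simp only: integral_divide_zero Bochner_Integration.integral_diff)
  finally show ?thesis .
qed

context
  fixes p :: real and \<phi> :: "('d::finite \<Rightarrow> complex) \<Rightarrow> complex"
  assumes p: "1 \<le> p" and \<phi>: "\<phi> \<in> hardy (ereal p)" and nontriv: "nontrivial \<phi>"
    and hilbert: "hilbert_point (ereal p) \<phi>"
begin

text \<open>All complex multiples of \<open>g\<close> are admissible perturbations, so the one-sided
  derivative of the norm is nonnegative in each of these directions. A complex linear functional
  with nonnegative real part on all multiples of a vector vanishes on it.\<close>

lemma hilbert_point_variation:
  assumes g: "g \<in> trig_polys nonneg_indices" and orth: "pairing g \<phi> = 0"
  shows "pairing g (duality_map p \<phi>) = 0"
proof -
  have p0: "0 < p" using p by simp
  have \<phi>l: "\<phi> \<in> lp_space (ereal p)" using \<phi> by (simp add: hardy_def)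
  have nz: "AE z in torus_haar. \<phi> z \<noteq> 0" if "p = 1"
    using hardy_AE_nonzero \<phi> nontriv that by auto
  have le: "Ip p \<phi> \<le> Ip p (\<lambda>z. \<phi> z + a * g z)" for a
  proof -
    have ag: "(\<lambda>z. a * g z) \<in> trig_polys nonneg_indices" by (rule trig_polys_scale[OF g])
    have hardy: "(\<lambda>z. a * g z) \<in> hardy (ereal p)" using trig_polys_hardy[OF ag] p by simp
    then have agl: "(\<lambda>z. a * g z) \<in> lp_space (ereal p)" by (simp add: hardy_def)
    have orth': "pairing (\<lambda>z. a * g z) \<phi> = 0"
      using orth by (simp add: pairing_def mult.assoc)
    have "lp_tendsto (ereal p) (\<lambda>_ z. a * g z) (\<lambda>z. a * g z)"
      using agl p0 by (simp add: lp_tendsto_iff)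
    then have "hardy_orthogonal (ereal p) (\<lambda>z. a * g z) \<phi>"
      using orth' ag unfolding hardy_orthogonal_def analytic_polys_eq by (auto intro!: exI[of _ "\<lambda>_ z. a * g z"])
    then have "lp_norm (ereal p) \<phi> \<le> lp_norm (ereal p) (\<lambda>z. \<phi> z + a * g z)"
      using hilbert hardy by (simp add: hilbert_point_def)
    then have "lp_norm (ereal p) \<phi> powr p \<le> lp_norm (ereal p) (\<lambda>z. \<phi> z + a * g z) powr p"
      using p0 by (intro powr_mono2) (auto simp: lp_norm_ereal)
    then show ?thesis using p0 by (simp add: lp_norm_ereal powr_powr)
  qed
  have Re_nonneg: "0 \<le> Re (a * pairing g (duality_map p \<phi>))" for a
  proof -
    have "0 \<le> p * Re (pairing (\<lambda>z. a * g z) (duality_map p \<phi>))"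
    proof (rule tendsto_lowerbound[OF Ip_derivative[OF p \<phi>l nz trig_polys_scale[OF g, of a] _ _ LIMSEQ_inverse_real_of_nat]])
      show "\<forall>\<^sub>F n in sequentially. 0 \<le> (Ip p (\<lambda>z. \<phi> z + complex_of_real (inverse (real (Suc n))) * (a * g z)) - Ip p \<phi>) / inverse (real (Suc n))"
        using le[of "complex_of_real (inverse (real (Suc n))) * a" for n]
        by (intro always_eventually allI divide_nonneg_nonneg) (simp_all add: mult.assoc)
    qed (auto simp: divide_simps)
    moreover have "pairing (\<lambda>z. a * g z) (duality_map p \<phi>) = a * pairing g (duality_map p \<phi>)"
      by (simp add: pairing_def mult.assoc)
    ultimately show ?thesis using p0 by (simp add: zero_le_mult_iff)
  qed
  \<comment> \<open>The multiple used is minus the conjugate of the pairing, for which nonnegativity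
    says that minus a squared modulus is at least 0.\<close>
  have eq: "- cnj (pairing g (duality_map p \<phi>)) * pairing g (duality_map p \<phi>) =
      - complex_of_real ((cmod (pairing g (duality_map p \<phi>)))\<^sup>2)"
    unfolding complex_norm_square by simp
  have "0 \<le> Re (- complex_of_real ((cmod (pairing g (duality_map p \<phi>)))\<^sup>2))"
    using Re_nonneg[of "- cnj (pairing g (duality_map p \<phi>))"] unfolding eq .
  then show ?thesis by simp
qed

text \<open>Testing with combinations of two characters orthogonal to \<open>\<phi>\<close> shows
  that the coefficients are proportional. The factor obtained this way is only complex; its
  positivity needs a separate argument, since \<open>\<phi>\<close> may fail to be square integrable
  and cannot simply be paired with itself.\<close>

lemma hilbert_point_imp_hilbert_eigen: "\<exists>c>0. hilbert_eigen p c \<phi>"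
proof -
  let ?\<psi> = "duality_map p \<phi>"
  have \<phi>l: "\<phi> \<in> lp_space (ereal p)" using \<phi> by (simp add: hardy_def)
  have \<phi>i: "integrable torus_haar \<phi>" by (rule hardy_integrable[OF p \<phi>])
  have \<psi>i: "integrable torus_haar ?\<psi>" by (rule integrable_duality_map[OF p \<phi>l])
  obtain \<beta> where \<beta>: "fourier \<phi> \<beta> \<noteq> 0"
    using fourier_zero_imp_AE_zero[OF p \<phi>l] nontriv by (auto simp: nontrivial_def)
  then have \<beta>N: "\<beta> \<in> nonneg_indices" using \<phi> by (auto simp: hardy_def)
  define c where "c = fourier ?\<psi> \<beta> / fourier \<phi> \<beta>"
  have c: "fourier ?\<psi> \<alpha> = c * fourier \<phi> \<alpha>" if \<alpha>: "\<alpha> \<in> nonneg_indices" for \<alpha>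
  proof -
    \<comment> \<open>The multiple of the character of \<open>\<beta>\<close> that makes the
      difference of the two orthogonal to \<open>\<phi>\<close>.\<close>
    define k where "k = cnj (fourier \<phi> \<alpha>) / cnj (fourier \<phi> \<beta>)"
    have pair: "pairing (\<lambda>z. 1 * character \<alpha> z - k * character \<beta> z) h = cnj (fourier h \<alpha>) - k * cnj (fourier h \<beta>)"
      if "integrable torus_haar h" for h
      using integrable_trig_poly_mult[OF trig_polys_character[of \<alpha> UNIV 1] that] integrable_trig_poly_mult[OF trig_polys_character[of \<beta> UNIV k] that]
        integrable_trig_poly_mult[OF trig_polys_character[of \<beta> UNIV 1] that]
      by (simp add: pairing_def left_diff_distrib mult.assoc pairing_character[unfolded pairing_def])
    have "pairing (\<lambda>z. 1 * character \<alpha> z - k * character \<beta> z) ?\<psi> = 0"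
    proof (rule hilbert_point_variation)
      show "(\<lambda>z. 1 * character \<alpha> z - k * character \<beta> z) \<in> trig_polys nonneg_indices"
        by (intro trig_polys_diff trig_polys_character \<alpha> \<beta>N)
      show "pairing (\<lambda>z. 1 * character \<alpha> z - k * character \<beta> z) \<phi> = 0"
        using pair[OF \<phi>i] \<beta> by (simp add: k_def)
    qed
    then have "cnj (fourier ?\<psi> \<alpha>) = k * cnj (fourier ?\<psi> \<beta>)" using pair[OF \<psi>i] by simp
    then have "cnj (cnj (fourier ?\<psi> \<alpha>)) = cnj (k * cnj (fourier ?\<psi> \<beta>))" by simp
    then show ?thesis by (simp add: k_def c_def)
  qed
  \<comment> \<open>Fejer means replace the pairing of \<open>\<phi>\<close> with itself. The
    numbers \<open>r n\<close> are nonnegative and \<open>cnj c * r n\<close> tends to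
    \<open>Ip p \<phi> > 0\<close>. So does \<open>cmod c * r n\<close>, and comparing the two
    limits forces \<open>c\<close> to be its own modulus.\<close>
  define r where "r n = Re (pairing (fejer (Suc n) \<phi>) \<phi>)" for n
  have r: "pairing (fejer (Suc n) \<phi>) \<phi> = complex_of_real (r n)" "r n \<ge> 0" for n
  proof -
    have "pairing (fejer (Suc n) \<phi>) \<phi> = complex_of_real ((\<Sum>\<beta>\<in>cube (Suc n). \<Sum>\<gamma>\<in>cube (Suc n).
      (cmod (fourier \<phi> (\<lambda>i. \<beta> i - \<gamma> i)))\<^sup>2) / real (card (cube (Suc n) :: ('d \<Rightarrow> int) set)))"
      unfolding pairing_fejer[OF \<phi>i] of_real_divide of_real_sum complex_norm_square by simp
    then show "pairing (fejer (Suc n) \<phi>) \<phi> = complex_of_real (r n)" "r n \<ge> 0"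
      by (simp_all add: r_def sum_nonneg)
  qed
  have "pairing (fejer (Suc n) \<phi>) ?\<psi> = cnj c * pairing (fejer (Suc n) \<phi>) \<phi>" for n
  proof -
    have *: "fourier \<phi> \<alpha> * cnj (fourier ?\<psi> \<alpha>) = cnj c * (fourier \<phi> \<alpha> * cnj (fourier \<phi> \<alpha>))" for \<alpha>
      using c[of \<alpha>] \<phi> by (cases "\<alpha> \<in> nonneg_indices") (auto simp: hardy_def)
    show ?thesis
      unfolding pairing_fejer[OF \<phi>i] pairing_fejer[OF \<psi>i]
      by (simp only: * sum_distrib_left times_divide_eq_right)
  qed
  then have lim: "(\<lambda>n. cnj c * complex_of_real (r n)) \<longlonglongrightarrow> complex_of_real (Ip p \<phi>)"
    using pairing_duality_map_tendsto[OF p \<phi>l fejer_tendsto[OF p \<phi>l]]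
    by (simp add: pairing_self_duality_map[OF p \<phi>l] r(1))
  have pos: "Ip p \<phi> > 0" by (rule Ip_pos[OF p \<phi> nontriv])
  have c0: "c \<noteq> 0"
  proof
    assume "c = 0"
    then show False using lim pos by (simp add: LIMSEQ_const_iff)
  qed
  have "(\<lambda>n. cmod (cnj c * complex_of_real (r n))) \<longlonglongrightarrow> cmod (complex_of_real (Ip p \<phi>))"
    by (intro tendsto_norm lim)
  then have "(\<lambda>n. cmod c * r n) \<longlonglongrightarrow> Ip p \<phi>" using r(2) pos by (simp add: norm_mult)
  then have "(\<lambda>n. cnj c * complex_of_real (cmod c * r n) / cmod c) \<longlonglongrightarrow> cnj c * complex_of_real (Ip p \<phi>) / cmod c"
    using c0 by (intro tendsto_intros) auto
  moreover have "cnj c * complex_of_real (cmod c * r n) / cmod c = cnj c * complex_of_real (r n)" for n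
    using c0 by simp
  ultimately have "(\<lambda>n. cnj c * complex_of_real (r n)) \<longlonglongrightarrow> cnj c * complex_of_real (Ip p \<phi>) / cmod c"
    by (simp only:)
  then have "cnj c * complex_of_real (Ip p \<phi>) / cmod c = complex_of_real (Ip p \<phi>)"
    using lim by (rule LIMSEQ_unique)
  then have "cnj c = complex_of_real (cmod c)" using c0 pos by (simp add: field_simps)
  then have "c = complex_of_real (cmod c)" by (metis complex_cnj_cnj complex_cnj_complex_of_real)
  then show ?thesis using c c0 unfolding hilbert_eigen_def by (intro exI[of _ "cmod c"]) auto
qed

end

section \<open>The Riesz projection and Fourier coefficients\<close>

lemma fourier_tendsto:
  assumes "1 \<le> q" "lp_tendsto (ereal q) F f"
  shows "(\<lambda>n. fourier (F n) \<alpha>) \<longlonglongrightarrow> fourier f \<alpha>"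
proof -
  have "lp_tendsto (ereal 1) F f" using lp_tendsto_mono[of 1 q F f] assms by simp
  then have F: "\<And>n. F n \<in> lp_space (ereal 1)" and f: "f \<in> lp_space (ereal 1)"
    and lim: "(\<lambda>n. Ip 1 (\<lambda>z. F n z - f z)) \<longlonglongrightarrow> 0"
    by (auto simp: lp_tendsto_iff)
  have int: "integrable torus_haar (F n)" "integrable torus_haar f" for n
    using lp_integrable[OF _ F] lp_integrable[OF _ f] by auto
  have "cmod (fourier (F n) \<alpha> - fourier f \<alpha>) \<le> Ip 1 (\<lambda>z. F n z - f z)" for n
  proof -
    have "cmod (fourier (F n) \<alpha> - fourier f \<alpha>) = cmod (fourier (\<lambda>z. F n z - f z) \<alpha>)"
      by (simp add: fourier_diff int)
    also have "\<dots> \<le> (LINT z|torus_haar. norm ((F n z - f z) * cnj (character \<alpha> z)))"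
      unfolding fourier_def by (rule integral_norm_bound)
    also have "\<dots> = Ip 1 (\<lambda>z. F n z - f z)"
      by (intro Bochner_Integration.integral_cong) (auto simp: norm_mult)
    finally show ?thesis .
  qed
  then have "(\<lambda>n. fourier (F n) \<alpha> - fourier f \<alpha>) \<longlonglongrightarrow> 0"
    by (intro Lim_null_comparison[OF always_eventually lim] allI)
  then show ?thesis by (simp add: LIM_zero_iff)
qed

lemma hardy_2_integrable: "g \<in> hardy 2 \<Longrightarrow> integrable torus_haar g"
  using hardy_integrable[of 2 g] by simp

lemma is_riesz_proj_fourier:
  assumes "is_riesz_proj f h" "\<alpha> \<in> nonneg_indices"
  shows "fourier f \<alpha> = fourier h \<alpha>"
proof -
  obtain q F G where q: "1 < q" and FG: "\<And>n. is_orth_proj (F n) (G n)"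
    and F: "lp_tendsto (ereal q) F f" and G: "lp_tendsto (ereal q) G h"
    using assms(1) by (auto simp: is_riesz_proj_def)
  have "fourier (F n) \<alpha> = fourier (G n) \<alpha>" for n
  proof -
    have "integrable torus_haar (F n)" "integrable torus_haar (G n)"
      using FG[of n] lp_integrable[of 2 "F n"] by (auto simp: is_orth_proj_def hardy_2_integrable)
    moreover have "(\<lambda>z. 1 * character \<alpha> z) \<in> hardy 2"
      using trig_polys_hardy[OF trig_polys_character[OF assms(2), of 1], of 2] by simp
    then have "pairing (\<lambda>z. F n z - G n z) (character \<alpha>) = 0"
      using FG[of n] by (simp add: is_orth_proj_def)
    then have "fourier (\<lambda>z. F n z - G n z) \<alpha> = 0" by (simp add: pairing_def fourier_def)
    ultimately show ?thesis by (simp add: fourier_diff)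
  qed
  then have "(\<lambda>n. fourier (F n) \<alpha>) \<longlonglongrightarrow> fourier h \<alpha>"
    using fourier_tendsto[OF _ G] q by simp
  then show ?thesis
    using fourier_tendsto[OF _ F] q by (intro LIMSEQ_unique[of "\<lambda>n. fourier (F n) \<alpha>"]) auto
qed

text \<open>Fejer means commute with cutting off the spectrum. Hence matching coefficients of merely
  integrable functions give honest projections in L^2, which serve as approximants in
  \<open>is_riesz_proj\<close>.\<close>

lemma is_orth_proj_fejer:
  fixes f h :: "('d::finite \<Rightarrow> complex) \<Rightarrow> complex"
  assumes f: "integrable torus_haar f" and h: "integrable torus_haar h"
    and h0: "\<And>\<alpha>. \<alpha> \<notin> nonneg_indices \<Longrightarrow> fourier h \<alpha> = 0"
    and eq: "\<And>\<alpha>. \<alpha> \<in> nonneg_indices \<Longrightarrow> fourier f \<alpha> = fourier h \<alpha>"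
  shows "is_orth_proj (fejer N f) (fejer N h)"
  unfolding is_orth_proj_def
proof (intro conjI ballI)
  show "fejer N f \<in> lp_space 2" using trig_polys_lp[OF fejer_trig_polys_UNIV, of 2] by simp
  show "fejer N h \<in> hardy 2" using trig_polys_hardy[OF fejer_trig_polys[OF h0], of 2] by simp
  fix g :: "('d \<Rightarrow> complex) \<Rightarrow> complex" assume g: "g \<in> hardy 2"
  have "fourier (\<lambda>z. f z - h z) \<alpha> * cnj (fourier g \<alpha>) = 0" for \<alpha>
    using eq[of \<alpha>] g by (cases "\<alpha> \<in> nonneg_indices") (auto simp: fourier_diff[OF f h] hardy_def)
  then have "pairing (fejer N (\<lambda>z. f z - h z)) g = 0"
    unfolding pairing_fejer[OF hardy_2_integrable[OF g]] by (simp only: sum.neutral_const div_0)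
  then show "pairing (\<lambda>z. fejer N f z - fejer N h z) g = 0"
    by (simp add: fejer_diff[OF f h] pairing_def)
qed

lemma is_orth_proj_norm_le:
  assumes "is_orth_proj F G"
  shows "Ip 2 G \<le> Ip 2 F"
proof -
  have F: "F \<in> lp_space 2" and G: "G \<in> lp_space 2" and "pairing (\<lambda>z. F z - G z) G = 0"
    using assms by (auto simp: is_orth_proj_def hardy_def)
  then have "pairing F G = pairing G G"
    using pairing_lp2(1)[OF F G] pairing_lp2(1)[OF G G] by (simp add: pairing_def left_diff_distrib)
  then have "lp_norm 2 G * lp_norm 2 G \<le> lp_norm 2 F * lp_norm 2 G"
    using pairing_lp2(2)[OF F G] by (simp add: pairing_self[OF G] norm_power flip: power2_eq_square)
  moreover have nn: "lp_norm 2 G \<ge> 0" "lp_norm 2 F \<ge> 0"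
    using lp_norm_ereal[of 2 F] lp_norm_ereal[of 2 G] by simp_all
  ultimately have "lp_norm 2 G \<le> lp_norm 2 F"
    by (metis mult_right_le_imp_le order_le_less)
  then show ?thesis
    unfolding lp_norm_2[symmetric] using nn by (intro power_mono)
qed

lemma fourier_imp_is_riesz_proj:
  assumes q: "1 < q" and f: "f \<in> lp_space (ereal q)" and h: "h \<in> hardy (ereal q)"
    and eq: "\<And>\<alpha>. \<alpha> \<in> nonneg_indices \<Longrightarrow> fourier f \<alpha> = fourier h \<alpha>"
  shows "is_riesz_proj f h"
proof -
  have hl: "h \<in> lp_space (ereal q)" using h by (simp add: hardy_def)
  have "is_orth_proj (fejer (Suc n) f) (fejer (Suc n) h)" for n
    using q f h eq by (intro is_orth_proj_fejer lp_integrable[of q] hl) (auto simp: hardy_def)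
  moreover have "lp_tendsto (ereal q) (\<lambda>n. fejer (Suc n) f) f" "lp_tendsto (ereal q) (\<lambda>n. fejer (Suc n) h) h"
    using q f hl by (auto intro: fejer_tendsto)
  ultimately show ?thesis
    unfolding is_riesz_proj_def using q
    by (intro exI[of _ q] conjI exI[of _ "\<lambda>n. fejer (Suc n) f"] exI[of _ "\<lambda>n. fejer (Suc n) h"]) simp_all
qed

context
  fixes p :: real and \<phi> :: "('d::finite \<Rightarrow> complex) \<Rightarrow> complex"
  assumes p: "1 \<le> p" and \<phi>: "\<phi> \<in> hardy (ereal p)"
begin

text \<open>Both functions must lie in one L^q with q > 1. For p > 1 the dual function lies in the
  conjugate exponent \<open>r\<close>, so the minimum of \<open>p\<close> and \<open>r\<close>
  works. For p = 1 the dual function is bounded but \<open>\<phi>\<close> is only known to be in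
  L^1, and its square integrability comes from the eigenvalue equation.\<close>

lemma hilbert_eigen_imp_is_riesz_proj:
  assumes c: "c > 0" and eig: "hilbert_eigen p c \<phi>"
  shows "is_riesz_proj (duality_map p \<phi>) (\<lambda>z. complex_of_real c * \<phi> z)"
proof -
  let ?\<psi> = "duality_map p \<phi>" and ?h = "\<lambda>z. complex_of_real c * \<phi> z"
  have \<phi>l: "\<phi> \<in> lp_space (ereal p)" using \<phi> by (simp add: hardy_def)
  have \<phi>m [measurable]: "\<phi> \<in> borel_measurable torus_haar" using \<phi>l by (simp add: lp_space_ereal)
  have \<psi>m: "?\<psi> \<in> borel_measurable torus_haar" by measurable
  have eq: "fourier ?\<psi> \<alpha> = fourier ?h \<alpha>" if "\<alpha> \<in> nonneg_indices" for \<alpha>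
    using eig that by (simp add: hilbert_eigen_def fourier_scale)
  have h0: "fourier ?h \<alpha> = 0" if "\<alpha> \<notin> nonneg_indices" for \<alpha>
    using \<phi> that by (simp add: hardy_def fourier_scale)
  have hl: "?h \<in> lp_space (ereal p)" by (rule lp_scale[OF \<phi>l])
  obtain q where q: "1 < q" "?\<psi> \<in> lp_space (ereal q)" "?h \<in> lp_space (ereal q)"
  proof (cases "p = 1")
    case True
    have bd: "cmod (?\<psi> z) \<le> 1" for z
      using powr_le_one_le[of 0 "cmod (\<phi> z)"] by (simp add: norm_duality_map True)
    have \<psi>2: "?\<psi> \<in> lp_space (ereal 2)" using \<psi>m bd by (intro lp_bounded(1)[where B=1]) auto
    have "?h \<in> lp_space (ereal 2)"
    proof (rule lp2_limit)
      show "lp_tendsto (ereal 1) (\<lambda>n. fejer (Suc n) ?h) ?h"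
        using fejer_tendsto[OF p hl] True by simp
      show "fejer (Suc n) ?h \<in> lp_space (ereal 2)" for n
        using trig_polys_lp[OF fejer_trig_polys_UNIV, of 2] by simp
      \<comment> \<open>The means of \<open>?h\<close> are projections of the means of the bounded
        dual function, so their L^2 norms are bounded uniformly in \<open>n\<close>.\<close>
      show "Ip 2 (fejer (Suc n) ?h) \<le> Ip 2 ?\<psi>" for n
      proof -
        have "Ip 2 (fejer (Suc n) ?h) \<le> Ip 2 (fejer (Suc n) ?\<psi>)"
          by (intro is_orth_proj_norm_le is_orth_proj_fejer lp_integrable[OF p hl] integrable_duality_map[OF p \<phi>l] h0 eq)
        also have "\<dots> \<le> Ip 2 ?\<psi>" using \<psi>2 by (intro Ip_fejer_le) auto
        finally show ?thesis .
      qed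
    qed
    then show ?thesis using \<psi>2 that[of 2] by simp
  next
    case False
    then have p1: "1 < p" using p by simp
    define r where "r = p / (p - 1)"
    have r: "1 < r" "(p - 1) * r = p" using p1 by (simp_all add: r_def)
    have \<psi>r: "?\<psi> \<in> lp_space (ereal r)"
      using \<psi>m \<phi>l by (simp add: lp_space_ereal norm_duality_map powr_powr r)
    show ?thesis
    proof (rule that[of "min p r"])
      show "1 < min p r" using p1 r by simp
      show "?\<psi> \<in> lp_space (ereal (min p r))"
        using lp_mono(1)[OF _ _ \<psi>r, of "min p r"] p1 r by simp
      show "?h \<in> lp_space (ereal (min p r))"
        using lp_mono(1)[OF _ _ hl, of "min p r"] p1 r by simp
    qed
  qed
  show ?thesis
    by (rule fourier_imp_is_riesz_proj[OF q(1,2) _ eq]) (use q(3) h0 in \<open>auto simp: hardy_def\<close>)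
qed

theorem hilbert_point_iff_riesz_proj:
  assumes nontriv: "nontrivial \<phi>"
  shows "hilbert_point (ereal p) \<phi> \<longleftrightarrow>
    (\<exists>c::real. c > 0 \<and> is_riesz_proj (duality_map p \<phi>) (\<lambda>z. complex_of_real c * \<phi> z))"
proof
  assume "hilbert_point (ereal p) \<phi>"
  from hilbert_point_imp_hilbert_eigen[OF p \<phi> nontriv this]
  show "\<exists>c::real. c > 0 \<and> is_riesz_proj (duality_map p \<phi>) (\<lambda>z. complex_of_real c * \<phi> z)"
    using hilbert_eigen_imp_is_riesz_proj by blast
next
  assume "\<exists>c::real. c > 0 \<and> is_riesz_proj (duality_map p \<phi>) (\<lambda>z. complex_of_real c * \<phi> z)"
  then obtain c where "is_riesz_proj (duality_map p \<phi>) (\<lambda>z. complex_of_real c * \<phi> z)" by blast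
  then have "hilbert_eigen p c \<phi>"
    by (auto simp: hilbert_eigen_def is_riesz_proj_fourier fourier_scale)
  then show "hilbert_point (ereal p) \<phi>"
    by (rule hilbert_eigen_imp_hilbert_point[OF p \<phi> nontriv])
qed

end

section \<open>The dual norm\<close>

lemma nontrivial_lp_norm_2:
  assumes "f \<in> lp_space 2" "nontrivial f"
  shows "lp_norm 2 f > 0"
proof -
  have "Ip 2 f \<noteq> 0" using Ip_eq_0_iff[of f 2] assms by (auto simp: nontrivial_def)
  then have "Ip 2 f > 0" using Ip_nonneg[of f 2] by linarith
  then show ?thesis using lp_norm_ereal[of 2 f] by simp
qed

section \<open>Hardy spaces with infinite exponent allowed\<close>

lemma lp_norm_infinity:
  fixes f :: "('d::finite \<Rightarrow> complex) \<Rightarrow> complex"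
  assumes "f \<in> lp_space \<infinity>"
  shows "AE z in torus_haar. cmod (f z) \<le> lp_norm \<infinity> f" and "0 \<le> lp_norm \<infinity> f"
    and "\<And>C. AE z in torus_haar. cmod (f z) \<le> C \<Longrightarrow> lp_norm \<infinity> f \<le> C"
proof -
  have [measurable]: "f \<in> borel_measurable torus_haar" using assms by (simp add: lp_space_def)
  obtain C0 where C0: "AE z in torus_haar. cmod (f z) \<le> C0" using assms by (auto simp: lp_space_def)
  let ?e = "esssup torus_haar (\<lambda>z. ereal (cmod (f z)))"
  have AE: "AE z in torus_haar. ereal (cmod (f z)) \<le> ?e" by (rule esssup_AE)
  have le: "?e \<le> ereal C" if "AE z in torus_haar. cmod (f z) \<le> C" for C
    using that by (intro esssup_I) auto
  \<comment> \<open>Since \<open>real_of_ereal\<close> sends infinite values to 0, the norm is the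
    essential supremum only once the latter is known to be finite.\<close>
  have "?e \<ge> 0"
  proof (rule ccontr)
    assume "\<not> ?e \<ge> 0"
    then have neg: "?e < 0" by simp
    have "AE z in (torus_haar :: ('d \<Rightarrow> complex) measure). False"
      using AE
    proof eventually_elim
      case (elim z)
      have "(0::ereal) \<le> ereal (cmod (f z))" by simp
      also have "\<dots> < 0" using elim neg by (rule le_less_trans)
      finally show ?case by simp
    qed
    then show False using torus.AE_False by blast
  qed
  then have e: "?e = ereal (lp_norm \<infinity> f)"
    using le[OF C0] by (cases ?e) (auto simp: lp_norm_def)
  show "AE z in torus_haar. cmod (f z) \<le> lp_norm \<infinity> f" using AE unfolding e by simp
  show "0 \<le> lp_norm \<infinity> f" using \<open>?e \<ge> 0\<close> unfolding e by simp
  show "lp_norm \<infinity> f \<le> C" if "AE z in torus_haar. cmod (f z) \<le> C" for C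
    using le[OF that] unfolding e by simp
qed

lemma ereal_ge_2_cases:
  fixes p :: ereal
  assumes "2 \<le> p"
  obtains r :: real where "p = ereal r" "2 \<le> r" | "p = \<infinity>"
  using assms by (cases p) auto

lemma lp_ge_2:
  assumes p: "2 \<le> p" and f: "f \<in> lp_space p"
  shows "f \<in> lp_space 2" and "lp_norm 2 f \<le> lp_norm p f"
proof -
  have "f \<in> lp_space 2 \<and> lp_norm 2 f \<le> lp_norm p f"
    using p
  proof (cases rule: ereal_ge_2_cases)
    case (1 r)
    then have fr: "f \<in> lp_space (ereal r)" using f by simp
    have "Ip 2 f powr (1 / 2) \<le> (Ip r f powr (2 / r)) powr (1 / 2)"
      using lp_mono(2)[OF _ 1(2) fr] by (intro powr_mono2) auto
    then have "lp_norm 2 f \<le> lp_norm p f"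
      using lp_norm_ereal[of 2 f] by (simp add: 1(1) lp_norm_ereal powr_powr)
    then show ?thesis using lp_mono(1)[OF _ 1(2) fr] by simp
  next
    case 2
    then have f: "f \<in> lp_space \<infinity>" using f by simp
    note K = lp_norm_infinity[OF f]
    have fm [measurable]: "f \<in> borel_measurable torus_haar" using f by (simp add: lp_space_def)
    have le: "AE z in torus_haar. cmod (f z) powr 2 \<le> (lp_norm \<infinity> f)\<^sup>2"
      using K(1) by eventually_elim (simp add: power_mono)
    have int: "integrable torus_haar (\<lambda>z. cmod (f z) powr 2)"
      using le by (intro torus.integrable_const_bound[where B="(lp_norm \<infinity> f)\<^sup>2"]) auto
    then have "f \<in> lp_space (ereal 2)" using fm by (simp only: lp_space_ereal simp_thms)
    moreover have "Ip 2 f \<le> (lp_norm \<infinity> f)\<^sup>2" by (rule torus.integral_le_const[OF int le])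
    then have "lp_norm 2 f \<le> lp_norm \<infinity> f"
      unfolding lp_norm_2[symmetric] using K(2) by (rule power2_le_imp_le)
    ultimately show ?thesis using 2 by simp
  qed
  then show "f \<in> lp_space 2" "lp_norm 2 f \<le> lp_norm p f" by auto
qed

lemma hardy_add:
  assumes p: "1 \<le> p" and f: "f \<in> hardy p" and g: "g \<in> hardy p"
  shows "(\<lambda>z. f z + g z) \<in> hardy p"
proof -
  have "(\<lambda>z. f z + g z) \<in> lp_space p \<and> integrable torus_haar f \<and> integrable torus_haar g"
  proof (cases p)
    case (real r)
    then show ?thesis
      using p f g lp_add(1)[of r f g] by (auto simp: hardy_def intro: lp_integrable)
  next
    case PInf
    then have fg: "f \<in> lp_space \<infinity>" "g \<in> lp_space \<infinity>" using f g by (auto simp: hardy_def)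
    have "AE z in torus_haar. cmod (f z + g z) \<le> lp_norm \<infinity> f + lp_norm \<infinity> g"
      using lp_norm_infinity(1)[OF fg(1)] lp_norm_infinity(1)[OF fg(2)]
      by eventually_elim (rule norm_triangle_le, simp)
    moreover have "f \<in> lp_space (ereal 2)" "g \<in> lp_space (ereal 2)" using lp_ge_2(1)[of \<infinity>] fg by simp_all
    then have "integrable torus_haar f" "integrable torus_haar g" by (auto intro: lp_integrable[of 2])
    ultimately show ?thesis using fg PInf by (auto simp: lp_space_def)
  qed (use p in auto)
  then show ?thesis using f g by (auto simp: hardy_def fourier_add)
qed

lemma hardy_scale:
  assumes p: "1 \<le> p" and f: "f \<in> hardy p"
  shows "(\<lambda>z. c * f z) \<in> hardy p"
proof -
  have "(\<lambda>z. c * f z) \<in> lp_space p"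
  proof (cases p)
    case (real r)
    then show ?thesis using f lp_scale[of f r c] by (simp add: hardy_def)
  next
    case PInf
    then have fi: "f \<in> lp_space \<infinity>" using f by (simp add: hardy_def)
    have "AE z in torus_haar. cmod (c * f z) \<le> cmod c * lp_norm \<infinity> f"
      using lp_norm_infinity(1)[OF fi] by eventually_elim (simp add: norm_mult mult_left_mono)
    then show ?thesis using fi PInf by (auto simp: lp_space_def)
  qed (use p in auto)
  then show ?thesis using f by (simp add: hardy_def fourier_scale)
qed

lemma lp_norm_scale:
  assumes p: "1 \<le> p" and f: "f \<in> hardy p" and c: "c \<noteq> 0"
  shows "lp_norm p (\<lambda>z. c * f z) = cmod c * lp_norm p f"
proof (cases p)
  case (real r)
  then show ?thesis
    using p by (simp add: lp_norm_ereal Ip_scale powr_mult powr_powr del: norm_mult)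
next
  case PInf
  have le: "lp_norm \<infinity> (\<lambda>z. a * g z) \<le> cmod a * lp_norm \<infinity> g" if g: "g \<in> hardy p" for a and g :: "('a \<Rightarrow> complex) \<Rightarrow> complex"
  proof -
    have gi: "g \<in> lp_space \<infinity>" "(\<lambda>z. a * g z) \<in> lp_space \<infinity>"
      using g hardy_scale[OF p g] PInf by (auto simp: hardy_def)
    have "AE z in torus_haar. cmod (a * g z) \<le> cmod a * lp_norm \<infinity> g"
      using lp_norm_infinity(1)[OF gi(1)] by eventually_elim (simp add: norm_mult mult_left_mono)
    then show ?thesis by (rule lp_norm_infinity(3)[OF gi(2)])
  qed
  \<comment> \<open>Equality follows from the inequality \<open>le\<close> for \<open>c\<close> and,
    applied to the scaled function, for its inverse.\<close>
  have "lp_norm \<infinity> (\<lambda>z. inverse c * (c * f z)) \<le> cmod (inverse c) * lp_norm \<infinity> (\<lambda>z. c * f z)"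
    by (rule le[OF hardy_scale[OF p f]])
  moreover have "(\<lambda>z. inverse c * (c * f z)) = f" using c by (auto simp: field_simps)
  ultimately have "lp_norm \<infinity> f \<le> lp_norm \<infinity> (\<lambda>z. c * f z) / cmod c" by (simp add: norm_inverse divide_inverse mult.commute)
  then have "cmod c * lp_norm \<infinity> f \<le> lp_norm \<infinity> (\<lambda>z. c * f z)" using c by (simp add: pos_le_divide_eq mult.commute)
  then show ?thesis using le[OF f, of c] PInf by simp
qed (use p in auto)

text \<open>A positive finite \<open>N\<close> with finite product \<open>N * D\<close> forces the
  extended real \<open>D\<close> to be finite. Here \<open>D\<close> is the dual norm and
  \<open>a\<close> the norm of a function whose pairing with \<open>\<phi>\<close> is
  \<open>Q\<close>.\<close>

lemma norm_le_of_dual_norm: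
  fixes N Q a :: real
  assumes "N > 0" "Q > 0" "a > 0" "ereal N * D = ereal Q" "ereal (Q / a) \<le> D"
  shows "N \<le> a"
proof -
  obtain d where d: "D = ereal d" using assms(1,2,4) by (cases D) auto
  then have "N * d = Q" "Q / a \<le> d" using assms by auto
  then have "N * (Q / a) \<le> Q" using assms(1) by (metis less_imp_le mult_left_mono)
  then have "Q * N \<le> Q * a" using assms(3) by (simp add: pos_divide_le_eq mult.commute)
  then show ?thesis using assms(2) by simp
qed

text \<open>For \<open>p \<ge> 2\<close> the pairing with \<open>\<phi>\<close> is an integral
  bounded on H^p. Perturbing \<open>\<phi>\<close> by orthogonal functions gives exactly the
  functions whose pairing with \<open>\<phi>\<close> is \<open>Q\<close>; by homogeneity, minimality
  of the norm of \<open>\<phi>\<close> among them says that the dual norm is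
  \<open>Q / N\<close>.\<close>

lemma hilbert_point_iff_dual_norm_ge_2:
  fixes \<phi> :: "('d::finite \<Rightarrow> complex) \<Rightarrow> complex"
  assumes p: "2 \<le> p" and \<phi>: "\<phi> \<in> hardy p" and nontriv: "nontrivial \<phi>"
  shows "hilbert_point p \<phi> \<longleftrightarrow> ereal (lp_norm p \<phi>) * hardy_dual_norm p \<phi> = ereal ((lp_norm 2 \<phi>)\<^sup>2)"
proof -
  have p1: "1 \<le> p" using p by (rule order_trans[rotated]) simp
  have not_less: "\<not> p < 2" using p by simp
  have l2: "g \<in> lp_space 2" "lp_norm 2 g \<le> lp_norm p g" if "g \<in> hardy p" for g :: "('d \<Rightarrow> complex) \<Rightarrow> complex"
    using lp_ge_2[OF p, of g] that by (auto simp: hardy_def)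
  have pos: "lp_norm p g > 0" if "g \<in> hardy p" "nontrivial g" for g :: "('d \<Rightarrow> complex) \<Rightarrow> complex"
    using nontrivial_lp_norm_2[OF l2(1)] l2(2) that by (meson less_le_trans)
  define N where "N = lp_norm p \<phi>"
  define Q where "Q = (lp_norm 2 \<phi>)\<^sup>2"
  have N: "N > 0" unfolding N_def by (rule pos[OF \<phi> nontriv])
  have Q: "Q > 0" unfolding Q_def using nontrivial_lp_norm_2[OF l2(1)[OF \<phi>] nontriv] by simp
  have QQ: "pairing \<phi> \<phi> = complex_of_real Q"
    by (simp add: Q_def pairing_self[OF l2(1)[OF \<phi>]])
  have pairing_add: "pairing (\<lambda>z. a * g z + b * h z) \<phi> = a * pairing g \<phi> + b * pairing h \<phi>"
    if "g \<in> hardy p" "h \<in> hardy p" for a b g h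
    using pairing_lp2(1)[OF l2(1)[OF that(1)] l2(1)[OF \<phi>]] pairing_lp2(1)[OF l2(1)[OF that(2)] l2(1)[OF \<phi>]]
    by (simp add: pairing_def distrib_right mult.assoc)
  have dual: "in_hardy_dual p \<phi>"
    unfolding in_hardy_dual_def if_not_P[OF not_less]
  proof (intro exI[of _ "lp_norm 2 \<phi>"] ballI conjI)
    fix g :: "('d \<Rightarrow> complex) \<Rightarrow> complex" assume g: "g \<in> hardy p"
    show "integrable torus_haar (\<lambda>z. g z * cnj (\<phi> z))"
      by (rule pairing_lp2(1)[OF l2(1)[OF g] l2(1)[OF \<phi>]])
    have "cmod (pairing g \<phi>) \<le> lp_norm 2 g * lp_norm 2 \<phi>"
      by (rule pairing_lp2(2)[OF l2(1)[OF g] l2(1)[OF \<phi>]])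
    also have "\<dots> \<le> lp_norm 2 \<phi> * lp_norm p g"
      using l2(2)[OF g] nontrivial_lp_norm_2[OF l2(1)[OF \<phi>] nontriv] by (simp add: mult.commute)
    finally show "cmod (pairing g \<phi>) \<le> lp_norm 2 \<phi> * lp_norm p g" .
  qed
  have D: "hardy_dual_norm p \<phi> = (SUP g\<in>{g \<in> hardy p. nontrivial g}. ereal (cmod (pairing g \<phi>) / lp_norm p g))"
    using dual not_less by (simp add: hardy_dual_norm_def dual_pairing_def)
  have "hilbert_point p \<phi> \<longleftrightarrow> ereal N * hardy_dual_norm p \<phi> = ereal Q"
  proof
    assume hp: "hilbert_point p \<phi>"
    have "hardy_dual_norm p \<phi> = ereal (Q / N)"
      unfolding D
    proof (rule antisym)
      show "(SUP g\<in>{g \<in> hardy p. nontrivial g}. ereal (cmod (pairing g \<phi>) / lp_norm p g)) \<le> ereal (Q / N)"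
      proof (rule SUP_least)
        fix g :: "('d \<Rightarrow> complex) \<Rightarrow> complex" assume "g \<in> {g \<in> hardy p. nontrivial g}"
        then have g: "g \<in> hardy p" "lp_norm p g > 0" using pos by auto
        show "ereal (cmod (pairing g \<phi>) / lp_norm p g) \<le> ereal (Q / N)"
        proof (cases "pairing g \<phi> = 0")
          case True
          then show ?thesis using N Q by simp
        next
          case False
          \<comment> \<open>Scaling \<open>g\<close> to have pairing \<open>Q\<close> with
            \<open>\<phi>\<close> makes \<open>a * g - \<phi>\<close> an admissible
            perturbation.\<close>
          define a where "a = complex_of_real Q / pairing g \<phi>"
          have a: "a \<noteq> 0" "a * pairing g \<phi> = complex_of_real Q" using False Q by (auto simp: a_def)
          have f: "(\<lambda>z. a * g z + (-1) * \<phi> z) \<in> hardy p"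
            by (intro hardy_add hardy_scale p1 g \<phi>)
          have "pairing (\<lambda>z. a * g z + (-1) * \<phi> z) \<phi> = 0"
            unfolding pairing_add[OF g(1) \<phi>] by (simp add: a QQ)
          then have "hardy_orthogonal p (\<lambda>z. a * g z + (-1) * \<phi> z) \<phi>"
            using not_less by (simp add: hardy_orthogonal_def)
          then have "N \<le> lp_norm p (\<lambda>z. \<phi> z + (a * g z + (-1) * \<phi> z))"
            using hp f unfolding hilbert_point_def N_def by blast
          also have "\<dots> = cmod a * lp_norm p g" using lp_norm_scale[OF p1 g(1) a(1)] by simp
          also have "\<dots> = Q / cmod (pairing g \<phi>) * lp_norm p g" using Q by (simp add: a_def norm_divide)
          finally show ?thesis using N g(2) False by (simp add: field_simps)
        qed
      qed
      have "ereal (Q / N) = ereal (cmod (pairing \<phi> \<phi>) / lp_norm p \<phi>)" using Q by (simp add: QQ N_def)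
      also have "\<dots> \<le> (SUP g\<in>{g \<in> hardy p. nontrivial g}. ereal (cmod (pairing g \<phi>) / lp_norm p g))"
        using \<phi> nontriv by (intro SUP_upper) simp
      finally show "ereal (Q / N) \<le> (SUP g\<in>{g \<in> hardy p. nontrivial g}. ereal (cmod (pairing g \<phi>) / lp_norm p g))" .
    qed
    then show "ereal N * hardy_dual_norm p \<phi> = ereal Q" using N by simp
  next
    assume eq: "ereal N * hardy_dual_norm p \<phi> = ereal Q"
    show "hilbert_point p \<phi>"
      unfolding hilbert_point_def
    proof (intro conjI ballI impI \<phi> nontriv)
      fix f :: "('d \<Rightarrow> complex) \<Rightarrow> complex" assume f: "f \<in> hardy p" and "hardy_orthogonal p f \<phi>"
      then have "pairing f \<phi> = 0" using not_less by (simp add: hardy_orthogonal_def)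
      then have pair: "pairing (\<lambda>z. \<phi> z + f z) \<phi> = complex_of_real Q"
        using pairing_add[OF \<phi> f, of 1 1] by (simp add: QQ)
      have h: "(\<lambda>z. \<phi> z + f z) \<in> hardy p" by (rule hardy_add[OF p1 \<phi> f])
      have nt: "nontrivial (\<lambda>z. \<phi> z + f z)"
        unfolding nontrivial_def
      proof
        assume "AE z in torus_haar. \<phi> z + f z = 0"
        then have "AE z in torus_haar. (\<phi> z + f z) * cnj (\<phi> z) = 0" by eventually_elim simp
        then have "pairing (\<lambda>z. \<phi> z + f z) \<phi> = 0"
          unfolding pairing_def by (rule integral_eq_zero_AE)
        then show False using pair Q by simp
      qed
      have "ereal (cmod (pairing (\<lambda>z. \<phi> z + f z) \<phi>) / lp_norm p (\<lambda>z. \<phi> z + f z)) \<le> hardy_dual_norm p \<phi>"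
        unfolding D using h nt by (intro SUP_upper) simp
      then have "N \<le> lp_norm p (\<lambda>z. \<phi> z + f z)"
        using Q by (intro norm_le_of_dual_norm[OF N Q pos[OF h nt] eq]) (simp add: pair)
      then show "lp_norm p \<phi> \<le> lp_norm p (\<lambda>z. \<phi> z + f z)" by (simp add: N_def)
    qed
  qed
  then show ?thesis by (simp add: N_def Q_def)
qed

text \<open>Existence of the limit along one sequence suffices, because \<open>in_hardy_dual\<close> makes the
  functional continuous on polynomials.\<close>

lemma dual_pairing_eqI:
  assumes p: "1 \<le> p" "p < 2" and C: "\<And>g. g \<in> analytic_polys \<Longrightarrow> cmod (pairing g \<phi>) \<le> C * lp_norm (ereal p) g"
    and \<phi>: "integrable torus_haar \<phi>"
    and H: "\<And>n. H n \<in> analytic_polys" "lp_tendsto (ereal p) H g" "(\<lambda>n. pairing (H n) \<phi>) \<longlonglongrightarrow> c"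
  shows "dual_pairing (ereal p) g \<phi> = c"
proof -
  have p0: "0 < p" using p by simp
  have "(\<lambda>n. pairing (G n) \<phi>) \<longlonglongrightarrow> c" if G: "\<And>n. G n \<in> analytic_polys" "lp_tendsto (ereal p) G g" for G
  proof -
    have "lp_tendsto (ereal p) (\<lambda>n z. G n z + (-1) * H n z) (\<lambda>z. g z + (-1) * g z)"
      by (intro lp_tendsto_add lp_tendsto_scale p0 G H)
    then have lim: "(\<lambda>n. lp_norm (ereal p) (\<lambda>z. G n z - H n z)) \<longlonglongrightarrow> 0"
      by (simp add: lp_tendsto_def)
    have "(\<lambda>n. pairing (\<lambda>z. G n z - H n z) \<phi>) \<longlonglongrightarrow> 0"
    proof (rule tendsto_norm_zero_cancel, rule tendsto_sandwich[OF _ _ tendsto_const])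
      show "\<forall>\<^sub>F n in sequentially. cmod (pairing (\<lambda>z. G n z - H n z) \<phi>) \<le> C * lp_norm (ereal p) (\<lambda>z. G n z - H n z)"
        using G(1) H(1) unfolding analytic_polys_eq
        by (intro always_eventually allI C[unfolded analytic_polys_eq] trig_polys_diff)
      show "(\<lambda>n. C * lp_norm (ereal p) (\<lambda>z. G n z - H n z)) \<longlonglongrightarrow> 0"
        using tendsto_mult_left[OF lim, of C] by simp
    qed simp
    moreover have "pairing (\<lambda>z. G n z - H n z) \<phi> = pairing (G n) \<phi> - pairing (H n) \<phi>" for n
      using integrable_trig_poly_mult[OF _ \<phi>] G(1)[of n] H(1)[of n]
      unfolding analytic_polys_eq pairing_def left_diff_distrib by (intro Bochner_Integration.integral_diff) auto
    ultimately have "(\<lambda>n. pairing (G n) \<phi> - pairing (H n) \<phi>) \<longlonglongrightarrow> 0" by simp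
    from tendsto_add[OF this H(3)] show ?thesis by simp
  qed
  then have "(THE c. \<forall>G. (\<forall>n. G n \<in> analytic_polys) \<and> lp_tendsto (ereal p) G g \<longrightarrow> (\<lambda>n. pairing (G n) \<phi>) \<longlonglongrightarrow> c) = c"
    using H LIMSEQ_unique by (intro the_equality) blast+
  then show ?thesis using p by (simp add: dual_pairing_def)
qed

text \<open>Below 2 the functional on H^p is defined only as a limit. At a Hilbert point it is
  pairing with the dual function divided by \<open>c\<close>, so Holder computes its norm and
  \<open>\<phi>\<close> attains it. Conversely, finiteness of the dual norm supplies the continuity
  with which a perturbation of \<open>\<phi>\<close> is evaluated.\<close>

lemma hilbert_point_iff_dual_norm_less_2:
  fixes \<phi> :: "('d::finite \<Rightarrow> complex) \<Rightarrow> complex"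
  assumes p: "1 \<le> p" "p < 2" and \<phi>: "\<phi> \<in> hardy (ereal p)" and \<phi>2: "\<phi> \<in> lp_space 2" and nontriv: "nontrivial \<phi>"
  shows "hilbert_point (ereal p) \<phi> \<longleftrightarrow>
    ereal (lp_norm (ereal p) \<phi>) * hardy_dual_norm (ereal p) \<phi> = ereal ((lp_norm 2 \<phi>)\<^sup>2)"
proof -
  have p0: "0 < p" using p by simp
  have e2: "ereal p < 2" using p by simp
  have p1: "1 \<le> ereal p" using p by simp
  have \<phi>l: "\<phi> \<in> lp_space (ereal p)" using \<phi> by (simp add: hardy_def)
  have \<phi>i: "integrable torus_haar \<phi>" by (rule hardy_integrable[OF p(1) \<phi>])
  define N where "N = lp_norm (ereal p) \<phi>"
  define Q where "Q = (lp_norm 2 \<phi>)\<^sup>2"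
  have N: "N > 0" unfolding N_def by (rule lp_norm_pos[OF p(1) \<phi> nontriv])
  have Q: "Q > 0" unfolding Q_def using nontrivial_lp_norm_2[OF \<phi>2 nontriv] by simp
  have QQ: "pairing \<phi> \<phi> = complex_of_real Q"
    by (simp add: Q_def pairing_self[OF \<phi>2])
  have poly_int: "integrable torus_haar (\<lambda>z. g z * cnj (\<phi> z))" if "g \<in> analytic_polys" for g
    using integrable_trig_poly_mult[OF _ \<phi>i] that by (simp add: analytic_polys_eq)
  have fejer_poly: "fejer n g \<in> analytic_polys" if "g \<in> hardy (ereal p)" for n and g :: "('d \<Rightarrow> complex) \<Rightarrow> complex"
    using hardy_fejer[OF that] by (simp add: analytic_polys_eq)
  have fejer_lim: "lp_tendsto (ereal p) (\<lambda>n. fejer (Suc n) g) g" if "g \<in> hardy (ereal p)" for g :: "('d \<Rightarrow> complex) \<Rightarrow> complex"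
    using that by (intro fejer_tendsto p) (simp add: hardy_def)
  have fejer_Q: "(\<lambda>n. pairing (fejer (Suc n) \<phi>) \<phi>) \<longlonglongrightarrow> complex_of_real Q"
    unfolding QQ[symmetric] using fejer_tendsto[of 2 \<phi>] \<phi>2 by (intro pairing_tendsto_lp2) simp_all
  have "hilbert_point (ereal p) \<phi> \<longleftrightarrow> ereal N * hardy_dual_norm (ereal p) \<phi> = ereal Q"
  proof
    assume "hilbert_point (ereal p) \<phi>"
    then obtain c where c: "c > 0" "hilbert_eigen p c \<phi>"
      using hilbert_point_imp_hilbert_eigen[OF p(1) \<phi> nontriv] by blast
    let ?\<psi> = "duality_map p \<phi>"
    have pair: "pairing g \<phi> = pairing g ?\<psi> / complex_of_real c" if "g \<in> analytic_polys" for g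
      using hilbert_eigen_pairing[OF p(1) \<phi> nontriv c(2), of g] that c(1) by (simp add: analytic_polys_eq)
    have bound: "cmod (pairing g ?\<psi> / complex_of_real c) \<le> N powr (p - 1) / c * lp_norm (ereal p) g"
      if "g \<in> lp_space (ereal p)" for g
      using pairing_duality_map(2)[OF p(1) \<phi>l that] c(1)
      by (simp add: norm_divide divide_right_mono N_def mult.commute)
    have poly_bound: "cmod (pairing g \<phi>) \<le> N powr (p - 1) / c * lp_norm (ereal p) g" if "g \<in> analytic_polys" for g
      using bound[OF trig_polys_lp[OF that[unfolded analytic_polys_eq]]] p0 unfolding pair[OF that] by simp
    have dual: "in_hardy_dual (ereal p) \<phi>"
      unfolding in_hardy_dual_def if_P[OF e2] using poly_int poly_bound by blast
    have dp: "dual_pairing (ereal p) g \<phi> = pairing g ?\<psi> / complex_of_real c" if g: "g \<in> hardy (ereal p)" for g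
    proof (rule dual_pairing_eqI[OF p poly_bound \<phi>i fejer_poly[OF g] fejer_lim[OF g]])
      have "(\<lambda>n. pairing (fejer (Suc n) g) ?\<psi> / complex_of_real c) \<longlonglongrightarrow> pairing g ?\<psi> / complex_of_real c"
        using c(1) by (intro tendsto_divide tendsto_const pairing_duality_map_tendsto[OF p(1) \<phi>l fejer_lim[OF g]]) simp
      then show "(\<lambda>n. pairing (fejer (Suc n) g) \<phi>) \<longlonglongrightarrow> pairing g ?\<psi> / complex_of_real c"
        by (simp add: pair[OF fejer_poly[OF g]])
    qed
    \<comment> \<open>The functional is evaluated at \<open>\<phi>\<close> a second time, now by
      convergence in L^2. Comparison with \<open>dp\<close> eliminates \<open>c\<close> and yields
      \<open>QN\<close>.\<close>
    have dQ: "dual_pairing (ereal p) \<phi> \<phi> = complex_of_real Q"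
      by (rule dual_pairing_eqI[OF p poly_bound \<phi>i fejer_poly[OF \<phi>] fejer_lim[OF \<phi>] fejer_Q])
    have "Q = Ip p \<phi> / c"
      using dQ dp[OF \<phi>] c(1)
      by (simp add: pairing_self_duality_map[OF p(1) \<phi>l] flip: of_real_divide)
    then have QN: "Q = N powr (p - 1) / c * N"
      using Ip_eq_norm_mult[OF p(1) \<phi> nontriv] by (simp add: N_def)
    have "hardy_dual_norm (ereal p) \<phi> = (SUP g\<in>{g \<in> hardy (ereal p). nontrivial g}. ereal (cmod (dual_pairing (ereal p) g \<phi>) / lp_norm (ereal p) g))"
      using dual by (simp add: hardy_dual_norm_def)
    also have "\<dots> = ereal (Q / N)"
    proof (rule antisym)
      show "(SUP g\<in>{g \<in> hardy (ereal p). nontrivial g}. ereal (cmod (dual_pairing (ereal p) g \<phi>) / lp_norm (ereal p) g)) \<le> ereal (Q / N)"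
      proof (rule SUP_least)
        fix g :: "('d \<Rightarrow> complex) \<Rightarrow> complex" assume "g \<in> {g \<in> hardy (ereal p). nontrivial g}"
        then have g: "g \<in> hardy (ereal p)" "nontrivial g" by auto
        have "cmod (dual_pairing (ereal p) g \<phi>) \<le> N powr (p - 1) / c * lp_norm (ereal p) g"
          unfolding dp[OF g(1)] using g(1) by (intro bound) (simp add: hardy_def)
        then have "cmod (dual_pairing (ereal p) g \<phi>) / lp_norm (ereal p) g \<le> N powr (p - 1) / c"
          using lp_norm_pos[OF p(1) g] by (simp add: pos_divide_le_eq)
        also have "N powr (p - 1) / c = Q / N" using QN N by simp
        finally show "ereal (cmod (dual_pairing (ereal p) g \<phi>) / lp_norm (ereal p) g) \<le> ereal (Q / N)" by simp
      qed
      have "ereal (Q / N) = ereal (cmod (dual_pairing (ereal p) \<phi> \<phi>) / lp_norm (ereal p) \<phi>)" using Q by (simp add: dQ N_def)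
      also have "\<dots> \<le> (SUP g\<in>{g \<in> hardy (ereal p). nontrivial g}. ereal (cmod (dual_pairing (ereal p) g \<phi>) / lp_norm (ereal p) g))"
        using \<phi> nontriv by (intro SUP_upper) simp
      finally show "ereal (Q / N) \<le> (SUP g\<in>{g \<in> hardy (ereal p). nontrivial g}. ereal (cmod (dual_pairing (ereal p) g \<phi>) / lp_norm (ereal p) g))" .
    qed
    finally show "ereal N * hardy_dual_norm (ereal p) \<phi> = ereal Q" using N by simp
  next
    assume eq: "ereal N * hardy_dual_norm (ereal p) \<phi> = ereal Q"
    \<comment> \<open>An unbounded functional has dual norm infinity, and its product with
      \<open>N > 0\<close> could not be the finite number \<open>Q\<close>.\<close>
    have dual: "in_hardy_dual (ereal p) \<phi>"
    proof (rule ccontr)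
      assume "\<not> in_hardy_dual (ereal p) \<phi>"
      then show False using eq N by (simp add: hardy_dual_norm_def)
    qed
    then obtain C where C: "\<And>g. g \<in> analytic_polys \<Longrightarrow> cmod (pairing g \<phi>) \<le> C * lp_norm (ereal p) g"
      unfolding in_hardy_dual_def if_P[OF e2] by blast
    show "hilbert_point (ereal p) \<phi>"
      unfolding hilbert_point_def
    proof (intro conjI ballI impI \<phi> nontriv)
      fix f :: "('d \<Rightarrow> complex) \<Rightarrow> complex" assume f: "f \<in> hardy (ereal p)" and "hardy_orthogonal (ereal p) f \<phi>"
      then obtain G where G: "\<And>n. G n \<in> analytic_polys" "\<And>n. pairing (G n) \<phi> = 0" "lp_tendsto (ereal p) G f"
        using e2 by (auto simp: hardy_orthogonal_def)
      define g where "g = (\<lambda>z. \<phi> z + f z)"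
      have g: "g \<in> hardy (ereal p)" unfolding g_def by (rule hardy_add[OF p1 \<phi> f])
      \<comment> \<open>Polynomials converging to \<open>\<phi> + f\<close> whose pairings tend to
        \<open>Q\<close>: the Fejer means contribute the limit, and the summands \<open>G n\<close>
        are orthogonal to \<open>\<phi>\<close>.\<close>
      define H where "H n = (\<lambda>z. fejer (Suc n) \<phi> z + G n z)" for n
      have H: "H n \<in> analytic_polys" for n
        unfolding H_def using fejer_poly[OF \<phi>] G(1) by (simp add: analytic_polys_eq trig_polys_add)
      have H_lim: "lp_tendsto (ereal p) H g"
        unfolding H_def[abs_def] g_def by (intro lp_tendsto_add p0 fejer_lim \<phi> G)
      have "pairing (H n) \<phi> = pairing (fejer (Suc n) \<phi>) \<phi>" for n
        using G(2)[of n] poly_int[OF fejer_poly[OF \<phi>]] poly_int[OF G(1)]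
        by (simp add: H_def pairing_def distrib_right)
      then have H_Q: "(\<lambda>n. pairing (H n) \<phi>) \<longlonglongrightarrow> complex_of_real Q" using fejer_Q by simp
      have dp: "dual_pairing (ereal p) g \<phi> = complex_of_real Q"
        by (rule dual_pairing_eqI[OF p C \<phi>i H H_lim H_Q])
      \<comment> \<open>The supremum ranges over nontrivial functions. If \<open>g\<close> were zero
        almost everywhere, the norms of \<open>H n\<close> would tend to 0 and boundedness would
        force the pairings to 0 instead of \<open>Q\<close>.\<close>
      have nt: "nontrivial g"
        unfolding nontrivial_def
      proof
        assume AE: "AE z in torus_haar. g z = 0"
        have "Ip p (\<lambda>z. H n z - g z) = Ip p (H n)" for n
        proof (rule integral_cong_AE)
          have "H n \<in> borel_measurable torus_haar" "g \<in> borel_measurable torus_haar"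
            using H_lim by (auto simp: lp_tendsto_def intro: lp_measurable)
          then show "(\<lambda>z. cmod (H n z - g z) powr p) \<in> borel_measurable torus_haar"
            "(\<lambda>z. cmod (H n z) powr p) \<in> borel_measurable torus_haar" by measurable
        qed (use AE in eventually_elim, simp)
        then have lim0: "(\<lambda>n. lp_norm (ereal p) (H n)) \<longlonglongrightarrow> 0"
          using H_lim by (simp add: lp_tendsto_def lp_norm_ereal)
        have "(\<lambda>n. pairing (H n) \<phi>) \<longlonglongrightarrow> 0"
        proof (rule tendsto_norm_zero_cancel, rule tendsto_sandwich[OF _ _ tendsto_const])
          show "\<forall>\<^sub>F n in sequentially. cmod (pairing (H n) \<phi>) \<le> C * lp_norm (ereal p) (H n)"
            by (intro always_eventually allI C H)
          show "(\<lambda>n. C * lp_norm (ereal p) (H n)) \<longlonglongrightarrow> 0"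
            using tendsto_mult_left[OF lim0, of C] by simp
        qed simp
        then show False using LIMSEQ_unique[OF H_Q] Q by fastforce
      qed
      have "ereal (cmod (dual_pairing (ereal p) g \<phi>) / lp_norm (ereal p) g) \<le> hardy_dual_norm (ereal p) \<phi>"
        unfolding hardy_dual_norm_def if_P[OF dual] using g nt by (intro SUP_upper) simp
      then have "N \<le> lp_norm (ereal p) g"
        using Q by (intro norm_le_of_dual_norm[OF N Q lp_norm_pos[OF p(1) g nt] eq]) (simp add: dp)
      then show "lp_norm (ereal p) \<phi> \<le> lp_norm (ereal p) (\<lambda>z. \<phi> z + f z)" by (simp add: N_def g_def)
    qed
  qed
  then show ?thesis by (simp add: N_def Q_def)
qed

theorem theorem2p2:
  "(\<forall>(p::real) (\<phi> :: ('d::finite \<Rightarrow> complex) \<Rightarrow> complex).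
      1 \<le> p \<longrightarrow> \<phi> \<in> hardy (ereal p) \<longrightarrow> nontrivial \<phi> \<longrightarrow>
      (hilbert_point (ereal p) \<phi> \<longleftrightarrow>
        (\<exists>c::real. c > 0 \<and>
          is_riesz_proj (\<lambda>z. complex_of_real (cmod (\<phi> z) powr (p - 2)) * \<phi> z)
            (\<lambda>z. complex_of_real c * \<phi> z)))) \<and>
   (\<forall>(p::ereal) (\<phi> :: ('d \<Rightarrow> complex) \<Rightarrow> complex).
      1 \<le> p \<longrightarrow> \<phi> \<in> hardy p \<inter> hardy 2 \<longrightarrow> nontrivial \<phi> \<longrightarrow>
      (hilbert_point p \<phi> \<longleftrightarrow>
        ereal (lp_norm p \<phi>) * hardy_dual_norm p \<phi> = ereal ((lp_norm 2 \<phi>)\<^sup>2)))"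
proof (intro conjI allI impI)
  fix p :: real and \<phi> :: "('d \<Rightarrow> complex) \<Rightarrow> complex"
  assume "1 \<le> p" "\<phi> \<in> hardy (ereal p)" "nontrivial \<phi>"
  then show "hilbert_point (ereal p) \<phi> \<longleftrightarrow>
        (\<exists>c::real. c > 0 \<and>
          is_riesz_proj (\<lambda>z. complex_of_real (cmod (\<phi> z) powr (p - 2)) * \<phi> z)
            (\<lambda>z. complex_of_real c * \<phi> z))"
    using hilbert_point_iff_riesz_proj[of p \<phi>] by (simp add: duality_map_def)
next
  fix p :: ereal and \<phi> :: "('d \<Rightarrow> complex) \<Rightarrow> complex"
  assume p: "1 \<le> p" and \<phi>: "\<phi> \<in> hardy p \<inter> hardy 2" and nontriv: "nontrivial \<phi>"
  show "hilbert_point p \<phi> \<longleftrightarrow>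
        ereal (lp_norm p \<phi>) * hardy_dual_norm p \<phi> = ereal ((lp_norm 2 \<phi>)\<^sup>2)"
  proof (cases "2 \<le> p")
    case True
    then show ?thesis using \<phi> nontriv by (intro hilbert_point_iff_dual_norm_ge_2) auto
  next
    case False
    then obtain r where "p = ereal r" "1 \<le> r" "r < 2" using p by (cases p) auto
    then show ?thesis
      using \<phi> nontriv hilbert_point_iff_dual_norm_less_2[of r \<phi>] by (auto simp: hardy_def)
  qed
qed

end
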